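(* Let $(\Omega,m)$ be a $\sigma$-finite measure space. Let $T_0$ be a positive $C_0$-semigroup on $L_2(m)$ with generator $A_0$, and $T$ a positive $C_0$-semigroup on $L_2(m)$ with generator $A$. Assume there exist $M\geq 1$ and $\omega\in\mathbb{R}$ such that for all $t\geq 0$ $$\|T(t)u\|_1\leq Me^{\omega t}\|u\|_1\quad(u\in L_2(m)\cap L_1(m)),\qquad \|T_0(t)^*v\|_1\leq Me^{\omega t}\|v\|_1\quad(v\in L_2(m)\cap L_1(m)).$$ Then the following are equivalent: (a) There exists $C_1\in\mathbb{R}$ such that for $t\geq 0$ we have $$T(t)u\leq T_0(t)u+C_1te^{\omega t}\|u\|_1\mathbf{1}_\Omega\quad(0\leq u\in L_2(m)\cap L_1(m)).$$ (b) There exists $C_2\in\mathbb{R}$ such that $$(Au\,|\,v)\leq (u\,|\,A_0^*v)+C_2\|u\|_1\|v\|_1\quad(0\leq u\in D(A)\cap L_1(m),\ 0\leq v\in D(A_0^* )\cap L_1(m)).$$ (c) There exists $C_3\in\mathbb{R}$ such that for $\lambda>\omega$ we have $$(\lambda-A)^{-1}u\leq(\lambda-A_0)^{-1}u+\frac{C_3}{(\lambda-\omega)^2}\|u\|_1\mathbf{1}_\Omega\quad(0\leq u\in L_2(m)\cap L_1(m)).$$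
   Context: $(\cdot\,|\,\cdot)$ is the inner product of $L_2(m)$, $\|\cdot\|_1$ is the norm of $L_1(m)$, and $\mathbf{1}_\Omega$ is the constant function $1$ on $\Omega$. Order relations between functions hold $m$-almost everywhere. A semigroup $S$ on $L_2(m)$ is positive if $S(t)u\geq 0$ for all $t\geq 0$ and $0\leq u\in L_2(m)$. A $C_0$-semigroup is a strongly continuous semigroup; the generator $A$ of a $C_0$-semigroup $T$ is $Au=\lim_{t\to0}\frac1t(T(t)u-u)$, defined on the set $D(A)$ of those $u\in L_2(m)$ for which the limit exists in $L_2(m)$. $T_0(t)^*$ and $A_0^*$ are the adjoints in $L_2(m)$; $A_0^*$ generates the $C_0$-semigroup $(T_0(t)^* )_{t\ge0}$. $(\lambda-A)^{-1}$ and $(\lambda-A_0)^{-1}$ are the resolvents of $A$ and $A_0$.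
   Formalization: In (c), λ > ω is restricted to those λ with [λ,∞) in the resolvent sets of both A and A_0, since the L_2-resolvents need not exist for every λ > ω; if they do, (c) is unchanged. L_1(m) and L_2(m) are taken real. *)

theory Defs
  imports "HOL-Analysis.Analysis"
begin

text \<open>
  Elements of (real) \<open>L\<^sub>1(m)\<close> and \<open>L\<^sub>2(m)\<close> are given by representatives, functions
  \<open>'a \<Rightarrow> real\<close>; equality and order of elements are equality and order almost everywhere.
\<close>

definition L1 :: "'a measure \<Rightarrow> ('a \<Rightarrow> real) set" where
  "L1 m = {u. integrable m u}"

definition norm1 :: "'a measure \<Rightarrow> ('a \<Rightarrow> real) \<Rightarrow> real" where
  "norm1 m u = (\<integral>x. \<bar>u x\<bar> \<partial>m)"

definition L2 :: "'a measure \<Rightarrow> ('a \<Rightarrow> real) set" where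
  "L2 m = {u \<in> borel_measurable m. integrable m (\<lambda>x. (u x)\<^sup>2)}"

definition inner2 :: "'a measure \<Rightarrow> ('a \<Rightarrow> real) \<Rightarrow> ('a \<Rightarrow> real) \<Rightarrow> real" where
  "inner2 m u v = (\<integral>x. u x * v x \<partial>m)"

definition norm2 :: "'a measure \<Rightarrow> ('a \<Rightarrow> real) \<Rightarrow> real" where
  "norm2 m u = sqrt (inner2 m u u)"

definition nonneg_ae :: "'a measure \<Rightarrow> ('a \<Rightarrow> real) \<Rightarrow> bool" where
  "nonneg_ae m u \<longleftrightarrow> (AE x in m. 0 \<le> u x)"

text \<open>
  A bounded linear operator on \<open>L\<^sub>2(m)\<close> acts on representatives and respects equality almost
  everywhere; its values outside \<open>L2 m\<close> are irrelevant.
\<close>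

definition bounded_op :: "'a measure \<Rightarrow> (('a \<Rightarrow> real) \<Rightarrow> ('a \<Rightarrow> real)) \<Rightarrow> bool" where
  "bounded_op m S \<longleftrightarrow>
     (\<forall>u\<in>L2 m. S u \<in> L2 m) \<and>
     (\<forall>u\<in>L2 m. \<forall>v\<in>L2 m. (AE x in m. u x = v x) \<longrightarrow> (AE x in m. S u x = S v x)) \<and>
     (\<forall>a b. \<forall>u\<in>L2 m. \<forall>v\<in>L2 m.
        AE x in m. S (\<lambda>y. a * u y + b * v y) x = a * S u x + b * S v x) \<and>
     (\<exists>C. \<forall>u\<in>L2 m. norm2 m (S u) \<le> C * norm2 m u)"

text \<open>Only the values of a semigroup at times \<open>t \<ge> 0\<close> matter.\<close>

definition C0_semigroup :: "'a measure \<Rightarrow> (real \<Rightarrow> ('a \<Rightarrow> real) \<Rightarrow> ('a \<Rightarrow> real)) \<Rightarrow> bool" where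
  "C0_semigroup m T \<longleftrightarrow>
     (\<forall>t\<ge>0. bounded_op m (T t)) \<and>
     (\<forall>u\<in>L2 m. AE x in m. T 0 u x = u x) \<and>
     (\<forall>s\<ge>0. \<forall>t\<ge>0. \<forall>u\<in>L2 m. AE x in m. T (s + t) u x = T s (T t u) x) \<and>
     (\<forall>u\<in>L2 m. \<forall>t\<ge>0.
        ((\<lambda>s. norm2 m (\<lambda>x. T s u x - T t u x)) \<longlongrightarrow> 0) (at t within {0..}))"

definition positive_semigroup ::
    "'a measure \<Rightarrow> (real \<Rightarrow> ('a \<Rightarrow> real) \<Rightarrow> ('a \<Rightarrow> real)) \<Rightarrow> bool" where
  "positive_semigroup m T \<longleftrightarrow> (\<forall>t\<ge>0. \<forall>u\<in>L2 m. nonneg_ae m u \<longrightarrow> nonneg_ae m (T t u))"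

text \<open>
  A possibly unbounded operator in \<open>L\<^sub>2(m)\<close> is given by its graph, a set of pairs of
  representatives. Its domain is \<open>Domain A\<close>, and \<open>op_apply A u\<close> is the value at \<open>u \<in> Domain A\<close>;
  as values are determined only almost everywhere, some representative is chosen.
\<close>

type_synonym 'a l2op = "(('a \<Rightarrow> real) \<times> ('a \<Rightarrow> real)) set"

definition op_apply :: "'a l2op \<Rightarrow> ('a \<Rightarrow> real) \<Rightarrow> ('a \<Rightarrow> real)" where
  "op_apply A u = (SOME f. (u, f) \<in> A)"

definition graph_of :: "'a measure \<Rightarrow> (('a \<Rightarrow> real) \<Rightarrow> ('a \<Rightarrow> real)) \<Rightarrow> 'a l2op" where
  "graph_of m S = {(u, f). u \<in> L2 m \<and> f \<in> L2 m \<and> (AE x in m. f x = S u x)}"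

definition generator :: "'a measure \<Rightarrow> (real \<Rightarrow> ('a \<Rightarrow> real) \<Rightarrow> ('a \<Rightarrow> real)) \<Rightarrow> 'a l2op" where
  "generator m T = {(u, f). u \<in> L2 m \<and> f \<in> L2 m \<and>
     ((\<lambda>t. norm2 m (\<lambda>x. (T t u x - u x) / t - f x)) \<longlongrightarrow> 0) (at_right 0)}"

definition adjoint_op :: "'a measure \<Rightarrow> 'a l2op \<Rightarrow> 'a l2op" where
  "adjoint_op m A = {(v, g). v \<in> L2 m \<and> g \<in> L2 m \<and>
     (\<forall>(u, f)\<in>A. inner2 m f v = inner2 m u g)}"

text \<open>The graph of \<open>(\<lambda> - A)\<^sup>-\<^sup>1\<close>.\<close>

definition resolvent :: "'a measure \<Rightarrow> 'a l2op \<Rightarrow> real \<Rightarrow> 'a l2op" where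
  "resolvent m A lam = {(f, w). f \<in> L2 m \<and>
     (\<exists>g. (w, g) \<in> A \<and> (AE x in m. lam * w x - g x = f x))}"

text \<open>
  The real part of the resolvent set: \<open>\<lambda> - A\<close> is onto \<open>L\<^sub>2(m)\<close> and has a bounded inverse. For
  linear \<open>A\<close> the bound contains the injectivity of \<open>\<lambda> - A\<close>.
\<close>

definition resolvent_set :: "'a measure \<Rightarrow> 'a l2op \<Rightarrow> real set" where
  "resolvent_set m A = {lam. Domain (resolvent m A lam) = L2 m \<and>
     (\<exists>C. \<forall>(f, w)\<in>resolvent m A lam. norm2 m w \<le> C * norm2 m f)}"

text \<open>
  The bounds \<open>M e\<^bsup>\<omega>t\<^esup>\<close> on \<open>L\<^sub>1(m)\<close> for \<open>T\<close> and the adjoint of \<open>T0\<close> do not control the growth of \<open>T\<close>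
  and \<open>T0\<close> on \<open>L\<^sub>2(m)\<close>, so a number \<open>\<lambda> > \<omega>\<close> may belong to the \<open>L\<^sub>2\<close>-spectrum, or lie below it, where
  the resolvent is not the Laplace transform of the semigroup. The set below consists of the \<open>\<lambda>\<close>
  to the right of the real spectrum of both operators; it contains all \<open>\<lambda> > \<omega>\<close> as soon as both
  resolvents exist for all \<open>\<lambda> > \<omega>\<close>.
\<close>

definition right_of_spectra :: "'a measure \<Rightarrow> 'a l2op \<Rightarrow> 'a l2op \<Rightarrow> real set" where
  "right_of_spectra m A B = {lam. {lam..} \<subseteq> resolvent_set m A \<inter> resolvent_set m B}"

end

theory Submission
  imports Defs
begin

text \<open>
  (b) is the infinitesimal form of both (a) and (c). From (a) it follows by pairing difference
  quotients at \<open>t = 0\<close> with \<open>v\<close>, from (c) by pairing \<open>\<lambda> (\<lambda> (\<lambda> - A)\<^sup>-\<^sup>1 u - u)\<close> with \<open>v\<close> and letting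
  \<open>\<lambda>\<close> tend to infinity. Conversely, (b) bounds the derivative of
  \<open>(T(s)u | T0(t - s)\<^sup>* v)\<close> in \<open>s\<close>, and integration over \<open>[0, t]\<close> yields (a); applied to
  \<open>(\<lambda> - A)\<^sup>-\<^sup>1 u\<close> and \<open>(\<lambda> - A0\<^sup>*)\<^sup>-\<^sup>1 v\<close>, whose \<open>L\<^sub>1\<close>-norms are at most \<open>M / (\<lambda> - \<omega>)\<close> times those of
  \<open>u\<close> and \<open>v\<close>, it yields (c). For \<open>\<lambda>\<close> below the growth bound of the semigroups this \<open>L\<^sub>1\<close>-bound rests
  on positivity: the resolvent stays positive to the right of the real spectrum, and there it is
  still the Laplace transform of the semigroup.

  Vector-valued integrals are defined by duality, through the Riesz representation of functionals
  on \<open>L\<^sub>2\<close>. Hence only integrals of real functions occur.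
\<close>

section \<open>The Hilbert space of square integrable functions\<close>

text \<open>The obstacle is regularity. The inequality (b) speaks only about elements of two
  operator domains, while (a) and (c) concern arbitrary functions in \<open>L2 m\<close> and
  \<open>L1 m\<close>, and for the adjoint orbits only weak continuity is established. Averages over
  \<open>[s, s + h]\<close> repair the first point: they lie in the domain of the generator or of
  its adjoint, stay nonnegative and inherit the \<open>L1\<close> bounds. For the second point, the
  product rule uses a norm derivative in the \<open>T\<close> factor and only a weak derivative with
  local boundedness in the adjoint factor. The constants in (a) and (c) come out as
  \<open>C * M\<^sup>2\<close>, one \<open>M\<close> for each of the two \<open>L1\<close>
  estimates; \<open>exp (\<omega> * s) * exp (\<omega> * (t - s)) = exp (\<omega> * t)\<close> makes
  the bound on the derivative independent of \<open>s\<close>. Sigma-finiteness enters through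
  indicators of sets of finite measure. They turn bounds on pairings into inequalities almost
  everywhere and into membership in \<open>L1 m\<close>.\<close>

lemma L2_D [dest]:
  assumes "u \<in> L2 m"
  shows L2_measurable: "u \<in> borel_measurable m" and L2_integrable_sq: "integrable m (\<lambda>x. (u x)\<^sup>2)"
  using assms by (auto simp: L2_def)

lemma integrable_mult_L2:
  assumes u: "u \<in> L2 m" and v: "v \<in> L2 m"
  shows "integrable m (\<lambda>x. u x * v x)"
proof (rule Bochner_Integration.integrable_bound)
  show "integrable m (\<lambda>x. (u x)\<^sup>2 + (v x)\<^sup>2)"
    using u v by (auto simp: L2_def)
  show "(\<lambda>x. u x * v x) \<in> borel_measurable m"
    using u v by (auto simp: L2_def)
  have "\<bar>a * b\<bar> \<le> a\<^sup>2 + b\<^sup>2" for a b :: real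
  proof -
    have "0 \<le> (\<bar>a\<bar> - \<bar>b\<bar>)\<^sup>2" "0 \<le> a\<^sup>2 + b\<^sup>2" by auto
    then have "2 * \<bar>a * b\<bar> \<le> a\<^sup>2 + b\<^sup>2"
      by (simp add: power2_diff abs_mult)
    then show ?thesis using \<open>0 \<le> a\<^sup>2 + b\<^sup>2\<close> by linarith
  qed
  then show "AE x in m. norm (u x * v x) \<le> norm ((u x)\<^sup>2 + (v x)\<^sup>2)" by auto
qed

lemma L2_lin [simp, intro]:
  assumes "u \<in> L2 m" "v \<in> L2 m"
  shows "(\<lambda>x. a * u x + b * v x) \<in> L2 m"
proof -
  have "integrable m (\<lambda>x. a\<^sup>2 * (u x)\<^sup>2 + (2 * a * b) * (u x * v x) + b\<^sup>2 * (v x)\<^sup>2)"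
    using assms integrable_mult_L2[OF assms] by (auto simp: L2_def)
  then have "integrable m (\<lambda>x. (a * u x + b * v x)\<^sup>2)"
    by (simp add: power2_sum power_mult_distrib algebra_simps)
  then show ?thesis using assms by (auto simp: L2_def)
qed

lemma L2_diff [simp, intro]: "u \<in> L2 m \<Longrightarrow> v \<in> L2 m \<Longrightarrow> (\<lambda>x. u x - v x) \<in> L2 m"
  using L2_lin[of u m v 1 "-1"] by simp

lemma L2_add [simp, intro]: "u \<in> L2 m \<Longrightarrow> v \<in> L2 m \<Longrightarrow> (\<lambda>x. u x + v x) \<in> L2 m"
  using L2_lin[of u m v 1 1] by simp

lemma L2_scale [simp, intro]: "u \<in> L2 m \<Longrightarrow> (\<lambda>x. a * u x) \<in> L2 m"
  using L2_lin[of u m u a 0] by simp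

lemma L2_divide [simp, intro]: "u \<in> L2 m \<Longrightarrow> (\<lambda>x. u x / a) \<in> L2 m"
  using L2_scale[of u m "1/a"] by simp

lemma L2_zero [simp, intro]: "(\<lambda>x. 0) \<in> L2 m"
  by (simp add: L2_def)

lemma L2_bounded_by:
  assumes "u \<in> borel_measurable m" "v \<in> L2 m" "AE x in m. \<bar>u x\<bar> \<le> \<bar>v x\<bar>"
  shows "u \<in> L2 m"
proof -
  have "integrable m (\<lambda>x. (u x)\<^sup>2)"
    by (rule Bochner_Integration.integrable_bound[of _ "\<lambda>x. (v x)\<^sup>2"])
      (use assms in \<open>auto simp: L2_def abs_le_square_iff\<close>)
  then show ?thesis using assms by (auto simp: L2_def)
qed

lemma L2_abs [simp, intro]: "u \<in> L2 m \<Longrightarrow> (\<lambda>x. \<bar>u x\<bar>) \<in> L2 m"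
  by (rule L2_bounded_by[of _ _ u]) auto

lemma L2_pos_part [simp, intro]: "u \<in> L2 m \<Longrightarrow> (\<lambda>x. max 0 (u x)) \<in> L2 m"
  by (rule L2_bounded_by[of _ _ u]) auto

lemma L2_neg_part [simp, intro]: "u \<in> L2 m \<Longrightarrow> (\<lambda>x. max 0 (- u x)) \<in> L2 m"
  by (rule L2_bounded_by[of _ _ u]) auto

lemma L2_indicator [simp, intro]:
  assumes "B \<in> sets m" "emeasure m B < \<infinity>"
  shows "(indicator B :: _ \<Rightarrow> real) \<in> L2 m"
proof -
  have "(\<lambda>x. (indicator B x :: real)\<^sup>2) = indicator B"
    by (auto simp: fun_eq_iff indicator_def)
  then show ?thesis using assms by (simp add: L2_def)
qed

section \<open>Inner product and norm\<close>

lemma inner2_commute: "inner2 m u v = inner2 m v u"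
  by (simp add: inner2_def mult.commute)

lemma inner2_lin_left:
  assumes "u \<in> L2 m" "v \<in> L2 m" "y \<in> L2 m"
  shows "inner2 m (\<lambda>x. a * u x + b * v x) y = a * inner2 m u y + b * inner2 m v y"
  using integrable_mult_L2[OF assms(1,3)] integrable_mult_L2[OF assms(2,3)]
  by (simp add: inner2_def algebra_simps)

lemma inner2_diff_left:
  "u \<in> L2 m \<Longrightarrow> v \<in> L2 m \<Longrightarrow> y \<in> L2 m \<Longrightarrow>
    inner2 m (\<lambda>x. u x - v x) y = inner2 m u y - inner2 m v y"
  using inner2_lin_left[of u m v y 1 "-1"] by simp

lemma inner2_add_left:
  "u \<in> L2 m \<Longrightarrow> v \<in> L2 m \<Longrightarrow> y \<in> L2 m \<Longrightarrow>
    inner2 m (\<lambda>x. u x + v x) y = inner2 m u y + inner2 m v y"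
  using inner2_lin_left[of u m v y 1 1] by simp

lemma inner2_scale_left: "inner2 m (\<lambda>x. a * u x) y = a * inner2 m u y"
  by (simp add: inner2_def mult.assoc)

lemma inner2_divide_left: "inner2 m (\<lambda>x. u x / a) y = inner2 m u y / a"
  using inner2_scale_left[of m "1/a"] by simp

lemma inner2_zero_left [simp]: "inner2 m (\<lambda>x. 0) y = 0"
  by (simp add: inner2_def)

lemma inner2_lin_right:
  assumes "u \<in> L2 m" "v \<in> L2 m" "y \<in> L2 m"
  shows "inner2 m y (\<lambda>x. a * u x + b * v x) = a * inner2 m y u + b * inner2 m y v"
  using inner2_lin_left[OF assms] by (simp add: inner2_commute)

lemma inner2_diff_right:
  "u \<in> L2 m \<Longrightarrow> v \<in> L2 m \<Longrightarrow> y \<in> L2 m \<Longrightarrow>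
    inner2 m y (\<lambda>x. u x - v x) = inner2 m y u - inner2 m y v"
  using inner2_diff_left[of u m v y] by (simp add: inner2_commute)

lemma inner2_scale_right: "inner2 m y (\<lambda>x. a * u x) = a * inner2 m y u"
  using inner2_scale_left[of m a u y] by (simp add: inner2_commute)

lemma inner2_zero_right [simp]: "inner2 m y (\<lambda>x. 0) = 0"
  by (simp add: inner2_def)

lemmas inner2_simps =
  inner2_diff_left inner2_add_left inner2_scale_left inner2_divide_left
  inner2_lin_left inner2_lin_right inner2_diff_right inner2_scale_right

lemma inner2_cong_AE:
  assumes "u \<in> L2 m" "v \<in> L2 m" "y \<in> L2 m" "AE x in m. u x = v x"
  shows "inner2 m u y = inner2 m v y"
  unfolding inner2_def
  by (rule integral_cong_AE) (use assms in \<open>auto intro!: borel_measurable_times\<close>)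

lemma inner2_self_nonneg [simp]: "0 \<le> inner2 m u u"
  by (simp add: inner2_def)

lemma norm2_nonneg [simp]: "0 \<le> norm2 m u"
  by (simp add: norm2_def)

lemma norm2_sq: "(norm2 m u)\<^sup>2 = inner2 m u u"
  by (simp add: norm2_def)

lemma norm2_sq_integral: "(norm2 m u)\<^sup>2 = (\<integral>x. (u x)\<^sup>2 \<partial>m)"
  unfolding norm2_sq inner2_def by (simp add: power2_eq_square)

lemma norm2_zero [simp]: "norm2 m (\<lambda>x. 0) = 0"
  by (simp add: norm2_def)

lemma norm2_abs [simp]: "norm2 m (\<lambda>x. \<bar>u x\<bar>) = norm2 m u"
  by (simp add: norm2_def inner2_def flip: abs_mult)

lemma norm2_scale: "norm2 m (\<lambda>x. a * u x) = \<bar>a\<bar> * norm2 m u"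
proof -
  have "inner2 m (\<lambda>x. a * u x) (\<lambda>x. a * u x) = a\<^sup>2 * inner2 m u u"
    by (simp add: inner2_scale_left inner2_scale_right power2_eq_square)
  then show ?thesis by (simp add: norm2_def real_sqrt_mult)
qed

lemma norm2_minus_commute: "norm2 m (\<lambda>x. u x - v x) = norm2 m (\<lambda>x. v x - u x)"
  using norm2_scale[of m "-1" "\<lambda>x. u x - v x"] by simp

lemma norm2_eq_0_iff:
  assumes "u \<in> L2 m"
  shows "norm2 m u = 0 \<longleftrightarrow> (AE x in m. u x = 0)"
proof -
  have "norm2 m u = 0 \<longleftrightarrow> (\<integral>x. (u x)\<^sup>2 \<partial>m) = 0"
    by (simp add: norm2_def inner2_def power2_eq_square)
  also have "\<dots> \<longleftrightarrow> (AE x in m. (u x)\<^sup>2 = 0)"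
    by (rule integral_nonneg_eq_0_iff_AE) (use assms in \<open>auto simp: L2_def\<close>)
  finally show ?thesis by simp
qed

lemma norm2_cong_AE:
  assumes "u \<in> L2 m" "v \<in> L2 m" "AE x in m. u x = v x"
  shows "norm2 m u = norm2 m v"
  using inner2_cong_AE[OF assms(1,2,1,3)] inner2_cong_AE[OF assms(1,2,2,3)]
  by (simp add: norm2_def inner2_commute)

lemma norm2_mono:
  assumes "u \<in> L2 m" "v \<in> L2 m" "AE x in m. \<bar>u x\<bar> \<le> \<bar>v x\<bar>"
  shows "norm2 m u \<le> norm2 m v"
proof -
  have "(\<integral>x. u x * u x \<partial>m) \<le> (\<integral>x. v x * v x \<partial>m)"
    by (rule integral_mono_AE)
      (use assms in \<open>auto intro!: integrable_mult_L2 elim!: eventually_mono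
        simp: abs_le_square_iff simp flip: power2_eq_square\<close>)
  then show ?thesis by (simp add: norm2_def inner2_def)
qed

lemma cauchy_schwarz_L2:
  assumes u: "u \<in> L2 m" and v: "v \<in> L2 m"
  shows "\<bar>inner2 m u v\<bar> \<le> norm2 m u * norm2 m v"
proof (cases "norm2 m v = 0")
  case True
  then have "AE x in m. v x = 0" using norm2_eq_0_iff[OF v] by simp
  then have "inner2 m v u = 0"
    using inner2_cong_AE[OF v L2_zero u] by simp
  with True show ?thesis by (simp add: inner2_commute)
next
  case False
  define b where "b = inner2 m v v"
  define c where "c = inner2 m u v"
  have b: "b > 0" using False by (simp add: b_def norm2_def less_le)
  have "0 \<le> inner2 m (\<lambda>x. b * u x + (- c) * v x) (\<lambda>x. b * u x + (- c) * v x)"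
    by (rule inner2_self_nonneg)
  also have "\<dots> = b * (b * inner2 m u u - c\<^sup>2)"
    using u v by (simp only: inner2_lin_left inner2_lin_right L2_lin)
      (simp add: b_def c_def inner2_commute[of m v u] power2_eq_square algebra_simps)
  finally have "c\<^sup>2 \<le> inner2 m u u * b"
    using b by (simp add: zero_le_mult_iff mult.commute)
  then have "sqrt (c\<^sup>2) \<le> sqrt (inner2 m u u * b)" by (rule real_sqrt_le_mono)
  then show ?thesis by (simp add: c_def b_def norm2_def real_sqrt_mult)
qed

lemma cauchy_schwarz_L2_le:
  assumes "u \<in> L2 m" "v \<in> L2 m" "norm2 m u \<le> c"
  shows "\<bar>inner2 m u v\<bar> \<le> c * norm2 m v"
  using cauchy_schwarz_L2[OF assms(1,2)] mult_right_mono[OF assms(3) norm2_nonneg[of m v]] by linarith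

lemma inner2_le_norm2: "u \<in> L2 m \<Longrightarrow> v \<in> L2 m \<Longrightarrow> inner2 m u v \<le> norm2 m u * norm2 m v"
  using cauchy_schwarz_L2[of u m v] by simp

lemma norm2_triangle:
  assumes u: "u \<in> L2 m" and v: "v \<in> L2 m"
  shows "norm2 m (\<lambda>x. u x + v x) \<le> norm2 m u + norm2 m v"
proof (rule power2_le_imp_le)
  have "(norm2 m (\<lambda>x. u x + v x))\<^sup>2 = (norm2 m u)\<^sup>2 + 2 * inner2 m u v + (norm2 m v)\<^sup>2"
    using u v inner2_lin_right[of u m v u 1 1] inner2_lin_right[of u m v v 1 1]
    by (simp add: norm2_sq inner2_add_left inner2_commute[of m v u])
  also have "\<dots> \<le> (norm2 m u + norm2 m v)\<^sup>2"
    using inner2_le_norm2[OF u v] by (simp add: power2_sum)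
  finally show "(norm2 m (\<lambda>x. u x + v x))\<^sup>2 \<le> (norm2 m u + norm2 m v)\<^sup>2" .
qed simp

lemma norm2_triangle_diff:
  assumes "u \<in> L2 m" "v \<in> L2 m" "w \<in> L2 m"
  shows "norm2 m (\<lambda>x. u x - w x) \<le> norm2 m (\<lambda>x. u x - v x) + norm2 m (\<lambda>x. v x - w x)"
  using norm2_triangle[of "\<lambda>x. u x - v x" m "\<lambda>x. v x - w x"] assms by simp

lemma norm2_diff_ineq:
  assumes "u \<in> L2 m" "v \<in> L2 m"
  shows "\<bar>norm2 m u - norm2 m v\<bar> \<le> norm2 m (\<lambda>x. u x - v x)"
  using norm2_triangle_diff[of u m v "\<lambda>x. 0"] norm2_triangle_diff[of v m u "\<lambda>x. 0"] assms
  by (simp add: norm2_minus_commute[of m v u])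

section \<open>Norm, equality, order and integrability recovered from pairings\<close>

lemma norm2_le_by_duality:
  assumes u: "u \<in> L2 m" and c: "0 \<le> c" and "\<And>y. y \<in> L2 m \<Longrightarrow> inner2 m u y \<le> c * norm2 m y"
  shows "norm2 m u \<le> c"
proof -
  have "norm2 m u * norm2 m u \<le> c * norm2 m u"
    using assms(3)[OF u] by (simp add: norm2_sq flip: power2_eq_square)
  then show ?thesis using c
    by (metis mult_le_cancel_right norm2_nonneg order_less_le)
qed

lemma AE_eq_by_duality:
  assumes u: "u \<in> L2 m" and v: "v \<in> L2 m" and "\<And>y. y \<in> L2 m \<Longrightarrow> inner2 m u y = inner2 m v y"
  shows "AE x in m. u x = v x"
proof -
  have "norm2 m (\<lambda>x. u x - v x) \<le> 0"
    by (rule norm2_le_by_duality) (use assms in \<open>auto simp: inner2_diff_left\<close>)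
  then have "norm2 m (\<lambda>x. u x - v x) = 0" by (simp add: order_antisym)
  then show ?thesis using norm2_eq_0_iff[of "\<lambda>x. u x - v x" m] u v by auto
qed

lemma inner2_nonneg:
  assumes "nonneg_ae m u" "nonneg_ae m v"
  shows "0 \<le> inner2 m u v"
  unfolding inner2_def by (rule integral_nonneg_AE) (use assms in \<open>auto simp: nonneg_ae_def\<close>)

text \<open>Tested against its own negative part \<open>w\<close>, the function \<open>u\<close>
  gives \<open>- inner2 m w w\<close>, so nonnegativity of the pairing forces \<open>w\<close> to
  vanish.\<close>

lemma nonneg_ae_by_duality:
  assumes u: "u \<in> L2 m" and *: "\<And>y. y \<in> L2 m \<Longrightarrow> nonneg_ae m y \<Longrightarrow> 0 \<le> inner2 m u y"
  shows "nonneg_ae m u"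
proof -
  define w where "w = (\<lambda>x. max 0 (- u x))"
  have w: "w \<in> L2 m" unfolding w_def using u by blast
  have "0 \<le> inner2 m u w" by (rule *) (use w in \<open>auto simp: nonneg_ae_def w_def\<close>)
  moreover have "inner2 m u w = - inner2 m w w"
    unfolding inner2_def by (subst integral_minus[symmetric], rule arg_cong[where f = "integral\<^sup>L m"])
      (auto simp: w_def fun_eq_iff max_def)
  ultimately have "norm2 m w = 0" using inner2_self_nonneg[of m w] by (simp add: norm2_def)
  then have "AE x in m. w x = 0" using norm2_eq_0_iff[OF w] by simp
  then show ?thesis unfolding nonneg_ae_def w_def by eventually_elim (auto simp: max_def split: if_splits)
qed

lemma inner2_parts:
  assumes "y \<in> L2 m" "u \<in> L2 m"
  shows "inner2 m u y = inner2 m u (\<lambda>x. max 0 (y x)) - inner2 m u (\<lambda>x. max 0 (- y x))"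
proof -
  have "y = (\<lambda>x. max 0 (y x) - max 0 (- y x))" by (auto simp: max_def)
  then have "inner2 m u y = inner2 m u (\<lambda>x. max 0 (y x) - max 0 (- y x))" by simp
  also have "\<dots> = inner2 m u (\<lambda>x. max 0 (y x)) - inner2 m u (\<lambda>x. max 0 (- y x))"
    by (rule inner2_diff_right) (use assms in auto)
  finally show ?thesis .
qed

lemma inner2_le_norm1:
  assumes u: "u \<in> L2 m" and v: "v \<in> L2 m" "v \<in> L1 m" and b: "AE x in m. \<bar>u x\<bar> \<le> 1"
  shows "inner2 m u v \<le> norm1 m v"
  unfolding inner2_def norm1_def
proof (rule integral_mono_AE)
  show "integrable m (\<lambda>x. u x * v x)" using u v integrable_mult_L2 by blast
  show "integrable m (\<lambda>x. \<bar>v x\<bar>)" using v by (auto simp: L1_def)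
  have "u x * v x \<le> \<bar>v x\<bar>" if "\<bar>u x\<bar> \<le> 1" for x
  proof -
    have "u x * v x \<le> \<bar>u x\<bar> * \<bar>v x\<bar>" by (metis abs_ge_self abs_mult)
    also have "\<dots> \<le> \<bar>v x\<bar>" using that by (simp add: mult_left_le_one_le)
    finally show ?thesis .
  qed
  then show "AE x in m. u x * v x \<le> \<bar>v x\<bar>" using b by auto
qed

text \<open>Indicators of an increasing exhaustion by sets of finite measure are admissible test
  functions; they bound the integrals over these sets, and monotone convergence passes to the whole
  space. This is how \<open>L1\<close> bounds reach vectors known only through their pairings, such
  as averages and resolvents.\<close>

lemma (in sigma_finite_measure) L1_by_duality:
  assumes u: "u \<in> L2 M" and pos: "nonneg_ae M u"
    and le: "\<And>y. y \<in> L2 M \<Longrightarrow> (\<And>x. 0 \<le> y x \<and> y x \<le> 1) \<Longrightarrow> inner2 M u y \<le> c"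
  shows "u \<in> L1 M" "norm1 M u \<le> c"
proof -
  obtain B :: "nat \<Rightarrow> 'a set" where B: "range B \<subseteq> sets M" "(\<Union>i. B i) = space M"
    "\<And>i. emeasure M (B i) \<noteq> \<infinity>" "incseq B"
    using sigma_finite_incseq by metis
  have u_meas: "u \<in> borel_measurable M" using u by blast
  have ind: "(indicator (B i) :: 'a \<Rightarrow> real) \<in> L2 M" for i
    using B by (intro L2_indicator) (auto simp: less_top)
  have int: "integrable M (\<lambda>x. u x * indicator (B i) x)" for i
    by (rule integrable_mult_L2[OF u ind])
  have bound: "(\<integral>x. u x * indicator (B i) x \<partial>M) \<le> c" for i
    using le[OF ind, of i] by (auto simp: inner2_def indicator_def)
  have mono: "AE x in M. mono (\<lambda>i. u x * indicator (B i) x)"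
    using pos unfolding nonneg_ae_def
    by eventually_elim (use B(4) in \<open>auto simp: mono_def indicator_def incseq_def\<close>)
  have lim: "AE x in M. (\<lambda>i. u x * indicator (B i) x) \<longlonglongrightarrow> u x"
  proof (rule AE_I2)
    fix x assume "x \<in> space M"
    then obtain n where "x \<in> B n" using B(2) by auto
    then have "eventually (\<lambda>i. u x * indicator (B i) x = u x) sequentially"
      using B(4) by (intro eventually_sequentiallyI[of n]) (auto simp: incseq_def indicator_def)
    then show "(\<lambda>i. u x * indicator (B i) x) \<longlonglongrightarrow> u x" by (rule tendsto_eventually)
  qed
  have mono_int: "incseq (\<lambda>i. \<integral>x. u x * indicator (B i) x \<partial>M)"
    unfolding incseq_def
  proof (intro allI impI integral_mono_AE int)
    fix i j :: nat assume "i \<le> j"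
    with mono show "AE x in M. u x * indicator (B i) x \<le> u x * indicator (B j) x"
      by (auto simp: mono_def)
  qed
  obtain l where l: "(\<lambda>i. \<integral>x. u x * indicator (B i) x \<partial>M) \<longlonglongrightarrow> l"
    using incseq_convergent[OF mono_int] bound by metis
  have "integrable M u" "integral\<^sup>L M u = l"
    using integrable_monotone_convergence[OF int mono lim l u_meas]
      integral_monotone_convergence[OF int mono lim l u_meas] by auto
  moreover have "l \<le> c" using l bound by (intro LIMSEQ_le_const2) auto
  moreover have "norm1 M u = integral\<^sup>L M u" unfolding norm1_def
    by (rule integral_cong_AE) (use u_meas pos in \<open>auto simp: nonneg_ae_def\<close>)
  ultimately show "u \<in> L1 M" "norm1 M u \<le> c" by (auto simp: L1_def)
qed

text \<open>The set where \<open>f > g + c\<close> may have infinite measure, so it is cut down to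
  the pieces \<open>B i\<close>. On such a piece \<open>E\<close> the function
  \<open>f - g - c\<close> is positive, while its integral is at most 0 by the hypothesis for the
  indicator of \<open>E\<close>; hence \<open>E\<close> is a null set.\<close>

lemma (in sigma_finite_measure) AE_le_by_duality:
  assumes f: "f \<in> L2 M" and g: "g \<in> L2 M"
    and le: "\<And>v. v \<in> L2 M \<Longrightarrow> v \<in> L1 M \<Longrightarrow> nonneg_ae M v \<Longrightarrow>
      inner2 M f v \<le> inner2 M g v + c * norm1 M v"
  shows "AE x in M. f x \<le> g x + c"
proof -
  obtain B :: "nat \<Rightarrow> 'a set" where B: "range B \<subseteq> sets M" "(\<Union>i. B i) = space M"
    "\<And>i. emeasure M (B i) \<noteq> \<infinity>" "incseq B"
    using sigma_finite_incseq by metis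
  have [measurable]: "f \<in> borel_measurable M" "g \<in> borel_measurable M" using f g by auto
  have "AE x in M. x \<in> B i \<longrightarrow> f x \<le> g x + c" for i
  proof -
    define E where "E = {x \<in> space M. f x > g x + c} \<inter> B i"
    have E: "E \<in> sets M" using B(1) by (auto simp: E_def)
    have "emeasure M E \<le> emeasure M (B i)"
      by (rule emeasure_mono) (use B(1) in \<open>auto simp: E_def\<close>)
    then have Efin: "emeasure M E < \<infinity>" using B(3)[of i] by (metis infinity_ennreal_def order_le_less_trans top.not_eq_extremum)
    let ?v = "indicator E :: 'a \<Rightarrow> real"
    have v: "?v \<in> L2 M" "?v \<in> L1 M" using E Efin by (auto simp: L1_def)
    have ints: "integrable M (\<lambda>x. f x * ?v x)" "integrable M (\<lambda>x. g x * ?v x)" "integrable M ?v"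
      using integrable_mult_L2[OF f v(1)] integrable_mult_L2[OF g v(1)] v by (auto simp: L1_def)
    have "inner2 M f ?v \<le> inner2 M g ?v + c * norm1 M ?v"
      by (rule le[OF v]) (simp add: nonneg_ae_def)
    then have "(\<integral>x. f x * ?v x - g x * ?v x - c * ?v x \<partial>M) \<le> 0"
      using ints by (simp add: inner2_def norm1_def)
    moreover have nn: "0 \<le> f x * ?v x - g x * ?v x - c * ?v x" for x
      by (auto simp: indicator_def E_def)
    ultimately have "(\<integral>x. f x * ?v x - g x * ?v x - c * ?v x \<partial>M) = 0"
      by (intro order_antisym integral_nonneg) auto
    then have "AE x in M. f x * ?v x - g x * ?v x - c * ?v x = 0"
      using ints nn by (subst (asm) integral_nonneg_eq_0_iff_AE) auto
    then show ?thesis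
      by (rule AE_mp) (auto intro!: AE_I2 simp: E_def indicator_def split: if_splits)
  qed
  then have "AE x in M. \<forall>i. x \<in> B i \<longrightarrow> f x \<le> g x + c" unfolding AE_all_countable by blast
  then show ?thesis
  proof (rule AE_mp, intro AE_I2 impI)
    fix x assume "x \<in> space M" "\<forall>i. x \<in> B i \<longrightarrow> f x \<le> g x + c"
    then show "f x \<le> g x + c" using B(2) by blast
  qed
qed

lemma inner2_le_of_AE_le:
  assumes f: "f \<in> L2 m" and g: "g \<in> L2 m" and v: "v \<in> L2 m" "v \<in> L1 m" "nonneg_ae m v"
    and le: "AE x in m. f x \<le> g x + c"
  shows "inner2 m f v \<le> inner2 m g v + c * norm1 m v"
proof -
  have "(\<integral>x. f x * v x \<partial>m) \<le> (\<integral>x. g x * v x + c * v x \<partial>m)"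
  proof (rule integral_mono_AE)
    show "integrable m (\<lambda>x. f x * v x)" "integrable m (\<lambda>x. g x * v x + c * v x)"
      using integrable_mult_L2[OF f v(1)] integrable_mult_L2[OF g v(1)] v by (auto simp: L1_def)
    show "AE x in m. f x * v x \<le> g x * v x + c * v x"
      using le v(3) unfolding nonneg_ae_def
      by eventually_elim (metis distrib_right mult_right_mono)
  qed
  also have "\<dots> = (\<integral>x. g x * v x \<partial>m) + c * (\<integral>x. v x \<partial>m)"
    using integrable_mult_L2[OF g v(1)] v by (auto simp: L1_def)
  also have "(\<integral>x. v x \<partial>m) = norm1 m v" unfolding norm1_def
    by (rule integral_cong_AE) (use v in \<open>auto simp: nonneg_ae_def L1_def\<close>)
  finally show ?thesis by (simp add: inner2_def)
qed

(* 2|d| \<le> 2^-n + 2^n d^2 turns the L2 bounds into pointwise summability of the increments. *)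
lemma L2_complete:
  assumes f: "\<And>n. f n \<in> L2 m"
    and fast: "\<And>n. (norm2 m (\<lambda>x. f (Suc n) x - f n x))\<^sup>2 \<le> (1/8) ^ n"
    and cauchy: "\<And>n k. n \<le> k \<Longrightarrow> (norm2 m (\<lambda>x. f k x - f n x))\<^sup>2 \<le> e n"
  shows "\<exists>g\<in>L2 m. (AE x in m. (\<lambda>n. f n x) \<longlonglongrightarrow> g x) \<and>
    (\<forall>n. (norm2 m (\<lambda>x. g x - f n x))\<^sup>2 \<le> e n)"
proof -
  have meas [measurable]: "f n \<in> borel_measurable m" for n using f by auto
  define d where "d n x = f (Suc n) x - f n x" for n x
  have d: "d n \<in> L2 m" for n unfolding d_def using f by auto
  have [measurable]: "d n \<in> borel_measurable m" for n using d by auto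
  have int_d: "integrable m (\<lambda>x. 2 ^ n * (d n x)\<^sup>2)" for n using d by auto
  have "(\<integral>x. 2 ^ n * (d n x)\<^sup>2 \<partial>m) \<le> (1/4) ^ n" for n
  proof -
    have "(\<integral>x. (d n x)\<^sup>2 \<partial>m) \<le> (1/8) ^ n"
      using fast[of n] by (simp add: norm2_sq_integral d_def)
    then have "(2::real) ^ n * (\<integral>x. (d n x)\<^sup>2 \<partial>m) \<le> 2 ^ n * (1/8) ^ n" by simp
    also have "\<dots> = (1/4) ^ n" by (simp flip: power_mult_distrib)
    finally show ?thesis by simp
  qed
  then have emb: "(\<integral>\<^sup>+x. ennreal (2 ^ n * (d n x)\<^sup>2) \<partial>m) \<le> ennreal ((1/4) ^ n)" for n
    by (subst nn_integral_eq_integral[OF int_d]) (auto intro: ennreal_leI)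
  have "(\<integral>\<^sup>+x. (\<Sum>n. ennreal (2 ^ n * (d n x)\<^sup>2)) \<partial>m) = (\<Sum>n. \<integral>\<^sup>+x. ennreal (2 ^ n * (d n x)\<^sup>2) \<partial>m)"
    by (rule nn_integral_suminf) auto
  also have "\<dots> \<le> (\<Sum>n. ennreal ((1/4) ^ n))" by (intro suminf_le emb) auto
  also have "\<dots> = ennreal (\<Sum>n. (1/4) ^ n)"
    by (rule suminf_ennreal2) (auto intro: summable_geometric)
  also have "\<dots> < \<infinity>" by simp
  finally have "AE x in m. (\<Sum>n. ennreal (2 ^ n * (d n x)\<^sup>2)) \<noteq> \<infinity>"
    by (intro nn_integral_PInf_AE) auto
  then have conv: "AE x in m. convergent (\<lambda>n. f n x)"
  proof eventually_elim
    case (elim x)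
    have "summable (\<lambda>n. 2 ^ n * (d n x)\<^sup>2)"
      by (rule summable_suminf_not_top) (use elim in auto)
    then have "summable (\<lambda>n. (1/2) ^ n + 2 ^ n * (d n x)\<^sup>2)"
      by (intro summable_add summable_geometric) auto
    then have "summable (\<lambda>n. d n x)"
    proof (rule summable_comparison_test')
      fix n :: nat
      have "0 \<le> ((1/2) ^ n - \<bar>d n x\<bar>)\<^sup>2" by simp
      then have "2 * ((1/2) ^ n * \<bar>d n x\<bar>) \<le> ((1/2) ^ n)\<^sup>2 + (d n x)\<^sup>2"
        by (simp add: power2_diff)
      then have "2 ^ n * (2 * ((1/2) ^ n * \<bar>d n x\<bar>)) \<le> 2 ^ n * (((1/2) ^ n)\<^sup>2 + (d n x)\<^sup>2)" by simp
      then have "2 * \<bar>d n x\<bar> \<le> (1/2) ^ n + 2 ^ n * (d n x)\<^sup>2"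
        by (simp add: algebra_simps power2_eq_square power_one_over)
      then show "norm (d n x) \<le> (1/2) ^ n + 2 ^ n * (d n x)\<^sup>2" by simp
    qed
    then have "convergent (\<lambda>n. \<Sum>i<n. d i x)" by (simp add: summable_iff_convergent)
    moreover have "(\<Sum>i<n. d i x) = f n x - f 0 x" for n
      unfolding d_def by (rule sum_lessThan_telescope)
    ultimately have "convergent (\<lambda>n. f n x - f 0 x + f 0 x)"
      by (intro convergent_add convergent_const) simp
    then show ?case by simp
  qed
  define g where "g x = lim (\<lambda>n. f n x)" for x
  have [measurable]: "g \<in> borel_measurable m" unfolding g_def by measurable
  have lim: "AE x in m. (\<lambda>n. f n x) \<longlonglongrightarrow> g x"
    using conv by eventually_elim (simp add: g_def convergent_LIMSEQ_iff)
  \<comment> \<open>Fatou's lemma in \<open>k\<close>, for fixed \<open>n\<close>, carries the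
    Cauchy bound over to the limit. For \<open>n = 0\<close> it also yields
    \<open>g \<in> L2 m\<close>.\<close>
  have bound: "(\<integral>\<^sup>+x. ennreal ((g x - f n x)\<^sup>2) \<partial>m) \<le> ennreal (e n)" for n
  proof -
    have "(\<integral>\<^sup>+x. ennreal ((g x - f n x)\<^sup>2) \<partial>m)
        = (\<integral>\<^sup>+x. liminf (\<lambda>k. ennreal ((f k x - f n x)\<^sup>2)) \<partial>m)"
    proof (rule nn_integral_cong_AE, use lim in eventually_elim)
      case (elim x)
      then have "(\<lambda>k. ennreal ((f k x - f n x)\<^sup>2)) \<longlonglongrightarrow> ennreal ((g x - f n x)\<^sup>2)"
        by (intro tendsto_intros) auto
      then show ?case by (metis lim_imp_Liminf trivial_limit_sequentially)
    qed
    also have "\<dots> \<le> liminf (\<lambda>k. \<integral>\<^sup>+x. ennreal ((f k x - f n x)\<^sup>2) \<partial>m)"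
      by (rule nn_integral_liminf) auto
    also have "\<dots> \<le> liminf (\<lambda>k. ennreal (e n))"
    proof (rule Liminf_mono, rule eventually_sequentiallyI)
      fix k assume "n \<le> k"
      have "integrable m (\<lambda>x. (f k x - f n x)\<^sup>2)" using f by (intro L2_integrable_sq) auto
      then show "(\<integral>\<^sup>+x. ennreal ((f k x - f n x)\<^sup>2) \<partial>m) \<le> ennreal (e n)"
        using cauchy[OF \<open>n \<le> k\<close>]
        by (subst nn_integral_eq_integral)
          (auto intro!: ennreal_leI simp: norm2_sq_integral)
    qed
    also have "\<dots> = ennreal (e n)" by (simp add: Liminf_const)
    finally show ?thesis .
  qed
  have int: "integrable m (\<lambda>x. (g x - f n x)\<^sup>2)" for n
    by (rule integrableI_bounded) (auto intro: order_le_less_trans[OF bound])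
  then have gf: "(\<lambda>x. g x - f n x) \<in> L2 m" for n by (simp add: L2_def)
  have "g \<in> L2 m" using L2_add[OF gf[of 0] f[of 0]] by simp
  moreover have "(norm2 m (\<lambda>x. g x - f n x))\<^sup>2 \<le> e n" for n
  proof -
    have "0 \<le> e n" using cauchy[of n n] by simp
    moreover have "ennreal (\<integral>x. (g x - f n x)\<^sup>2 \<partial>m) \<le> ennreal (e n)"
      using bound[of n] by (subst (asm) nn_integral_eq_integral[OF int]) auto
    ultimately show ?thesis by (simp add: norm2_sq_integral)
  qed
  ultimately show ?thesis using lim by blast
qed

section \<open>The Riesz representation theorem\<close>

lemma parallelogram_L2:
  assumes "u \<in> L2 m" "v \<in> L2 m"
  shows "(norm2 m (\<lambda>x. u x - v x))\<^sup>2 =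
    2 * (norm2 m u)\<^sup>2 + 2 * (norm2 m v)\<^sup>2 - 4 * (norm2 m (\<lambda>x. 1/2 * u x + 1/2 * v x))\<^sup>2"
  using assms
  by (simp only: norm2_sq inner2_lin_left inner2_lin_right inner2_diff_left inner2_diff_right L2_lin L2_diff)
    (simp add: inner2_commute[of m v u] algebra_simps)

text \<open>The representing vector minimizes the energy
  \<open>J w = (norm2 m w)\<^sup>2 / 2 - \<phi> w\<close>. By the parallelogram law two almost
  minimal vectors are close to each other, so a minimizing sequence converges; the vanishing first
  variation at its limit is the claimed identity.\<close>

theorem riesz_L2:
  fixes \<phi> :: "('a \<Rightarrow> real) \<Rightarrow> real"
  assumes lin: "\<And>u v a b. u \<in> L2 m \<Longrightarrow> v \<in> L2 m \<Longrightarrow> \<phi> (\<lambda>x. a * u x + b * v x) = a * \<phi> u + b * \<phi> v"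
    and bdd: "\<And>u. u \<in> L2 m \<Longrightarrow> \<bar>\<phi> u\<bar> \<le> C * norm2 m u"
  shows "\<exists>w\<in>L2 m. \<forall>u\<in>L2 m. inner2 m w u = \<phi> u"
proof -
  define J where "J w = (norm2 m w)\<^sup>2 / 2 - \<phi> w" for w
  define i where "i = Inf (J ` L2 m)"
  have lower: "- C\<^sup>2 / 2 \<le> J w" if "w \<in> L2 m" for w
  proof -
    have "\<phi> w \<le> C * norm2 m w" using bdd[OF that] by simp
    moreover have "0 \<le> (norm2 m w - C)\<^sup>2" by simp
    ultimately show ?thesis by (simp add: J_def power2_diff mult.commute)
  qed
  then have bb: "bdd_below (J ` L2 m)" by (auto simp: bdd_below_def)
  have i: "i \<le> J w" if "w \<in> L2 m" for w
    unfolding i_def by (rule cInf_lower[OF _ bb]) (use that in auto)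
  have ne: "J ` L2 m \<noteq> {}" using L2_zero[of m] by blast
  \<comment> \<open>The excess is chosen for \<open>close\<close>: four times it for each of the two
    indices adds up to at most \<open>(1/8) ^ n\<close>, the rate that \<open>L2_complete\<close>
    asks for.\<close>
  have "\<exists>w\<in>L2 m. J w < i + (1/8) ^ n / 8" for n
    using cInf_lessD[OF ne, of "i + (1/8) ^ n / 8"] by (auto simp: i_def)
  then obtain w where w: "\<And>n. w n \<in> L2 m" and Jw: "\<And>n. J (w n) < i + (1/8) ^ n / 8" by metis
  have close: "(norm2 m (\<lambda>x. u x - v x))\<^sup>2 \<le> 4 * (J u - i) + 4 * (J v - i)"
    if "u \<in> L2 m" "v \<in> L2 m" for u v
    using parallelogram_L2[OF that] i[of "\<lambda>x. 1/2 * u x + 1/2 * v x"] lin[OF that, of "1/2" "1/2"] that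
    by (simp add: J_def)
  have cau: "(norm2 m (\<lambda>x. w k x - w n x))\<^sup>2 \<le> (1/8) ^ n" if "n \<le> k" for n k
  proof -
    define e where "e n = ((1::real)/8) ^ n" for n :: nat
    have "e k \<le> e n" unfolding e_def using that by (intro power_decreasing) auto
    moreover have "J (w n) < i + e n / 8" "J (w k) < i + e k / 8" using Jw by (auto simp: e_def)
    ultimately show ?thesis using close[OF w[of k] w[of n]] unfolding e_def[symmetric] by argo
  qed
  obtain z where z: "z \<in> L2 m" and zw: "\<And>n. (norm2 m (\<lambda>x. z x - w n x))\<^sup>2 \<le> (1/8) ^ n"
    using L2_complete[OF w cau cau] le_SucI[OF order_refl] by blast
  have norm_lim: "(\<lambda>n. norm2 m (\<lambda>x. z x - w n x)) \<longlonglongrightarrow> 0"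
  proof -
    have "(\<lambda>n. (norm2 m (\<lambda>x. z x - w n x))\<^sup>2) \<longlonglongrightarrow> 0"
      by (rule tendsto_sandwich[OF _ _ tendsto_const LIMSEQ_power_zero[of "1/8::real"]])
        (use zw in auto)
    then show ?thesis by simp
  qed
  have "(\<lambda>n. \<phi> (w n)) \<longlonglongrightarrow> \<phi> z"
  proof (rule LIM_zero_cancel, rule Lim_null_comparison)
    show "\<forall>\<^sub>F n in sequentially. norm (\<phi> (w n) - \<phi> z) \<le> C * norm2 m (\<lambda>x. z x - w n x)"
    proof (intro always_eventually allI)
      fix n
      have "\<phi> (\<lambda>x. z x - w n x) = \<phi> z - \<phi> (w n)" using lin[OF z w, of 1 "-1" n] by simp
      then show "norm (\<phi> (w n) - \<phi> z) \<le> C * norm2 m (\<lambda>x. z x - w n x)"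
        using bdd[of "\<lambda>x. z x - w n x"] z w by auto
    qed
    show "(\<lambda>n. C * norm2 m (\<lambda>x. z x - w n x)) \<longlonglongrightarrow> 0"
      using tendsto_mult_left[OF norm_lim, of C] by simp
  qed
  moreover have "(\<lambda>n. norm2 m (w n)) \<longlonglongrightarrow> norm2 m z"
  proof (rule LIM_zero_cancel, rule Lim_null_comparison[OF _ norm_lim])
    show "\<forall>\<^sub>F n in sequentially. norm (norm2 m (w n) - norm2 m z) \<le> norm2 m (\<lambda>x. z x - w n x)"
      using norm2_diff_ineq[OF z w] by (auto simp: abs_minus_commute)
  qed
  ultimately have Jlim: "(\<lambda>n. J (w n)) \<longlonglongrightarrow> J z" unfolding J_def by (intro tendsto_intros) auto
  have "(\<lambda>n. i + (1/8) ^ n / 8) \<longlonglongrightarrow> i + 0 / 8"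
    by (intro tendsto_intros LIMSEQ_power_zero) auto
  then have "J z \<le> i"
    using LIMSEQ_le[OF Jlim, of "\<lambda>n. i + (1/8) ^ n / 8" i] Jw by (auto intro: less_imp_le)
  then have min: "J z \<le> J w" if "w \<in> L2 m" for w using i[OF that] by linarith
  have "inner2 m z u = \<phi> u" if u: "u \<in> L2 m" for u
  proof -
    define c where "c = inner2 m z u - \<phi> u"
    have quad: "0 \<le> t * c + t\<^sup>2 * (inner2 m u u / 2)" for t
    proof -
      have "(norm2 m (\<lambda>x. 1 * z x + t * u x))\<^sup>2 = (norm2 m z)\<^sup>2 + 2 * t * inner2 m z u + t\<^sup>2 * inner2 m u u"
        using z u unfolding norm2_sq
        by (simp only: inner2_lin_left inner2_lin_right L2_lin)
          (simp add: inner2_commute[of m u z] power2_eq_square algebra_simps)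
      then have "J (\<lambda>x. 1 * z x + t * u x) - J z = t * c + t\<^sup>2 * (inner2 m u u / 2)"
        using lin[OF z u, of 1 t] by (simp add: J_def c_def algebra_simps)
      then show ?thesis using min[OF L2_lin[OF z u], of 1 t] by linarith
    qed
    \<comment> \<open>The summand 1 makes \<open>q\<close> positive even for \<open>u = 0\<close>,
      so \<open>t = - c / q\<close> can be inserted into \<open>quad\<close> without a case
      distinction. The outcome is \<open>- (c / q)\<^sup>2\<close>, which can be nonnegative only
      for \<open>c = 0\<close>.\<close>
    define q where "q = inner2 m u u / 2 + 1"
    have q: "q > 0" using inner2_self_nonneg[of m u] by (simp add: q_def add_nonneg_pos)
    have "0 \<le> (- c / q) * c + (- c / q)\<^sup>2 * (q - 1)" using quad[of "- c / q"] by (simp add: q_def)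
    also have "\<dots> = - (c / q)\<^sup>2" using q by (simp add: field_simps power2_eq_square)
    finally have "c = 0" using q by (simp add: not_less)
    then show ?thesis by (simp add: c_def)
  qed
  with z show ?thesis by blast
qed

section \<open>Averages of weakly continuous curves\<close>

text \<open>An antiderivative on the whole line, not merely on one interval, lets integrals over
  moving windows be written as \<open>F (s + h) - F s\<close> and differentiated in
  \<open>s\<close>.\<close>

lemma continuous_antiderivative:
  fixes p :: "real \<Rightarrow> real"
  assumes "continuous_on UNIV p"
  obtains F where "\<And>x. (F has_real_derivative p x) (at x)"
    and "\<And>a b. a \<le> b \<Longrightarrow> integral {a..b} p = F b - F a"
proof -
  have "\<exists>F. \<forall>x. -\<infinity> < ereal x \<longrightarrow> ereal x < \<infinity> \<longrightarrow> (F has_vector_derivative p x) (at x)"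
    by (rule einterval_antiderivative) (use assms in \<open>auto simp: continuous_on_eq_continuous_at\<close>)
  then obtain F where F: "\<And>x. (F has_vector_derivative p x) (at x)" by auto
  show ?thesis
  proof
    show "(F has_real_derivative p x) (at x)" for x
      using F by (simp add: has_real_derivative_iff_has_vector_derivative)
    show "integral {a..b} p = F b - F a" if "a \<le> b" for a b
      by (rule integral_unique, rule fundamental_theorem_of_calculus[OF that])
        (use F in \<open>auto intro: has_vector_derivative_at_within\<close>)
  qed
qed

(* The average of f over [s, s + h]; unspecified unless h > 0 and f is weakly continuous. *)
definition wavg :: "'a measure \<Rightarrow> (real \<Rightarrow> 'a \<Rightarrow> real) \<Rightarrow> real \<Rightarrow> real \<Rightarrow> 'a \<Rightarrow> real" where
  "wavg m f h s = (SOME w. w \<in> L2 m \<and>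
     (\<forall>y\<in>L2 m. inner2 m w y = integral {s..s + h} (\<lambda>r. inner2 m (f r) y) / h))"

text \<open>These properties are just enough for averaging: weak continuity makes the pairings
  integrable, and local boundedness makes the averaged pairing a bounded functional, so that
  \<open>riesz_L2\<close> applies. Adjoint orbits are treated at this level.\<close>

locale weak_curve =
  fixes m :: "'a measure" and f :: "real \<Rightarrow> 'a \<Rightarrow> real"
  assumes f_L2 [simp, intro]: "\<And>s. f s \<in> L2 m"
    and f_cont: "\<And>y. y \<in> L2 m \<Longrightarrow> continuous_on UNIV (\<lambda>s. inner2 m (f s) y)"
    and f_bdd: "\<And>a b. \<exists>B. \<forall>s\<in>{a..b}. norm2 m (f s) \<le> B"
begin

lemma f_int: "y \<in> L2 m \<Longrightarrow> (\<lambda>r. inner2 m (f r) y) integrable_on {a..b}"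
  by (rule integrable_continuous_interval, rule continuous_on_subset[OF f_cont]) auto

lemma wavg_exists:
  assumes h: "0 < h"
  shows "\<exists>w\<in>L2 m. \<forall>y\<in>L2 m. inner2 m w y = integral {s..s + h} (\<lambda>r. inner2 m (f r) y) / h"
proof -
  obtain B where B: "\<And>r. r \<in> {s..s + h} \<Longrightarrow> norm2 m (f r) \<le> B" using f_bdd by meson
  show ?thesis
  proof (rule riesz_L2)
    fix u v a b assume uv: "u \<in> L2 m" "v \<in> L2 m"
    have "integral {s..s + h} (\<lambda>r. inner2 m (f r) (\<lambda>x. a * u x + b * v x))
        = integral {s..s + h} (\<lambda>r. a * inner2 m (f r) u + b * inner2 m (f r) v)"
      using uv by (simp add: inner2_lin_right)
    also have "\<dots> = a * integral {s..s + h} (\<lambda>r. inner2 m (f r) u)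
        + b * integral {s..s + h} (\<lambda>r. inner2 m (f r) v)"
      using f_int[OF uv(1)] f_int[OF uv(2)]
      by (subst integral_add) (auto intro: integrable_on_mult_right)
    finally show "integral {s..s + h} (\<lambda>r. inner2 m (f r) (\<lambda>x. a * u x + b * v x)) / h =
        a * (integral {s..s + h} (\<lambda>r. inner2 m (f r) u) / h) +
        b * (integral {s..s + h} (\<lambda>r. inner2 m (f r) v) / h)"
      by (simp add: add_divide_distrib)
  next
    fix u assume u: "u \<in> L2 m"
    have "norm (integral {s..s + h} (\<lambda>r. inner2 m (f r) u)) \<le> integral {s..s + h} (\<lambda>r. B * norm2 m u)"
    proof (rule integral_norm_bound_integral)
      fix r assume "r \<in> {s..s + h}"
      then have "norm2 m (f r) * norm2 m u \<le> B * norm2 m u" using B by (intro mult_right_mono) auto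
      then show "norm (inner2 m (f r) u) \<le> B * norm2 m u"
        using cauchy_schwarz_L2[OF f_L2 u, of r] by simp
    qed (use f_int[OF u] in auto)
    then show "\<bar>integral {s..s + h} (\<lambda>r. inner2 m (f r) u) / h\<bar> \<le> B * norm2 m u"
      using h by (simp add: field_simps)
  qed
qed

lemma wavg_L2 [simp, intro]: "0 < h \<Longrightarrow> wavg m f h s \<in> L2 m"
  and inner2_wavg: "0 < h \<Longrightarrow> y \<in> L2 m \<Longrightarrow>
    inner2 m (wavg m f h s) y = integral {s..s + h} (\<lambda>r. inner2 m (f r) y) / h"
  unfolding atomize_conj atomize_imp wavg_def
  using someI_ex[OF wavg_exists[of h s, unfolded Bex_def]] by blast

lemma inner2_wavg_le:
  assumes h: "0 < h" and y: "y \<in> L2 m" and le: "\<And>r. r \<in> {s..s + h} \<Longrightarrow> inner2 m (f r) y \<le> c"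
  shows "inner2 m (wavg m f h s) y \<le> c"
proof -
  have "integral {s..s + h} (\<lambda>r. inner2 m (f r) y) \<le> integral {s..s + h} (\<lambda>r. c)"
    by (rule integral_le) (use f_int[OF y] le in auto)
  then show ?thesis using h y by (simp add: inner2_wavg field_simps)
qed

lemma wavg_nonneg:
  assumes h: "0 < h" and pos: "\<And>r. nonneg_ae m (f r)"
  shows "nonneg_ae m (wavg m f h s)"
proof (rule nonneg_ae_by_duality)
  fix y assume "y \<in> L2 m" "nonneg_ae m y"
  then show "0 \<le> inner2 m (wavg m f h s) y"
    using h pos f_int
    by (auto simp: inner2_wavg intro!: divide_nonneg_pos integral_nonneg inner2_nonneg)
qed (use h in auto)

lemma norm2_wavg_diff_le:
  assumes h: "0 < h" and x: "x \<in> L2 m" and c: "\<And>r. r \<in> {s..s + h} \<Longrightarrow> norm2 m (\<lambda>z. f r z - x z) \<le> c"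
  shows "norm2 m (\<lambda>z. wavg m f h s z - x z) \<le> c"
proof (rule norm2_le_by_duality)
  show "0 \<le> c" using order_trans[OF norm2_nonneg c[of s]] h by simp
  fix y assume y: "y \<in> L2 m"
  have "inner2 m (wavg m f h s) y \<le> c * norm2 m y + inner2 m x y"
  proof (rule inner2_wavg_le[OF h y])
    fix r assume "r \<in> {s..s + h}"
    then have "norm2 m (\<lambda>z. f r z - x z) * norm2 m y \<le> c * norm2 m y"
      using c by (intro mult_right_mono) auto
    then show "inner2 m (f r) y \<le> c * norm2 m y + inner2 m x y"
      using inner2_le_norm2[of "\<lambda>z. f r z - x z" m y] x y by (simp add: inner2_diff_left)
  qed
  then show "inner2 m (\<lambda>z. wavg m f h s z - x z) y \<le> c * norm2 m y"
    using h x y by (simp add: inner2_diff_left)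
qed (use h x in auto)

lemma norm2_wavg_le:
  assumes h: "0 < h" and c: "\<And>r. r \<in> {s..s + h} \<Longrightarrow> norm2 m (f r) \<le> c"
  shows "norm2 m (wavg m f h s) \<le> c"
  using norm2_wavg_diff_le[OF h, of "\<lambda>x. 0"] c by simp

text \<open>Against a test function between 0 and 1 each \<open>f r\<close> pairs to at most its
  \<open>L1\<close> norm, so the average does as well; \<open>L1_by_duality\<close> converts this
  back into an \<open>L1\<close> bound.\<close>

lemma wavg_L1:
  assumes sf: "sigma_finite_measure m" and h: "0 < h" and pos: "\<And>r. nonneg_ae m (f r)"
    and f1: "\<And>r. r \<in> {s..s + h} \<Longrightarrow> f r \<in> L1 m \<and> norm1 m (f r) \<le> c"
  shows "wavg m f h s \<in> L1 m" "norm1 m (wavg m f h s) \<le> c"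
proof -
  have "inner2 m (wavg m f h s) y \<le> c" if y: "y \<in> L2 m" "\<And>x. 0 \<le> y x \<and> y x \<le> 1" for y
  proof (rule inner2_wavg_le[OF h y(1)])
    fix r assume r: "r \<in> {s..s + h}"
    have "inner2 m y (f r) \<le> norm1 m (f r)"
      by (rule inner2_le_norm1) (use y f1[OF r] in auto)
    then show "inner2 m (f r) y \<le> c" using f1[OF r] by (simp add: inner2_commute)
  qed
  then show "wavg m f h s \<in> L1 m" "norm1 m (wavg m f h s) \<le> c"
    using sigma_finite_measure.L1_by_duality[OF sf wavg_L2[OF h] wavg_nonneg[OF h pos]] by blast+
qed

lemma inner2_wavg_antiderivative:
  assumes h: "0 < h" and y: "y \<in> L2 m"
  obtains F where "\<And>s. (F has_real_derivative inner2 m (f s) y) (at s)"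
    and "\<And>s. inner2 m (wavg m f h s) y = (F (s + h) - F s) / h"
proof -
  obtain F where F: "\<And>x. (F has_real_derivative inner2 m (f x) y) (at x)"
    "\<And>a b. a \<le> b \<Longrightarrow> integral {a..b} (\<lambda>s. inner2 m (f s) y) = F b - F a"
    using continuous_antiderivative[OF f_cont[OF y]] by metis
  show ?thesis by (rule that[OF F(1)]) (use F(2) h y in \<open>auto simp: inner2_wavg\<close>)
qed

lemma inner2_wavg_deriv:
  assumes h: "0 < h" and y: "y \<in> L2 m"
  shows "((\<lambda>s. inner2 m (wavg m f h s) y) has_real_derivative
    inner2 m (\<lambda>x. (f (s + h) x - f s x) / h) y) (at s)"
proof -
  obtain F where F: "\<And>x. (F has_real_derivative inner2 m (f x) y) (at x)"
    "\<And>s. inner2 m (wavg m f h s) y = (F (s + h) - F s) / h"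
    using inner2_wavg_antiderivative[OF h y] by metis
  show ?thesis using y unfolding F(2)
    by (auto intro!: derivative_eq_intros DERIV_chain2[OF F(1)] F(1) simp: inner2_simps less_imp_neq[OF h, symmetric])
qed

lemma inner2_wavg_tendsto:
  assumes y: "y \<in> L2 m"
  shows "((\<lambda>h. inner2 m (wavg m f h s) y) \<longlongrightarrow> inner2 m (f s) y) (at_right 0)"
proof -
  obtain F where F: "\<And>x. (F has_real_derivative inner2 m (f x) y) (at x)"
    "\<And>a b. a \<le> b \<Longrightarrow> integral {a..b} (\<lambda>s. inner2 m (f s) y) = F b - F a"
    using continuous_antiderivative[OF f_cont[OF y]] by metis
  have "((\<lambda>h. (F (s + h) - F s) / h) \<longlongrightarrow> inner2 m (f s) y) (at 0)"
    using F(1)[of s] by (simp add: DERIV_def)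
  then have "((\<lambda>h. (F (s + h) - F s) / h) \<longlongrightarrow> inner2 m (f s) y) (at_right 0)"
    by (rule tendsto_mono[rotated]) (simp add: at_le)
  then show ?thesis
    by (rule Lim_transform_eventually)
      (use eventually_at_right_less[of "0::real"] in eventually_elim, auto simp: inner2_wavg y F(2))
qed

end

section \<open>Norm continuous curves and the product rule for pairings\<close>

locale strong_curve = weak_curve +
  assumes f_strong: "\<And>s. ((\<lambda>r. norm2 m (\<lambda>x. f r x - f s x)) \<longlongrightarrow> 0) (at s)"
begin

lemma f_strongD:
  assumes "0 < e"
  obtains d where "d > 0" "\<And>r. \<bar>r - s\<bar> < d \<Longrightarrow> norm2 m (\<lambda>x. f r x - f s x) < e"
proof -
  obtain d where d: "d > 0" "\<And>r. r \<noteq> s \<Longrightarrow> dist r s < d \<Longrightarrow> norm2 m (\<lambda>x. f r x - f s x) < e"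
    using tendstoD[OF f_strong[of s] assms] by (auto simp: eventually_at)
  show ?thesis
    by (rule that[OF d(1)], case_tac "r = s") (use d assms in \<open>auto simp: dist_real_def\<close>)
qed

lemma wavg_strong_tendsto:
  "((\<lambda>h. norm2 m (\<lambda>x. wavg m f h s x - f s x)) \<longlongrightarrow> 0) (at_right 0)"
proof (rule tendstoI)
  fix e :: real assume e: "0 < e"
  obtain d where d: "d > 0" "\<And>r. \<bar>r - s\<bar> < d \<Longrightarrow> norm2 m (\<lambda>x. f r x - f s x) < e / 2"
    using f_strongD[of "e / 2"] e by auto
  have "norm2 m (\<lambda>x. wavg m f h s x - f s x) \<le> e / 2" if "0 < h" "h < d" for h
    by (rule norm2_wavg_diff_le) (use that d(2) in \<open>auto intro!: less_imp_le\<close>)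
  then show "\<forall>\<^sub>F h in at_right 0. dist (norm2 m (\<lambda>x. wavg m f h s x - f s x)) 0 < e"
    using e d(1) by (fastforce simp: eventually_at_right_field dist_real_def)
qed

text \<open>For each test vector \<open>y\<close> the mean value theorem writes the increment as
  \<open>(r - s) * p \<sigma>\<close>. The point \<open>\<sigma>\<close> depends on
  \<open>y\<close>, but it stays close to \<open>s\<close>, and norm continuity of \<open>f\<close>
  at \<open>s\<close> and at \<open>s + h\<close> bounds \<open>p \<sigma> - p s\<close> by a
  multiple of \<open>norm2 m y\<close> that is independent of \<open>\<sigma>\<close>. Hence the
  weak derivative is a norm derivative.\<close>

lemma wavg_strong_deriv:
  assumes h: "0 < h"
  shows "((\<lambda>r. norm2 m (\<lambda>x. wavg m f h r x - wavg m f h s x - (r - s) * ((f (s + h) x - f s x) / h)) / \<bar>r - s\<bar>) \<longlongrightarrow> 0) (at s)"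
    (is "((\<lambda>r. norm2 m (?D r) / _) \<longlongrightarrow> 0) _")
proof (rule tendstoI)
  fix e :: real assume e: "0 < e"
  \<comment> \<open>Two errors of size \<open>e'\<close>, one at each end of the window, are divided
    by \<open>h\<close>; together they give \<open>e / 2\<close>.\<close>
  define e' where "e' = e * h / 4"
  have e': "e' > 0" using e h by (simp add: e'_def)
  obtain d where d: "d > 0" "\<And>r. \<bar>r - s\<bar> < d \<Longrightarrow> norm2 m (\<lambda>x. f r x - f s x) < e'"
    using f_strongD[OF e'] by metis
  obtain d' where d': "d' > 0" "\<And>r. \<bar>r - (s + h)\<bar> < d' \<Longrightarrow> norm2 m (\<lambda>x. f r x - f (s + h) x) < e'"
    using f_strongD[OF e'] by metis
  have "norm2 m (?D r) / \<bar>r - s\<bar> < e" if r: "r \<noteq> s" "\<bar>r - s\<bar> < min d d'" for r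
  proof -
    have "norm2 m (?D r) \<le> \<bar>r - s\<bar> * (e / 2)"
    proof (rule norm2_le_by_duality)
      fix y assume y: "y \<in> L2 m"
      define p where "p \<sigma> = inner2 m (\<lambda>x. (f (\<sigma> + h) x - f \<sigma> x) / h) y" for \<sigma>
      define q where "q \<sigma> = inner2 m (wavg m f h \<sigma>) y" for \<sigma>
      have dq: "(q has_real_derivative p \<sigma>) (at \<sigma>)" for \<sigma>
        unfolding q_def p_def by (rule inner2_wavg_deriv[OF h y])
      have "\<exists>\<sigma>. \<bar>\<sigma> - s\<bar> < min d d' \<and> q r - q s = (r - s) * p \<sigma>"
      proof (cases "s < r")
        case True
        from MVT2[of s r q p] dq True obtain z where z: "s < z" "z < r" "q r - q s = (r - s) * p z"
          by blast
        with r show ?thesis by (intro exI[of _ z]) linarith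
      next
        case False
        with r have "r < s" by simp
        from MVT2[of r s q p] dq this obtain z where z: "r < z" "z < s" "q s - q r = (s - r) * p z"
          by blast
        then have "q r - q s = (r - s) * p z" by (simp add: algebra_simps)
        moreover have "\<bar>z - s\<bar> < min d d'" using z r by linarith
        ultimately show ?thesis by blast
      qed
      then obtain \<sigma> where \<sigma>: "\<bar>\<sigma> - s\<bar> < min d d'" "q r - q s = (r - s) * p \<sigma>" by blast
      have "inner2 m (?D r) y = q r - q s - (r - s) * p s"
        using y h by (simp add: inner2_simps q_def p_def)
      also have "\<dots> = (r - s) * (p \<sigma> - p s)" using \<sigma> by (simp add: algebra_simps)
      also have "\<dots> \<le> \<bar>r - s\<bar> * \<bar>p \<sigma> - p s\<bar>" by (metis abs_ge_self abs_mult)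
      also have "\<bar>p \<sigma> - p s\<bar> \<le> e / 2 * norm2 m y"
      proof -
        have 1: "\<bar>inner2 m (\<lambda>x. f (\<sigma> + h) x - f (s + h) x) y\<bar> \<le> e' * norm2 m y"
          by (rule cauchy_schwarz_L2_le) (use y d'(2)[of "\<sigma> + h"] \<sigma> in auto)
        have 2: "\<bar>inner2 m (\<lambda>x. f \<sigma> x - f s x) y\<bar> \<le> e' * norm2 m y"
          by (rule cauchy_schwarz_L2_le) (use y d(2)[of "\<sigma>"] \<sigma> in auto)
        have "p \<sigma> - p s = (inner2 m (\<lambda>x. f (\<sigma> + h) x - f (s + h) x) y - inner2 m (\<lambda>x. f \<sigma> x - f s x) y) / h"
          using y h unfolding p_def by (simp add: inner2_simps field_simps)
        then have "\<bar>p \<sigma> - p s\<bar> = \<bar>inner2 m (\<lambda>x. f (\<sigma> + h) x - f (s + h) x) y - inner2 m (\<lambda>x. f \<sigma> x - f s x) y\<bar> / h"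
          using h by simp
        also have "\<dots> \<le> (2 * e' * norm2 m y) / h"
          using 1 2 h by (intro divide_right_mono) auto
        also have "\<dots> = e / 2 * norm2 m y" using h by (simp add: e'_def)
        finally show ?thesis .
      qed
      finally show "inner2 m (?D r) y \<le> \<bar>r - s\<bar> * (e / 2) * norm2 m y"
        by (simp add: mult_left_mono mult.assoc)
    qed (use h e in auto)
    then have "norm2 m (?D r) / \<bar>r - s\<bar> \<le> e / 2" using r by (simp add: field_simps)
    with e show ?thesis by linarith
  qed
  then show "\<forall>\<^sub>F r in at s. dist (norm2 m (?D r) / \<bar>r - s\<bar>) 0 < e"
    using d(1) d'(1) by (auto simp: eventually_at dist_real_def intro!: exI[of _ "min d d'"])
qed

end

text \<open>In the splitting \<open>eq\<close> the remainder \<open>D r\<close> of the first curve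
  meets the moving \<open>V r\<close>, and there smallness in norm and boundedness of
  \<open>V\<close> suffice. The other two terms pair \<open>V r\<close> with the fixed vectors
  \<open>U'\<close> and \<open>U s\<close>, for which weak information on \<open>V\<close> is
  enough.\<close>

lemma inner2_curves_deriv:
  assumes U: "\<And>r. U r \<in> L2 m" and V: "\<And>r. V r \<in> L2 m" and U': "U' \<in> L2 m"
    and strong: "((\<lambda>r. norm2 m (\<lambda>x. U r x - U s x - (r - s) * U' x) / \<bar>r - s\<bar>) \<longlongrightarrow> 0) (at s)"
    and weak: "\<And>x. x \<in> L2 m \<Longrightarrow> ((\<lambda>r. inner2 m (V r) x) has_real_derivative inner2 m V' x) (at s)"
    and bdd: "\<forall>\<^sub>F r in at s. norm2 m (V r) \<le> B"
  shows "((\<lambda>r. inner2 m (U r) (V r)) has_real_derivative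
    inner2 m U' (V s) + inner2 m (U s) V') (at s)"
proof -
  define D where "D r = (\<lambda>x. U r x - U s x - (r - s) * U' x)" for r
  have D: "D r \<in> L2 m" for r unfolding D_def using U U' by auto
  have eq: "(inner2 m (U r) (V r) - inner2 m (U s) (V s)) / (r - s) =
     inner2 m (D r) (V r) / (r - s) + inner2 m (V r) U'
       + (inner2 m (V r) (U s) - inner2 m (V s) (U s)) / (r - s)" if "r \<noteq> s" for r
  proof -
    have "inner2 m (D r) (V r) = inner2 m (U r) (V r) - inner2 m (V r) (U s) - (r - s) * inner2 m (V r) U'"
      unfolding D_def using U U' V by (simp add: inner2_simps inner2_commute)
    then have "inner2 m (U r) (V r) - inner2 m (U s) (V s) = inner2 m (D r) (V r)
        + (r - s) * inner2 m (V r) U' + (inner2 m (V r) (U s) - inner2 m (V s) (U s))"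
      by (simp add: inner2_commute)
    then show ?thesis using that by (simp only: add_divide_distrib) simp
  qed
  have "((\<lambda>r. inner2 m (D r) (V r) / (r - s)) \<longlongrightarrow> 0) (at s)"
  proof (rule Lim_null_comparison)
    show "\<forall>\<^sub>F r in at s. norm (inner2 m (D r) (V r) / (r - s)) \<le> norm2 m (D r) / \<bar>r - s\<bar> * B"
      using bdd
    proof eventually_elim
      case (elim r)
      have "\<bar>inner2 m (D r) (V r)\<bar> \<le> norm2 m (D r) * B"
        using cauchy_schwarz_L2[OF D V, of r r] elim
        by (meson mult_left_mono norm2_nonneg order_trans)
      then show ?case by (simp add: divide_right_mono)
    qed
    show "((\<lambda>r. norm2 m (D r) / \<bar>r - s\<bar> * B) \<longlongrightarrow> 0) (at s)"
      using tendsto_mult_left_zero[OF strong] by (simp add: D_def)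
  qed
  moreover have "((\<lambda>r. inner2 m (V r) U') \<longlongrightarrow> inner2 m (V s) U') (at s)"
    using DERIV_isCont[OF weak[OF U']] by (simp add: isCont_def)
  moreover have "((\<lambda>r. (inner2 m (V r) (U s) - inner2 m (V s) (U s)) / (r - s)) \<longlongrightarrow> inner2 m V' (U s)) (at s)"
    using weak[OF U[of s]] by (simp add: has_field_derivative_iff)
  ultimately have "((\<lambda>r. inner2 m (D r) (V r) / (r - s) + inner2 m (V r) U'
       + (inner2 m (V r) (U s) - inner2 m (V s) (U s)) / (r - s)) \<longlongrightarrow>
      0 + inner2 m (V s) U' + inner2 m V' (U s)) (at s)"
    by (intro tendsto_add)
  from this[unfolded add_0] have "((\<lambda>r. (inner2 m (U r) (V r) - inner2 m (U s) (V s)) / (r - s)) \<longlongrightarrow>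
      inner2 m (V s) U' + inner2 m V' (U s)) (at s)"
    by (rule Lim_transform_eventually[where f = "\<lambda>r. inner2 m (D r) (V r) / (r - s) + inner2 m (V r) U'
       + (inner2 m (V r) (U s) - inner2 m (V s) (U s)) / (r - s)"])
      (auto simp: eventually_at_filter eq)
  then show ?thesis by (simp add: has_field_derivative_iff inner2_commute)
qed

section \<open>Positive semigroups on L2\<close>

lemma
  assumes "bounded_op m S"
  shows bounded_op_L2: "u \<in> L2 m \<Longrightarrow> S u \<in> L2 m"
    and bounded_op_cong: "u \<in> L2 m \<Longrightarrow> v \<in> L2 m \<Longrightarrow> AE x in m. u x = v x \<Longrightarrow> AE x in m. S u x = S v x"
    and bounded_op_lin: "u \<in> L2 m \<Longrightarrow> v \<in> L2 m \<Longrightarrow>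
      AE x in m. S (\<lambda>y. a * u y + b * v y) x = a * S u x + b * S v x"
    and bounded_op_bound: "\<exists>C. \<forall>u\<in>L2 m. norm2 m (S u) \<le> C * norm2 m u"
  using assms unfolding bounded_op_def by auto

lemma bounded_op_diff:
  assumes "bounded_op m S" "u \<in> L2 m" "v \<in> L2 m"
  shows "AE x in m. S (\<lambda>y. u y - v y) x = S u x - S v x"
  using bounded_op_lin[OF assms, of 1 "-1"] by simp

lemma bounded_op_scale:
  assumes "bounded_op m S" "u \<in> L2 m"
  shows "AE x in m. S (\<lambda>y. a * u y) x = a * S u x"
  using bounded_op_lin[OF assms assms(2), of a 0] by simp

lemma inner2_bounded_op_lin:
  assumes S: "bounded_op m S" and "u \<in> L2 m" "v \<in> L2 m" "y \<in> L2 m"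
  shows "inner2 m (S (\<lambda>x. a * u x + b * v x)) y = a * inner2 m (S u) y + b * inner2 m (S v) y"
proof -
  have "inner2 m (S (\<lambda>x. a * u x + b * v x)) y = inner2 m (\<lambda>x. a * S u x + b * S v x) y"
    by (rule inner2_cong_AE) (use assms bounded_op_L2[OF S] bounded_op_lin[OF S] in auto)
  then show ?thesis using assms bounded_op_L2[OF S] by (simp add: inner2_lin_left)
qed

text \<open>Positivity is applied to \<open>|u| + u\<close> and to \<open>|u| - u\<close>.\<close>

lemma pos_op_abs_le:
  assumes S: "bounded_op m S" and u: "u \<in> L2 m"
    and pos: "\<And>v. v \<in> L2 m \<Longrightarrow> nonneg_ae m v \<Longrightarrow> nonneg_ae m (S v)"
  shows "AE x in m. \<bar>S u x\<bar> \<le> S (\<lambda>y. \<bar>u y\<bar>) x"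
proof -
  have au: "(\<lambda>y. \<bar>u y\<bar>) \<in> L2 m" using u by auto
  have "nonneg_ae m (S (\<lambda>y. 1 * \<bar>u y\<bar> + a * u y))" if "a = 1 \<or> a = -1" for a
    by (rule pos, rule L2_lin[OF au u]) (use that in \<open>auto simp: nonneg_ae_def\<close>)
  from this[of 1] this[of "-1"]
  have "nonneg_ae m (S (\<lambda>y. 1 * \<bar>u y\<bar> + 1 * u y))" "nonneg_ae m (S (\<lambda>y. 1 * \<bar>u y\<bar> + (-1) * u y))"
    by blast+
  then show ?thesis
    using bounded_op_lin[OF S au u, of 1 1] bounded_op_lin[OF S au u, of 1 "-1"]
    unfolding nonneg_ae_def by eventually_elim auto
qed

text \<open>The form agrees literally with the hypothesis of the theorem on \<open>T0\<close>. As
  \<open>op_apply\<close> only picks some representative, the working characterization is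
  \<open>inner2_adj\<close>.\<close>

abbreviation adj :: "'a measure \<Rightarrow> (('a \<Rightarrow> real) \<Rightarrow> 'a \<Rightarrow> real) \<Rightarrow> ('a \<Rightarrow> real) \<Rightarrow> 'a \<Rightarrow> real" where
  "adj m S v \<equiv> op_apply (adjoint_op m (graph_of m S)) v"

lemma
  assumes S: "bounded_op m S" and v: "v \<in> L2 m"
  shows adj_L2: "adj m S v \<in> L2 m"
    and inner2_adj: "x \<in> L2 m \<Longrightarrow> inner2 m (adj m S v) x = inner2 m (S x) v"
proof -
  obtain C where C: "\<And>u. u \<in> L2 m \<Longrightarrow> norm2 m (S u) \<le> C * norm2 m u"
    using bounded_op_bound[OF S] by auto
  have "\<exists>w\<in>L2 m. \<forall>u\<in>L2 m. inner2 m w u = inner2 m (S u) v"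
  proof (rule riesz_L2)
    fix u assume u: "u \<in> L2 m"
    show "\<bar>inner2 m (S u) v\<bar> \<le> (C * norm2 m v) * norm2 m u"
      using cauchy_schwarz_L2_le[OF bounded_op_L2[OF S u] v C[OF u]] by (simp add: mult_ac)
  qed (rule inner2_bounded_op_lin[OF S _ _ v])
  then obtain w where w: "w \<in> L2 m" "\<And>u. u \<in> L2 m \<Longrightarrow> inner2 m w u = inner2 m (S u) v" by blast
  have "(v, w) \<in> adjoint_op m (graph_of m S)"
    unfolding adjoint_op_def graph_of_def
    using w v bounded_op_L2[OF S] inner2_cong_AE[OF _ bounded_op_L2[OF S] v]
    by (auto simp: inner2_commute)
  then have *: "(v, adj m S v) \<in> adjoint_op m (graph_of m S)"
    unfolding op_apply_def by (rule someI[where P = "\<lambda>f. (v, f) \<in> _"])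
  then show "adj m S v \<in> L2 m" by (auto simp: adjoint_op_def)
  show "inner2 m (adj m S v) x = inner2 m (S x) v" if x: "x \<in> L2 m"
  proof -
    have "(x, S x) \<in> graph_of m S" using x bounded_op_L2[OF S x] by (auto simp: graph_of_def)
    with * show ?thesis by (auto simp: adjoint_op_def inner2_commute)
  qed
qed

section \<open>Orbits of a positive semigroup and of its adjoint\<close>

locale pos_semigroup =
  fixes m :: "'a measure" and T :: "real \<Rightarrow> ('a \<Rightarrow> real) \<Rightarrow> 'a \<Rightarrow> real"
  assumes sg: "C0_semigroup m T" and pos: "positive_semigroup m T"
begin

lemma bop: "0 \<le> t \<Longrightarrow> bounded_op m (T t)"
  using sg by (auto simp: C0_semigroup_def)

lemma T_L2 [simp, intro]: "0 \<le> t \<Longrightarrow> u \<in> L2 m \<Longrightarrow> T t u \<in> L2 m"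
  by (rule bounded_op_L2[OF bop])

lemma adj_T_L2 [simp, intro]: "0 \<le> t \<Longrightarrow> v \<in> L2 m \<Longrightarrow> adj m (T t) v \<in> L2 m"
  by (rule adj_L2[OF bop])

lemma T_zero: "u \<in> L2 m \<Longrightarrow> AE x in m. T 0 u x = u x"
  using sg by (auto simp: C0_semigroup_def)

lemma inner2_T_zero: "u \<in> L2 m \<Longrightarrow> y \<in> L2 m \<Longrightarrow> inner2 m (T 0 u) y = inner2 m u y"
  by (rule inner2_cong_AE[OF _ _ _ T_zero]) auto

lemma T_add: "0 \<le> s \<Longrightarrow> 0 \<le> t \<Longrightarrow> u \<in> L2 m \<Longrightarrow> AE x in m. T (s + t) u x = T s (T t u) x"
  using sg by (auto simp: C0_semigroup_def)

lemma inner2_T_add: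
  "0 \<le> s \<Longrightarrow> 0 \<le> t \<Longrightarrow> u \<in> L2 m \<Longrightarrow> y \<in> L2 m \<Longrightarrow> inner2 m (T (s + t) u) y = inner2 m (T s (T t u)) y"
  by (rule inner2_cong_AE[OF _ _ _ T_add]) auto

lemma inner2_adj_T: "0 \<le> t \<Longrightarrow> u \<in> L2 m \<Longrightarrow> y \<in> L2 m \<Longrightarrow> inner2 m u (adj m (T t) y) = inner2 m (T t u) y"
  using inner2_adj[OF bop, of t y u] by (simp add: inner2_commute)

lemma T_pos: "0 \<le> t \<Longrightarrow> u \<in> L2 m \<Longrightarrow> nonneg_ae m u \<Longrightarrow> nonneg_ae m (T t u)"
  using pos by (auto simp: positive_semigroup_def)

lemma adj_T_pos:
  assumes "0 \<le> t" "v \<in> L2 m" "nonneg_ae m v"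
  shows "nonneg_ae m (adj m (T t) v)"
  by (rule nonneg_ae_by_duality) (use assms in \<open>auto simp: inner2_adj[OF bop] intro!: inner2_nonneg T_pos\<close>)

lemma inner2_T_diff:
  "0 \<le> t \<Longrightarrow> u \<in> L2 m \<Longrightarrow> v \<in> L2 m \<Longrightarrow> y \<in> L2 m \<Longrightarrow>
    inner2 m (T t (\<lambda>x. u x - v x)) y = inner2 m (T t u) y - inner2 m (T t v) y"
  using inner2_bounded_op_lin[OF bop, of t u v y 1 "-1"] by simp

lemma inner2_T_scale:
  "0 \<le> t \<Longrightarrow> u \<in> L2 m \<Longrightarrow> y \<in> L2 m \<Longrightarrow> inner2 m (T t (\<lambda>x. a * u x)) y = a * inner2 m (T t u) y"
  using inner2_bounded_op_lin[OF bop, of t u u y a 0] by simp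

lemma inner2_T_lin:
  "0 \<le> t \<Longrightarrow> u \<in> L2 m \<Longrightarrow> v \<in> L2 m \<Longrightarrow> y \<in> L2 m \<Longrightarrow>
    inner2 m (T t (\<lambda>x. a * u x + b * v x)) y = a * inner2 m (T t u) y + b * inner2 m (T t v) y"
  by (rule inner2_bounded_op_lin[OF bop])

lemma T_diff: "0 \<le> t \<Longrightarrow> u \<in> L2 m \<Longrightarrow> v \<in> L2 m \<Longrightarrow> AE x in m. T t (\<lambda>y. u y - v y) x = T t u x - T t v x"
  by (rule bounded_op_diff[OF bop])

(* Cutting off at 0 extends orbits to all real times, so that derivatives can be taken two-sided. *)
definition orb :: "('a \<Rightarrow> real) \<Rightarrow> real \<Rightarrow> 'a \<Rightarrow> real" where
  "orb u s = T (max 0 s) u"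

definition adj_orb :: "('a \<Rightarrow> real) \<Rightarrow> real \<Rightarrow> 'a \<Rightarrow> real" where
  "adj_orb v s = adj m (T (max 0 s)) v"

lemma orb_L2 [simp, intro]: "u \<in> L2 m \<Longrightarrow> orb u s \<in> L2 m"
  by (auto simp: orb_def)

lemma adj_orb_L2 [simp, intro]: "v \<in> L2 m \<Longrightarrow> adj_orb v s \<in> L2 m"
  by (auto simp: adj_orb_def)

lemma orb_eq: "0 \<le> s \<Longrightarrow> orb u s = T s u"
  by (simp add: orb_def max_absorb2)

lemma adj_orb_eq: "0 \<le> s \<Longrightarrow> adj_orb v s = adj m (T s) v"
  by (simp add: adj_orb_def max_absorb2)

lemma inner2_adj_orb: "v \<in> L2 m \<Longrightarrow> x \<in> L2 m \<Longrightarrow> inner2 m (adj_orb v s) x = inner2 m (orb x s) v"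
  by (auto simp: adj_orb_def orb_def inner2_adj[OF bop])

lemma orb_pos: "u \<in> L2 m \<Longrightarrow> nonneg_ae m u \<Longrightarrow> nonneg_ae m (orb u s)"
  by (auto simp: orb_def intro!: T_pos)

lemma adj_orb_pos: "u \<in> L2 m \<Longrightarrow> nonneg_ae m u \<Longrightarrow> nonneg_ae m (adj_orb u s)"
  by (auto simp: adj_orb_def intro!: adj_T_pos)

lemma orb_strong:
  assumes u: "u \<in> L2 m"
  shows "((\<lambda>r. norm2 m (\<lambda>x. orb u r x - orb u s x)) \<longlongrightarrow> 0) (at s)"
proof -
  define g where "g r = norm2 m (\<lambda>x. T r u x - T (max 0 s) u x)" for r
  have "(g \<longlongrightarrow> 0) (at (max 0 s) within {0..})"
    using sg u unfolding C0_semigroup_def g_def by auto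
  then have "continuous (at (max 0 s) within {0..}) g"
    by (simp add: continuous_within g_def)
  then have "continuous (at (max 0 s) within range (max 0)) g"
    by (rule continuous_within_subset) auto
  then have "continuous (at s) (g \<circ> max 0)"
    by (rule continuous_within_compose[rotated]) (auto intro: continuous_intros)
  then show ?thesis by (simp add: continuous_within orb_def g_def o_def)
qed

lemma orb_weak_cont:
  assumes u: "u \<in> L2 m" and y: "y \<in> L2 m"
  shows "continuous_on UNIV (\<lambda>s. inner2 m (orb u s) y)"
  unfolding continuous_on_eq_continuous_at[OF open_UNIV] isCont_def
proof
  fix s
  have "((\<lambda>r. norm2 m (\<lambda>x. orb u r x - orb u s x) * norm2 m y) \<longlongrightarrow> 0) (at s)"
    by (rule tendsto_mult_left_zero[OF orb_strong[OF u]])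
  then show "(\<lambda>r. inner2 m (orb u r) y) \<midarrow>s\<rightarrow> inner2 m (orb u s) y"
    by (rule LIM_zero_cancel[OF Lim_null_comparison[rotated]])
      (use cauchy_schwarz_L2[of "\<lambda>x. orb u _ x - orb u s x" m y] u y in \<open>auto simp: inner2_diff_left\<close>)
qed

lemma orb_norm_cont:
  assumes u: "u \<in> L2 m"
  shows "continuous_on UNIV (\<lambda>s. norm2 m (orb u s))"
  unfolding continuous_on_eq_continuous_at[OF open_UNIV] isCont_def
proof
  fix s
  show "(\<lambda>r. norm2 m (orb u r)) \<midarrow>s\<rightarrow> norm2 m (orb u s)"
    by (rule LIM_zero_cancel, rule Lim_null_comparison[OF _ orb_strong[OF u, of s]])
      (use norm2_diff_ineq[OF orb_L2[OF u] orb_L2[OF u]] in auto)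
qed

lemma orb_bdd:
  assumes u: "u \<in> L2 m"
  shows "\<exists>B. \<forall>s\<in>{a..b}. norm2 m (orb u s) \<le> B"
proof -
  have "compact ((\<lambda>s. norm2 m (orb u s)) ` {a..b})"
    by (intro compact_continuous_image continuous_on_subset[OF orb_norm_cont[OF u]]) auto
  then have "bdd_above ((\<lambda>s. norm2 m (orb u s)) ` {a..b})"
    by (intro bounded_imp_bdd_above compact_imp_bounded)
  then show ?thesis by (auto simp: bdd_above_def)
qed

(* Uniform boundedness without Baire: the witnesses u n may be taken nonnegative, and then
   T t (\<Sum>k. u k) dominates every T t (u n). *)
lemma bounded_on_unit: "\<exists>K. \<forall>t\<in>{0..1}. \<forall>u\<in>L2 m. norm2 m (T t u) \<le> K * norm2 m u"
proof (rule ccontr)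
  assume contra: "\<not> ?thesis"
  \<comment> \<open>The factor \<open>8 ^ n\<close> is spent on scaling the witness to norm
    \<open>(1/8) ^ n\<close>, which makes the series of witnesses converge in the norm; the factor
    \<open>n\<close> survives and makes the images unbounded.\<close>
  have "\<exists>t x. t \<in> {0..1} \<and> x \<in> L2 m \<and> norm2 m (T t x) > (real n * 8 ^ n) * norm2 m x" for n :: nat
  proof -
    have "\<forall>K. \<exists>t\<in>{0..1}. \<exists>u\<in>L2 m. K * norm2 m u < norm2 m (T t u)"
      using contra by (simp add: not_le)
    then show ?thesis by blast
  qed
  then obtain t x where t: "\<And>n. t n \<in> {0..1}" and x: "\<And>n. x n \<in> L2 m"
    and big: "\<And>n::nat. norm2 m (T (t n) (x n)) > (real n * 8 ^ n) * norm2 m (x n)" by metis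
  have xpos: "norm2 m (x n) > 0" for n
  proof (rule ccontr)
    assume "\<not> ?thesis"
    then have 0: "norm2 m (x n) = 0" by (simp add: order_antisym not_less)
    obtain C where "norm2 m (T (t n) (x n)) \<le> C * norm2 m (x n)"
      using bounded_op_bound[OF bop, of "t n"] t[of n] x[of n] by auto
    with big[of n] 0 show False by simp
  qed
  define u where "u n = (\<lambda>y. (1 / (8 ^ n * norm2 m (x n))) * \<bar>x n y\<bar>)" for n
  have u: "u n \<in> L2 m" for n unfolding u_def using x by auto
  have u_pos: "0 \<le> u n y" for n y unfolding u_def by simp
  have norm_u: "norm2 m (u n) = (1/8) ^ n" for n
    unfolding u_def norm2_scale using xpos[of n] by (simp add: power_one_over abs_mult)
  have Tu: "real n \<le> norm2 m (T (t n) (u n))" for n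
  proof -
    have t0: "0 \<le> t n" using t[of n] by simp
    have "real n * 8 ^ n * norm2 m (x n) \<le> norm2 m (T (t n) (x n))" using big[of n] by simp
    also have "\<dots> \<le> norm2 m (T (t n) (\<lambda>y. \<bar>x n y\<bar>))"
      by (rule norm2_mono) (use t0 x pos_op_abs_le[OF bop[OF t0] x[of n] T_pos[OF t0]] in \<open>auto elim!: eventually_mono\<close>)
    finally have "real n * 8 ^ n * norm2 m (x n) / (8 ^ n * norm2 m (x n))
       \<le> norm2 m (T (t n) (\<lambda>y. \<bar>x n y\<bar>)) / (8 ^ n * norm2 m (x n))"
      by (intro divide_right_mono) auto
    also have "real n * 8 ^ n * norm2 m (x n) / (8 ^ n * norm2 m (x n)) = real n"
      using xpos[of n] by simp
    also have "norm2 m (T (t n) (\<lambda>y. \<bar>x n y\<bar>)) / (8 ^ n * norm2 m (x n)) =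
        norm2 m (\<lambda>z. (1 / (8 ^ n * norm2 m (x n))) * T (t n) (\<lambda>y. \<bar>x n y\<bar>) z)"
      unfolding norm2_scale by simp
    also have "\<dots> = norm2 m (T (t n) (u n))"
      using bounded_op_scale[OF bop[OF t0] L2_abs[OF x[of n]], of "1 / (8 ^ n * norm2 m (x n))"] t0 x u[of n]
      unfolding u_def by (intro norm2_cong_AE) auto
    finally show ?thesis .
  qed
  define f where "f n y = (\<Sum>i<n. u i y)" for n y
  have f_Suc: "f (Suc n) = (\<lambda>y. f n y + u n y)" for n by (simp add: f_def fun_eq_iff)
  have f: "f n \<in> L2 m" for n
    by (induction n) (auto simp: f_Suc u, simp add: f_def)
  have f_mono: "f n y \<le> f k y" if "n \<le> k" for n k y
    unfolding f_def by (rule sum_mono2) (use that u_pos in auto)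
  have step: "(norm2 m (\<lambda>y. f (Suc n) y - f n y))\<^sup>2 \<le> (1/8) ^ n" for n
  proof -
    have "(norm2 m (\<lambda>y. f (Suc n) y - f n y))\<^sup>2 = (1/8) ^ n * (1/8) ^ n"
      by (simp add: f_Suc norm_u power2_eq_square)
    also have "\<dots> \<le> (1/8) ^ n" by (rule mult_left_le) (auto intro: power_le_one)
    finally show ?thesis .
  qed
  define c where "c k = (1/8::real) ^ k" for k
  have c: "0 \<le> c k" "c k \<le> 1" "c (Suc k) = c k / 8" for k
    by (auto simp: c_def intro: power_le_one)
  \<comment> \<open>The telescoping form is what the induction needs: the increment
    \<open>c k\<close> is at most \<open>2 * c k - 2 * c (Suc k)\<close>. Only the existence of the
    dominating limit \<open>g\<close> is taken from completeness, so the uniform bound 2 derived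
    from this is enough.\<close>
  have "norm2 m (\<lambda>y. f k y - f n y) \<le> 2 * c n - 2 * c k" if "n \<le> k" for n k
    using that
  proof (induction k rule: dec_induct)
    case (step k)
    have "norm2 m (\<lambda>y. f (Suc k) y - f n y) \<le> norm2 m (\<lambda>y. f (Suc k) y - f k y) + norm2 m (\<lambda>y. f k y - f n y)"
      by (rule norm2_triangle_diff) (rule f)+
    also have "norm2 m (\<lambda>y. f (Suc k) y - f k y) = c k" by (simp add: f_Suc norm_u c_def)
    finally show ?case using step.IH c(1)[of k] c(3)[of k] by linarith
  qed simp
  then have "norm2 m (\<lambda>y. f k y - f n y) \<le> 2" if "n \<le> k" for n k
    using that c(2)[of n] c(1)[of k] by fastforce
  then have "(norm2 m (\<lambda>y. f k y - f n y))\<^sup>2 \<le> 4" if "n \<le> k" for n k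
    using that power_mono[of "norm2 m (\<lambda>y. f k y - f n y)" 2 2] by simp
  from L2_complete[OF f step this] obtain g where g: "g \<in> L2 m"
    and lim: "AE y in m. (\<lambda>n. f n y) \<longlonglongrightarrow> g y" by blast
  have ug: "AE y in m. u n y \<le> g y" for n
    using lim
  proof eventually_elim
    case (elim y)
    have "u n y \<le> f (Suc n) y" using f_mono[of 0 n y] by (simp add: f_Suc) (simp add: f_def)
    also have "\<dots> \<le> g y"
      by (rule incseq_le[OF _ elim]) (use f_mono in \<open>auto simp: incseq_def\<close>)
    finally show ?case .
  qed
  obtain B where B: "\<And>s. s \<in> {0..1} \<Longrightarrow> norm2 m (orb g s) \<le> B" using orb_bdd[OF g] by meson
  have "real n \<le> B" for n
  proof -
    have t0: "0 \<le> t n" using t[of n] by simp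
    have "nonneg_ae m (T (t n) (\<lambda>y. g y - u n y))"
      by (rule T_pos[OF t0]) (use g u ug[of n] in \<open>auto simp: nonneg_ae_def\<close>)
    moreover have "nonneg_ae m (T (t n) (u n))"
      by (rule T_pos[OF t0]) (use u u_pos in \<open>auto simp: nonneg_ae_def\<close>)
    ultimately have "AE y in m. \<bar>T (t n) (u n) y\<bar> \<le> \<bar>T (t n) g y\<bar>"
      using T_diff[OF t0 g u[of n]] unfolding nonneg_ae_def by eventually_elim auto
    then have "norm2 m (T (t n) (u n)) \<le> norm2 m (T (t n) g)"
      by (intro norm2_mono) (use t0 u g in auto)
    then show ?thesis using Tu[of n] B[OF t[of n]] by (simp add: orb_eq[OF t0])
  qed
  then show False using reals_Archimedean2[of B] by (meson not_less)
qed

text \<open>The semigroup law peels off unit time steps, each at the cost of a factor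
  \<open>K\<close>. This gives the rate \<open>ln K\<close>, nonnegative since
  \<open>1 \<le> K\<close>; the fractional part of \<open>t\<close> costs the remaining factor
  \<open>K\<close>.\<close>

lemma growth_bound:
  obtains K w where "1 \<le> K" "0 \<le> w" "\<And>t u. 0 \<le> t \<Longrightarrow> u \<in> L2 m \<Longrightarrow> norm2 m (T t u) \<le> K * exp (w * t) * norm2 m u"
proof -
  obtain K0 where K0: "\<And>t u. t \<in> {0..1} \<Longrightarrow> u \<in> L2 m \<Longrightarrow> norm2 m (T t u) \<le> K0 * norm2 m u"
    using bounded_on_unit by blast
  define K where "K = max 1 K0"
  have K: "norm2 m (T t u) \<le> K * norm2 m u" if "t \<in> {0..1}" "u \<in> L2 m" for t u
    using K0[OF that] mult_right_mono[of K0 K "norm2 m u"] by (simp add: K_def)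
  have K1: "1 \<le> K" by (simp add: K_def)
  have pw: "norm2 m (T t u) \<le> K ^ Suc n * norm2 m u" if "0 \<le> t" "t \<le> real n + 1" "u \<in> L2 m" for n t u
    using that
  proof (induction n arbitrary: t)
    case 0
    then show ?case using K[of t u] by simp
  next
    case (Suc n)
    show ?case
    proof (cases "t \<le> 1")
      case True
      have "norm2 m (T t u) \<le> K * norm2 m u" using K True Suc.prems by simp
      also have "\<dots> \<le> K ^ Suc (Suc n) * norm2 m u"
        using self_le_power[OF K1, of "Suc (Suc n)"] by (intro mult_right_mono) auto
      finally show ?thesis .
    next
      case False
      then have "AE x in m. T (1 + (t - 1)) u x = T 1 (T (t - 1) u) x"
        using Suc.prems by (intro T_add) auto
      then have "norm2 m (T t u) = norm2 m (T 1 (T (t - 1) u))"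
        using False Suc.prems by (intro norm2_cong_AE) auto
      also have "\<dots> \<le> K * norm2 m (T (t - 1) u)" using False Suc.prems by (intro K) auto
      also have "\<dots> \<le> K * (K ^ Suc n * norm2 m u)"
        using False Suc K1 by (intro mult_left_mono Suc.IH) auto
      finally show ?thesis by (simp add: mult_ac)
    qed
  qed
  show ?thesis
  proof (rule that[OF K1, of "ln K"])
    show "0 \<le> ln K" using K1 by simp
    fix t u assume t: "(0::real) \<le> t" and u: "u \<in> L2 m"
    define n where "n = nat \<lfloor>t\<rfloor>"
    have n: "real n \<le> t" "t \<le> real n + 1" using t unfolding n_def by linarith+
    have "norm2 m (T t u) \<le> K ^ Suc n * norm2 m u" by (rule pw[OF t n(2) u])
    also have "K ^ n = exp (ln K * real n)" using K1 by (simp add: exp_of_nat2_mult)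
    then have "K ^ Suc n * norm2 m u = K * exp (ln K * real n) * norm2 m u" by simp
    also have "\<dots> \<le> K * exp (ln K * t) * norm2 m u"
      using n K1 by (intro mult_right_mono mult_left_mono) (auto intro: mult_left_mono)
    finally show "norm2 m (T t u) \<le> K * exp (ln K * t) * norm2 m u" .
  qed
qed

lemma locally_bounded:
  obtains K where "0 \<le> K" "\<And>t u. t \<in> {0..b} \<Longrightarrow> u \<in> L2 m \<Longrightarrow> norm2 m (T t u) \<le> K * norm2 m u"
proof -
  obtain K w where K: "1 \<le> K" "0 \<le> w"
    "\<And>t u. 0 \<le> t \<Longrightarrow> u \<in> L2 m \<Longrightarrow> norm2 m (T t u) \<le> K * exp (w * t) * norm2 m u"
    using growth_bound by metis
  show ?thesis
  proof (rule that[of "K * exp (w * b)"])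
    fix t u assume t: "t \<in> {0..b}" and u: "u \<in> L2 m"
    have "norm2 m (T t u) \<le> K * exp (w * t) * norm2 m u" using K t u by auto
    also have "\<dots> \<le> K * exp (w * b) * norm2 m u"
      using K t by (intro mult_right_mono mult_left_mono) (auto intro: mult_left_mono)
    finally show "norm2 m (T t u) \<le> K * exp (w * b) * norm2 m u" .
  qed (use K in auto)
qed

lemma strong_curve_orb: "u \<in> L2 m \<Longrightarrow> strong_curve m (orb u)"
  by unfold_locales (auto intro: orb_weak_cont orb_bdd orb_strong)

lemma norm2_adj_orb_le:
  assumes K: "\<And>t u. t \<in> {0..b} \<Longrightarrow> u \<in> L2 m \<Longrightarrow> norm2 m (T t u) \<le> K * norm2 m u"
    and "0 \<le> K" and v: "v \<in> L2 m" and s: "s \<le> b" "0 \<le> b"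
  shows "norm2 m (adj_orb v s) \<le> K * norm2 m v"
proof (rule norm2_le_by_duality)
  fix y assume y: "y \<in> L2 m"
  have "norm2 m (orb y s) \<le> K * norm2 m y"
    unfolding orb_def by (rule K) (use s y in auto)
  then have "inner2 m (orb y s) v \<le> K * norm2 m y * norm2 m v"
    using cauchy_schwarz_L2_le[of "orb y s" m v] y v by fastforce
  then show "inner2 m (adj_orb v s) y \<le> K * norm2 m v * norm2 m y"
    using v y by (simp add: inner2_adj_orb mult_ac)
qed (use assms in auto)

lemma weak_curve_adj_orb: 
  assumes v: "v \<in> L2 m"
  shows "weak_curve m (adj_orb v)"
proof
  fix a b :: real
  obtain K where K: "0 \<le> K" "\<And>t u. t \<in> {0..max 0 b} \<Longrightarrow> u \<in> L2 m \<Longrightarrow> norm2 m (T t u) \<le> K * norm2 m u"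
    using locally_bounded by metis
  show "\<exists>B. \<forall>s\<in>{a..b}. norm2 m (adj_orb v s) \<le> B"
    by (intro exI[of _ "K * norm2 m v"] ballI norm2_adj_orb_le[where b = "max 0 b"]) (use K v in auto)
qed (use v in \<open>auto simp: inner2_adj_orb intro: orb_weak_cont\<close>)

end

section \<open>Generators, their adjoints, and averages as elements of the domains\<close>

lemma op_apply_mem: "u \<in> Domain A \<Longrightarrow> (u, op_apply A u) \<in> A"
  unfolding op_apply_def Domain_iff by (erule exE, rule someI[where P = "\<lambda>f. (u, f) \<in> A"])

lemma integral_of_deriv_shift:
  fixes F p :: "real \<Rightarrow> real"
  assumes F: "\<And>x. (F has_real_derivative p x) (at x)" and "a \<le> b"
  shows "integral {a..b} (\<lambda>x. p (x + c)) = F (b + c) - F (a + c)"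
proof (rule integral_unique, rule fundamental_theorem_of_calculus[OF \<open>a \<le> b\<close>])
  fix x
  have "((\<lambda>x. F (x + c)) has_real_derivative p (x + c)) (at x)"
    using F[of "x + c"] by (simp add: DERIV_shift)
  then show "((\<lambda>x. F (x + c)) has_vector_derivative p (x + c)) (at x within {a..b})"
    by (simp add: has_real_derivative_iff_has_vector_derivative has_vector_derivative_at_within)
qed

lemma adjoint_opD:
  assumes "(v, g) \<in> adjoint_op m A"
  shows "v \<in> L2 m" "g \<in> L2 m" "(x, y) \<in> A \<Longrightarrow> inner2 m y v = inner2 m x g"
  using assms by (auto simp: adjoint_op_def)

context pos_semigroup
begin

abbreviation A where "A \<equiv> generator m T"

lemma generatorD:
  assumes "(u, g) \<in> A"
  shows "u \<in> L2 m" "g \<in> L2 m"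
    "((\<lambda>t. norm2 m (\<lambda>x. (T t u x - u x) / t - g x)) \<longlongrightarrow> 0) (at_right 0)"
  using assms by (auto simp: generator_def)

lemma inner2_generator_tendsto:
  assumes ug: "(u, g) \<in> A" and y: "y \<in> L2 m"
  shows "((\<lambda>h. (inner2 m (T h u) y - inner2 m u y) / h) \<longlongrightarrow> inner2 m g y) (at_right 0)"
proof (rule LIM_zero_cancel, rule Lim_null_comparison)
  show "((\<lambda>h. norm2 m (\<lambda>x. (T h u x - u x) / h - g x) * norm2 m y) \<longlongrightarrow> 0) (at_right 0)"
    by (rule tendsto_mult_left_zero[OF generatorD(3)[OF ug]])
  show "\<forall>\<^sub>F h in at_right 0. norm ((inner2 m (T h u) y - inner2 m u y) / h - inner2 m g y)
      \<le> norm2 m (\<lambda>x. (T h u x - u x) / h - g x) * norm2 m y"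
    using eventually_at_right_less[of "0::real"]
  proof eventually_elim
    case (elim h)
    have "(inner2 m (T h u) y - inner2 m u y) / h - inner2 m g y = inner2 m (\<lambda>x. (T h u x - u x) / h - g x) y"
      using generatorD(1,2)[OF ug] y elim by (simp add: inner2_simps)
    then show ?case
      using cauchy_schwarz_L2[of "\<lambda>x. (T h u x - u x) / h - g x" m y] generatorD(1,2)[OF ug] y elim
      by auto
  qed
qed

lemma generator_unique:
  assumes "(u, g) \<in> A" "(u, g') \<in> A"
  shows "AE x in m. g x = g' x"
  by (rule AE_eq_by_duality)
    (use assms generatorD in \<open>auto intro: tendsto_unique[OF _ inner2_generator_tendsto inner2_generator_tendsto]\<close>)

lemma inner2_op_apply_generator:
  assumes ug: "(u, g) \<in> A" and y: "y \<in> L2 m"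
  shows "inner2 m (op_apply A u) y = inner2 m g y"
proof -
  have *: "(u, op_apply A u) \<in> A" using ug by (intro op_apply_mem) auto
  show ?thesis
    by (rule inner2_cong_AE) (use generator_unique[OF * ug] generatorD[OF *] generatorD[OF ug] y in auto)
qed

lemma generator_lin:
  assumes ug: "(u, g) \<in> A" and wk: "(w, k) \<in> A"
  shows "((\<lambda>x. a * u x + b * w x), (\<lambda>x. a * g x + b * k x)) \<in> A"
proof -
  note u = generatorD[OF ug] and w = generatorD[OF wk]
  let ?l = "\<lambda>x. a * u x + b * w x"
  have "((\<lambda>h. norm2 m (\<lambda>x. (T h ?l x - ?l x) / h - (a * g x + b * k x))) \<longlongrightarrow> 0) (at_right 0)"
  proof (rule Lim_null_comparison)
    show "((\<lambda>h. \<bar>a\<bar> * norm2 m (\<lambda>x. (T h u x - u x) / h - g x) + \<bar>b\<bar> * norm2 m (\<lambda>x. (T h w x - w x) / h - k x)) \<longlongrightarrow> 0) (at_right 0)"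
      using tendsto_add[OF tendsto_mult_left[OF u(3), of "\<bar>a\<bar>"] tendsto_mult_left[OF w(3), of "\<bar>b\<bar>"]] by simp
    show "\<forall>\<^sub>F h in at_right 0. norm (norm2 m (\<lambda>x. (T h ?l x - ?l x) / h - (a * g x + b * k x)))
       \<le> \<bar>a\<bar> * norm2 m (\<lambda>x. (T h u x - u x) / h - g x) + \<bar>b\<bar> * norm2 m (\<lambda>x. (T h w x - w x) / h - k x)"
      using eventually_at_right_less[of "0::real"]
    proof eventually_elim
      case (elim h)
      have "AE x in m. (T h ?l x - ?l x) / h - (a * g x + b * k x) =
          a * ((T h u x - u x) / h - g x) + b * ((T h w x - w x) / h - k x)"
        using bounded_op_lin[OF bop u(1) w(1), of h a b] elim
        by (auto simp: field_simps elim!: eventually_mono)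
      then have "norm2 m (\<lambda>x. (T h ?l x - ?l x) / h - (a * g x + b * k x)) =
          norm2 m (\<lambda>x. a * ((T h u x - u x) / h - g x) + b * ((T h w x - w x) / h - k x))"
        using u w elim by (intro norm2_cong_AE) (auto intro!: L2_lin L2_diff L2_divide)
      also have "\<dots> \<le> norm2 m (\<lambda>x. a * ((T h u x - u x) / h - g x)) + norm2 m (\<lambda>x. b * ((T h w x - w x) / h - k x))"
        using u w elim by (intro norm2_triangle) (auto intro!: L2_scale L2_diff L2_divide)
      finally show ?case by (simp only: norm2_scale real_norm_def abs_of_nonneg[OF norm2_nonneg])
    qed
  qed
  then show ?thesis unfolding generator_def using u w by auto
qed

text \<open>The hypothesis says that the difference quotient of \<open>w\<close> equals the average
  of the orbit of \<open>g\<close> over \<open>[0, h]\<close>, and this average tends to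
  \<open>g\<close> in norm. So membership in the generator, defined by norm convergence, can be
  verified by an identity between real integrals.\<close>

lemma generator_by_integral:
  assumes w: "w \<in> L2 m" and g: "g \<in> L2 m"
    and eq: "\<And>h y. 0 < h \<Longrightarrow> y \<in> L2 m \<Longrightarrow>
      inner2 m (T h w) y - inner2 m w y = integral {0..h} (\<lambda>s. inner2 m (orb g s) y)"
  shows "(w, g) \<in> A"
proof -
  interpret G: strong_curve m "orb g" by (rule strong_curve_orb[OF g])
  have "((\<lambda>h. norm2 m (\<lambda>x. (T h w x - w x) / h - g x)) \<longlongrightarrow> 0) (at_right 0)"
  proof (rule Lim_transform_eventually[OF G.wavg_strong_tendsto[of 0]])
    show "\<forall>\<^sub>F h in at_right 0. norm2 m (\<lambda>x. wavg m (orb g) h 0 x - orb g 0 x) =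
        norm2 m (\<lambda>x. (T h w x - w x) / h - g x)"
      using eventually_at_right_less[of "0::real"]
    proof eventually_elim
      case (elim h)
      have "AE x in m. wavg m (orb g) h 0 x = (T h w x - w x) / h"
        using elim w by (intro AE_eq_by_duality) (auto simp: inner2_simps G.inner2_wavg eq simp flip: diff_divide_distrib)
      moreover have "AE x in m. orb g 0 x = g x" using T_zero[OF g] by (simp add: orb_eq)
      ultimately have "AE x in m. wavg m (orb g) h 0 x - orb g 0 x = (T h w x - w x) / h - g x"
        by eventually_elim simp
      then show ?case using elim w g by (intro norm2_cong_AE) auto
    qed
  qed
  then show ?thesis using w g by (simp add: generator_def)
qed

lemma inner2_orb_add:
  "0 \<le> s \<Longrightarrow> 0 \<le> k \<Longrightarrow> u \<in> L2 m \<Longrightarrow> y \<in> L2 m \<Longrightarrow> inner2 m (T k (orb u s)) y = inner2 m (orb u (s + k)) y"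
  using inner2_T_add[of k s u y] by (simp add: orb_eq add.commute)

lemma inner2_orb_diff:
  "u \<in> L2 m \<Longrightarrow> v \<in> L2 m \<Longrightarrow> y \<in> L2 m \<Longrightarrow>
    inner2 m (orb (\<lambda>x. u x - v x) s) y = inner2 m (orb u s) y - inner2 m (orb v s) y"
  by (simp add: orb_def inner2_T_diff)

lemma inner2_orb_scale:
  "u \<in> L2 m \<Longrightarrow> y \<in> L2 m \<Longrightarrow> inner2 m (orb (\<lambda>x. a * u x) s) y = a * inner2 m (orb u s) y"
  by (simp add: orb_def inner2_T_scale)

lemma inner2_orb_cong:
  assumes "u \<in> L2 m" "v \<in> L2 m" "y \<in> L2 m" "AE x in m. u x = v x"
  shows "inner2 m (orb u s) y = inner2 m (orb v s) y"
  unfolding orb_def by (rule inner2_cong_AE) (use assms bounded_op_cong[OF bop, of "max 0 s" u v] in auto)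

text \<open>Applying \<open>T k\<close> shifts the averaging window by \<open>k\<close>. With an
  antiderivative \<open>F\<close> of the paired orbit, both sides of the equation required by
  \<open>generator_by_integral\<close> become
  \<open>(F (s + h + k) - F (s + k) - F (s + h) + F s) / h\<close>.\<close>

lemma wavg_orb_generator:
  assumes u: "u \<in> L2 m" and h: "0 < h" and s: "0 \<le> s"
  shows "(wavg m (orb u) h s, (\<lambda>x. (orb u (s + h) x - orb u s x) / h)) \<in> A"
proof -
  interpret U: strong_curve m "orb u" by (rule strong_curve_orb[OF u])
  let ?g = "\<lambda>x. (orb u (s + h) x - orb u s x) / h"
  show ?thesis
  proof (rule generator_by_integral)
    fix k y assume k: "(0::real) < k" and y: "y \<in> L2 m"
    obtain F where F: "\<And>s. (F has_real_derivative inner2 m (orb u s) y) (at s)"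
      "\<And>s. inner2 m (wavg m (orb u) h s) y = (F (s + h) - F s) / h"
      using U.inner2_wavg_antiderivative[OF h y] by metis
    have "inner2 m (T k (wavg m (orb u) h s)) y = inner2 m (wavg m (orb u) h s) (adj m (T k) y)"
      using h k y u by (subst inner2_adj_T) auto
    also have "\<dots> = integral {s..s + h} (\<lambda>r. inner2 m (orb u r) (adj m (T k) y)) / h"
      using h k y by (subst U.inner2_wavg) auto
    also have "integral {s..s + h} (\<lambda>r. inner2 m (orb u r) (adj m (T k) y)) = integral {s..s + h} (\<lambda>r. inner2 m (orb u (r + k)) y)"
      by (rule integral_cong) (use k y u s in \<open>auto simp: inner2_adj_T inner2_orb_add\<close>)
    also have "\<dots> = F (s + h + k) - F (s + k)"
      by (rule integral_of_deriv_shift) (use F h in auto)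
    finally have 1: "inner2 m (T k (wavg m (orb u) h s)) y = (F (s + h + k) - F (s + k)) / h" .
    have "integral {0..k} (\<lambda>r. inner2 m (orb ?g r) y) =
       integral {0..k} (\<lambda>r. (inner2 m (orb u (r + (s + h))) y - inner2 m (orb u (r + s)) y) / h)"
    proof (rule integral_cong)
      fix r assume r: "r \<in> {0..k}"
      have "inner2 m (orb ?g r) y = (inner2 m (T r (orb u (s + h))) y - inner2 m (T r (orb u s)) y) / h"
        using r u y inner2_T_scale[of r "\<lambda>x. orb u (s + h) x - orb u s x" y "1 / h"]
        by (simp add: orb_eq inner2_T_diff)
      then show "inner2 m (orb ?g r) y = (inner2 m (orb u (r + (s + h))) y - inner2 m (orb u (r + s)) y) / h"
        using r u y h s by (simp add: inner2_orb_add add_ac)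
    qed
    also have "\<dots> = (F (k + (s + h)) - F (k + s)) / h - (F (0 + (s + h)) - F (0 + s)) / h"
      by (rule integral_of_deriv_shift[where c = 0 and F = "\<lambda>r. (F (r + (s + h)) - F (r + s)) / h", simplified])
        (use k less_imp_neq[OF h] in \<open>auto intro!: derivative_eq_intros DERIV_chain2[OF F(1)]\<close>)
    finally have 2: "integral {0..k} (\<lambda>r. inner2 m (orb ?g r) y) =
       (F (k + (s + h)) - F (k + s)) / h - (F (s + h) - F s) / h" by simp
    show "inner2 m (T k (wavg m (orb u) h s)) y - inner2 m (wavg m (orb u) h s) y =
         integral {0..k} (\<lambda>r. inner2 m (orb ?g r) y)"
      unfolding 1 2 F(2) by (simp add: add_ac)
  qed (use u h in auto)
qed

lemma orb_zero: "u \<in> L2 m \<Longrightarrow> AE x in m. orb u 0 x = u x"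
  using T_zero by (simp add: orb_eq)

lemma inner2_orb_zero: "u \<in> L2 m \<Longrightarrow> y \<in> L2 m \<Longrightarrow> inner2 m (orb u 0) y = inner2 m u y"
  by (simp add: orb_eq inner2_T_zero)

lemma generator_dense:
  assumes u: "u \<in> L2 m" and e: "0 < e"
  shows "\<exists>x g. (x, g) \<in> A \<and> norm2 m (\<lambda>z. x z - u z) < e"
proof -
  interpret U: strong_curve m "orb u" by (rule strong_curve_orb[OF u])
  have "\<forall>\<^sub>F h in at_right 0. norm2 m (\<lambda>x. wavg m (orb u) h 0 x - orb u 0 x) < e"
    using order_tendstoD(2)[OF U.wavg_strong_tendsto e] .
  then have "\<forall>\<^sub>F h in at_right 0. 0 < h \<and> norm2 m (\<lambda>x. wavg m (orb u) h 0 x - orb u 0 x) < e"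
    using eventually_at_right_less[of "0::real"] by eventually_elim simp
  then obtain h where h: "0 < h" "norm2 m (\<lambda>x. wavg m (orb u) h 0 x - orb u 0 x) < e"
    using eventually_happens' trivial_limit_at_right_real by blast
  have "norm2 m (\<lambda>x. wavg m (orb u) h 0 x - u x) = norm2 m (\<lambda>x. wavg m (orb u) h 0 x - orb u 0 x)"
    using h u orb_zero[OF u] by (intro norm2_cong_AE) auto
  with h show ?thesis using wavg_orb_generator[OF u h(1), of 0] by auto
qed

text \<open>This rests on density of the domain: averages of the orbit of \<open>u\<close> lie in it
  and recover \<open>u\<close> weakly as \<open>h\<close> tends to 0. It makes the choice of a value
  in \<open>op_apply (adjoint_op m A)\<close> harmless.\<close>

lemma adjoint_generator_unique:
  assumes g: "(v, g) \<in> adjoint_op m A" and g': "(v, g') \<in> adjoint_op m A"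
  shows "AE x in m. g x = g' x"
proof (rule AE_eq_by_duality)
  note G = adjoint_opD[OF g] and G' = adjoint_opD[OF g']
  fix u assume u: "u \<in> L2 m"
  interpret U: strong_curve m "orb u" by (rule strong_curve_orb[OF u])
  have eq: "inner2 m (wavg m (orb u) h 0) g = inner2 m (wavg m (orb u) h 0) g'" if "0 < h" for h
    using G(3)[OF wavg_orb_generator[OF u that, of 0]] G'(3)[OF wavg_orb_generator[OF u that, of 0]] by simp
  have "((\<lambda>h. inner2 m (wavg m (orb u) h 0) g) \<longlongrightarrow> inner2 m (orb u 0) g') (at_right 0)"
    by (rule Lim_transform_eventually[OF U.inner2_wavg_tendsto])
      (use eventually_at_right_less[of "0::real"] G' in \<open>auto simp: eq elim!: eventually_mono\<close>)
  then have "inner2 m (orb u 0) g' = inner2 m (orb u 0) g"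
    by (rule tendsto_unique[rotated, OF _ U.inner2_wavg_tendsto[OF G(2)]]) simp
  then show "inner2 m g u = inner2 m g' u"
    using inner2_orb_zero[OF u G(2)] inner2_orb_zero[OF u G'(2)] by (simp add: inner2_commute)
qed (use adjoint_opD[OF g] adjoint_opD[OF g'] in auto)

lemma inner2_op_apply_adjoint:
  assumes ug: "(v, g) \<in> adjoint_op m A" and y: "y \<in> L2 m"
  shows "inner2 m y (op_apply (adjoint_op m A) v) = inner2 m y g"
proof -
  have *: "(v, op_apply (adjoint_op m A) v) \<in> adjoint_op m A" using ug by (intro op_apply_mem) auto
  have "inner2 m (op_apply (adjoint_op m A) v) y = inner2 m g y"
    by (rule inner2_cong_AE) (use adjoint_generator_unique[OF * ug] adjoint_opD[OF *] adjoint_opD[OF ug] y in auto)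
  then show ?thesis by (simp add: inner2_commute)
qed

text \<open>The definition of the generator controls only difference quotients to the right. The
  estimate \<open>est\<close> therefore compares the quotient over \<open>[a, b]\<close> with
  \<open>q\<close> at the left endpoint \<open>a\<close>, uniformly through the local bound on
  \<open>T a\<close>. When \<open>s\<close> is approached from the left, the left endpoint is the
  moving point \<open>r\<close>, and continuity of \<open>q\<close> supplies the missing term
  \<open>q (min r s) - q s\<close>.\<close>

lemma orb_generator_deriv:
  assumes ug: "(u, g) \<in> A" and y: "y \<in> L2 m" and s: "0 \<le> s"
  shows "((\<lambda>s. inner2 m (orb u s) y) has_real_derivative inner2 m (orb g s) y) (at s within {0..})"
proof -
  note u = generatorD(1)[OF ug] and g = generatorD(2)[OF ug]
  obtain K where K: "0 \<le> K" "\<And>t u. t \<in> {0..s + 1} \<Longrightarrow> u \<in> L2 m \<Longrightarrow> norm2 m (T t u) \<le> K * norm2 m u"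
    using locally_bounded by metis
  define \<delta> where "\<delta> h = norm2 m (\<lambda>x. (T h u x - u x) / h - g x)" for h
  define p where "p r = inner2 m (orb u r) y" for r
  define q where "q r = inner2 m (orb g r) y" for r
  have est: "\<bar>(p b - p a) / (b - a) - q a\<bar> \<le> K * \<delta> (b - a) * norm2 m y"
    if ab: "0 \<le> a" "a < b" "b \<le> s + 1" for a b
  proof -
    define h where "h = b - a"
    have h: "0 < h" "b = a + h" using ab by (auto simp: h_def)
    define d where "d = (\<lambda>x. (T h u x - u x) / h - g x)"
    have d: "d \<in> L2 m" using u g h by (auto simp: d_def)
    have "T a d = T a (\<lambda>x. (1/h) * (\<lambda>x. T h u x - u x) x + (-1) * g x)" by (simp add: d_def)
    then have "inner2 m (T a d) y = (1/h) * inner2 m (T a (\<lambda>x. T h u x - u x)) y + (-1) * inner2 m (T a g) y"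
      using ab u g h y by (simp only:) (subst inner2_T_lin, auto)
    also have "inner2 m (T a (\<lambda>x. T h u x - u x)) y = p b - p a"
      using ab h u y inner2_T_add[of a h u y] by (simp add: inner2_T_diff p_def orb_eq)
    finally have "(p b - p a) / (b - a) - q a = inner2 m (T a d) y"
      using ab by (simp add: h_def q_def orb_eq)
    also have "\<bar>\<dots>\<bar> \<le> K * norm2 m d * norm2 m y"
      by (rule cauchy_schwarz_L2_le) (use ab d y K in auto)
    finally show ?thesis by (simp add: \<delta>_def d_def h_def)
  qed
  have lim0: "filterlim (\<lambda>r. \<bar>r - s\<bar>) (at_right 0) (at s within {0..})"
    unfolding filterlim_at
  proof
    show "\<forall>\<^sub>F r in at s within {0..}. \<bar>r - s\<bar> \<in> {0<..} \<and> \<bar>r - s\<bar> \<noteq> 0"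
      by (auto simp: eventually_at_filter)
    have "((\<lambda>r. \<bar>r - s\<bar>) \<longlongrightarrow> \<bar>s - s\<bar>) (at s within {0..})" by (intro tendsto_intros)
    then show "((\<lambda>r. \<bar>r - s\<bar>) \<longlongrightarrow> 0) (at s within {0..})" by simp
  qed
  have lim1: "((\<lambda>r. K * \<delta> \<bar>r - s\<bar> * norm2 m y) \<longlongrightarrow> K * 0 * norm2 m y) (at s within {0..})"
    unfolding \<delta>_def by (intro tendsto_intros filterlim_compose[OF generatorD(3)[OF ug] lim0])
  have "continuous_on UNIV q" unfolding q_def by (rule orb_weak_cont[OF g y])
  then have "isCont q s" by (simp add: continuous_on_eq_continuous_at)
  then have "isCont q (min s s)" by simp
  moreover have "((\<lambda>r. min r s) \<longlongrightarrow> min s s) (at s within {0..})" by (intro tendsto_intros)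
  ultimately have "((\<lambda>r. q (min r s)) \<longlongrightarrow> q (min s s)) (at s within {0..})" by (rule isCont_tendsto_compose)
  then have lim2: "((\<lambda>r. \<bar>q (min r s) - q s\<bar>) \<longlongrightarrow> \<bar>q s - q s\<bar>) (at s within {0..})"
    by (intro tendsto_intros) simp
  have "((\<lambda>r. (p r - p s) / (r - s)) \<longlongrightarrow> q s) (at s within {0..})"
  proof (rule LIM_zero_cancel, rule Lim_null_comparison)
    show "((\<lambda>r. K * \<delta> \<bar>r - s\<bar> * norm2 m y + \<bar>q (min r s) - q s\<bar>) \<longlongrightarrow> 0) (at s within {0..})"
      using tendsto_add[OF lim1 lim2] by simp
    have ev1: "\<forall>\<^sub>F r in at s within {0..}. r < s + 1"
      using eventually_at_topological[of "\<lambda>r. r < s + 1" s "{0..}"]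
      by (auto intro!: exI[of _ "{..<s + 1}"])
    have ev2: "\<forall>\<^sub>F r in at s within {0..}. r \<noteq> s \<and> 0 \<le> r" by (simp add: eventually_at_filter)
    show "\<forall>\<^sub>F r in at s within {0..}. norm ((p r - p s) / (r - s) - q s)
        \<le> K * \<delta> \<bar>r - s\<bar> * norm2 m y + \<bar>q (min r s) - q s\<bar>"
      using ev1 ev2
    proof eventually_elim
      case (elim r)
      show ?case
      proof (cases "s < r")
        case True
        then show ?thesis using est[of s r] s elim by simp
      next
        case False
        then have r: "r < s" using elim by simp
        have "(p r - p s) / (r - s) = (p s - p r) / (s - r)"
          by (metis minus_diff_eq minus_divide_divide)
        then show ?thesis using est[of r s] elim r by (simp add: min_def)
      qed
    qed
  qed
  then show ?thesis unfolding p_def q_def by (simp add: has_field_derivative_iff)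
qed

text \<open>The adjoint orbit itself is never differentiated. Pairing its average with
  \<open>x'\<close> integrates the derivative of \<open>inner2 m (orb x r) v\<close>, and the
  boundary terms form the claimed difference quotient.\<close>

lemma wavg_adj_orb_generator:
  assumes v: "v \<in> L2 m" and h: "0 < h" and s: "0 \<le> s"
  shows "(wavg m (adj_orb v) h s, (\<lambda>x. (adj_orb v (s + h) x - adj_orb v s x) / h)) \<in> adjoint_op m A"
proof -
  interpret V: weak_curve m "adj_orb v" by (rule weak_curve_adj_orb[OF v])
  have "inner2 m x' (wavg m (adj_orb v) h s) = inner2 m x (\<lambda>z. (adj_orb v (s + h) z - adj_orb v s z) / h)"
    if xx: "(x, x') \<in> A" for x x'
  proof -
    note x = generatorD(1)[OF xx] and x' = generatorD(2)[OF xx]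
    have "integral {s..s + h} (\<lambda>r. inner2 m (orb x' r) v) = inner2 m (orb x (s + h)) v - inner2 m (orb x s) v"
      by (rule integral_unique, rule fundamental_theorem_of_calculus)
        (use h s in \<open>auto intro!: has_vector_derivative_within_subset[OF
          orb_generator_deriv[OF xx v, unfolded has_real_derivative_iff_has_vector_derivative]]\<close>)
    then have "inner2 m (wavg m (adj_orb v) h s) x' = (inner2 m (orb x (s + h)) v - inner2 m (orb x s) v) / h"
      using h x' v by (simp add: V.inner2_wavg inner2_adj_orb)
    also have "\<dots> = inner2 m (\<lambda>z. (adj_orb v (s + h) z - adj_orb v s z) / h) x"
      using x v by (simp add: inner2_simps inner2_adj_orb)
    finally show ?thesis by (simp add: inner2_commute)
  qed
  then show ?thesis using h v by (auto simp: adjoint_op_def)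
qed

end

section \<open>Resolvents of positive semigroups\<close>

lemma filterlim_add_const_at_top: "filterlim (\<lambda>t::real. t + c) at_top at_top"
  using filterlim_tendsto_add_at_top[OF tendsto_const filterlim_ident, of c] by (simp add: add.commute)

lemma bounded_mono_tendsto_at_top:
  fixes F :: "real \<Rightarrow> real"
  assumes mono: "\<And>s t. 0 \<le> s \<Longrightarrow> s \<le> t \<Longrightarrow> F s \<le> F t" and le: "\<And>t. 0 \<le> t \<Longrightarrow> F t \<le> c"
  shows "\<exists>L. (F \<longlongrightarrow> L) at_top"
proof -
  have bdd: "bdd_above (F ` {0..})" using le by (auto simp: bdd_above_def)
  show ?thesis
  proof (rule exI[of _ "Sup (F ` {0..})"], rule order_tendstoI)
    fix a assume "a < Sup (F ` {0..})"
    then obtain s where s: "0 \<le> s" "a < F s" using less_cSup_iff[OF _ bdd] by auto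
    then have "a < F t" if "s \<le> t" for t using mono[of s t] that by auto
    then show "\<forall>\<^sub>F t in at_top. a < F t" by (auto simp: eventually_at_top_linorder)
  next
    fix a assume "Sup (F ` {0..}) < a"
    then have "F t < a" if "0 \<le> t" for t
      using cSup_upper[OF _ bdd, of "F t"] that by (auto intro: order_le_less_trans)
    then show "\<forall>\<^sub>F t in at_top. F t < a" by (auto simp: eventually_at_top_linorder)
  qed
qed

lemma integral_exp_mult:
  fixes b t :: real
  assumes "b \<noteq> 0" "0 \<le> t"
  shows "integral {0..t} (\<lambda>s. C * exp (b * s)) = C / b * exp (b * t) - C / b"
proof (rule integral_unique)
  have "((\<lambda>s. C * exp (b * s)) has_integral (C / b * exp (b * t) - C / b * exp (b * 0))) {0..t}"
    by (rule fundamental_theorem_of_calculus[OF assms(2)])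
      (use assms in \<open>auto intro!: derivative_eq_intros simp flip: has_real_derivative_iff_has_vector_derivative\<close>)
  then show "((\<lambda>s. C * exp (b * s)) has_integral (C / b * exp (b * t) - C / b)) {0..t}" by simp
qed

lemma integral_exp_mult_le:
  fixes d t :: real
  assumes "0 < d" "0 \<le> t" "0 \<le> C"
  shows "integral {0..t} (\<lambda>s. C * exp (- d * s)) \<le> C / d"
  using assms by (subst integral_exp_mult) auto

lemma exp_neg_tendsto_0:
  fixes d :: real
  assumes "0 < d"
  shows "((\<lambda>t. C * exp (- d * t)) \<longlongrightarrow> 0) at_top"
proof -
  have "filterlim (\<lambda>t. - d * t) at_bot at_top"
    by (rule filterlim_tendsto_neg_mult_at_bot[OF tendsto_const _ filterlim_ident]) (use assms in simp)
  then have "((\<lambda>t. exp (- d * t)) \<longlongrightarrow> 0) at_top" by (rule filterlim_compose[OF exp_at_bot])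
  from tendsto_mult_left[OF this, of C] show ?thesis by simp
qed

(* Adding C exp (- d s) makes the integrand nonnegative, so the integrals become monotone. *)
lemma exp_bounded_integral_tendsto:
  fixes q :: "real \<Rightarrow> real"
  assumes cont: "continuous_on UNIV q" and d: "0 < d"
    and le: "\<And>s. 0 \<le> s \<Longrightarrow> \<bar>q s\<bar> \<le> C * exp (- d * s)"
  shows "\<exists>L. ((\<lambda>t. integral {0..t} q) \<longlongrightarrow> L) at_top"
proof -
  have int: "q integrable_on {a..b}" "(\<lambda>s. C * exp (- d * s)) integrable_on {a..b}" for a b
    by (auto intro!: integrable_continuous_interval continuous_on_subset[OF cont] continuous_intros)
  have C: "0 \<le> C" using le[of 0] by simp
  define G where "G t = integral {0..t} (\<lambda>s. q s + C * exp (- d * s))" for t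
  have nn: "0 \<le> q s + C * exp (- d * s)" if "0 \<le> s" for s using le[OF that] by linarith
  have "\<exists>L. (G \<longlongrightarrow> L) at_top"
  proof (rule bounded_mono_tendsto_at_top)
    show "G s \<le> G t" if "0 \<le> s" "s \<le> t" for s t
      unfolding G_def using that nn by (intro integral_subset_le integrable_add int) auto
    fix t :: real assume t: "0 \<le> t"
    have "G t \<le> integral {0..t} (\<lambda>s. (2 * C) * exp (- d * s))"
      unfolding G_def
    proof (rule integral_le)
      show "(\<lambda>s. 2 * C * exp (- d * s)) integrable_on {0..t}"
        by (auto intro!: integrable_continuous_interval continuous_intros)
      show "q s + C * exp (- d * s) \<le> 2 * C * exp (- d * s)" if "s \<in> {0..t}" for s
        using le[of s] that by simp
    qed (intro integrable_add int)
    also have "\<dots> \<le> 2 * C / d" by (rule integral_exp_mult_le) (use d t C in auto)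
    finally show "G t \<le> 2 * C / d" .
  qed
  then obtain L where L: "(G \<longlongrightarrow> L) at_top" by blast
  have "((\<lambda>t. C / (- d) * exp (- d * t) - C / (- d)) \<longlongrightarrow> 0 - C / (- d)) at_top"
    by (intro tendsto_diff exp_neg_tendsto_0 tendsto_const d)
  then have "((\<lambda>t. G t - (C / (- d) * exp (- d * t) - C / (- d))) \<longlongrightarrow> L - (0 - C / (- d))) at_top"
    by (rule tendsto_diff[OF L])
  then have "((\<lambda>t. integral {0..t} q) \<longlongrightarrow> L - (0 - C / (- d))) at_top"
  proof (rule Lim_transform_eventually)
    show "\<forall>\<^sub>F t in at_top. G t - (C / (- d) * exp (- d * t) - C / (- d)) = integral {0..t} q"
      using eventually_ge_at_top[of "0::real"]
    proof eventually_elim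
      case (elim t)
      have "G t = integral {0..t} q + integral {0..t} (\<lambda>s. C * exp (- d * s))"
        unfolding G_def by (rule integral_add) (rule int)+
      also have "integral {0..t} (\<lambda>s. C * exp (- d * s)) = C / (- d) * exp (- d * t) - C / (- d)"
        by (rule integral_exp_mult) (use d elim in auto)
      finally show ?case by simp
    qed
  qed
  then show ?thesis by blast
qed

section \<open>Truncated Laplace transforms and existence of the resolvent\<close>

context pos_semigroup
begin

text \<open>Truncation at \<open>t\<close> is essential: for \<open>lam\<close> below the growth
  bound, convergence as \<open>t\<close> tends to infinity is not evident and is settled only in
  \<open>resolvent_laplace\<close>.\<close>

definition laplace :: "real \<Rightarrow> ('a \<Rightarrow> real) \<Rightarrow> ('a \<Rightarrow> real) \<Rightarrow> real \<Rightarrow> real" where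
  "laplace lam u y t = integral {0..t} (\<lambda>s. exp (- lam * s) * inner2 m (orb u s) y)"

lemma laplace_integrand_cont:
  assumes "u \<in> L2 m" "y \<in> L2 m"
  shows "continuous_on S (\<lambda>s. exp (- lam * s) * inner2 m (orb u s) y)"
proof (rule continuous_on_mult)
  show "continuous_on S (\<lambda>s. inner2 m (orb u s) y)"
    by (rule continuous_on_subset[OF orb_weak_cont[OF assms]]) simp
  show "continuous_on S (\<lambda>s. exp (- lam * s))" by (intro continuous_intros)
qed

lemma laplace_integrand_int:
  "u \<in> L2 m \<Longrightarrow> y \<in> L2 m \<Longrightarrow> (\<lambda>s. exp (- lam * s) * inner2 m (orb u s) y) integrable_on {a..b}"
  by (rule integrable_continuous_interval) (rule laplace_integrand_cont)

lemma laplace_cong: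
  "u \<in> L2 m \<Longrightarrow> v \<in> L2 m \<Longrightarrow> y \<in> L2 m \<Longrightarrow> AE x in m. u x = v x \<Longrightarrow> laplace lam u y t = laplace lam v y t"
  unfolding laplace_def using inner2_orb_cong[of u v y] by simp

lemma laplace_lin_right:
  assumes "u \<in> L2 m" "y \<in> L2 m" "z \<in> L2 m"
  shows "laplace lam u (\<lambda>x. a * y x + b * z x) t = a * laplace lam u y t + b * laplace lam u z t"
proof -
  have "laplace lam u (\<lambda>x. a * y x + b * z x) t =
     integral {0..t} (\<lambda>s. a * (exp (- lam * s) * inner2 m (orb u s) y) + b * (exp (- lam * s) * inner2 m (orb u s) z))"
    unfolding laplace_def using assms
    by (intro integral_cong) (auto simp: inner2_lin_right algebra_simps)
  also have "\<dots> = a * laplace lam u y t + b * laplace lam u z t"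
    unfolding laplace_def using laplace_integrand_int[OF assms(1,2)] laplace_integrand_int[OF assms(1,3)]
    by (subst integral_add) (auto intro: integrable_on_mult_right)
  finally show ?thesis .
qed

lemma laplace_nonneg:
  assumes "u \<in> L2 m" "y \<in> L2 m" "nonneg_ae m u" "nonneg_ae m y"
  shows "0 \<le> laplace lam u y t"
  unfolding laplace_def
  by (rule integral_nonneg) (use assms laplace_integrand_int in \<open>auto intro!: mult_nonneg_nonneg inner2_nonneg orb_pos\<close>)

lemma laplace_mono:
  assumes "u \<in> L2 m" "y \<in> L2 m" "nonneg_ae m u" "nonneg_ae m y" "s \<le> t"
  shows "laplace lam u y s \<le> laplace lam u y t"
  unfolding laplace_def
  by (rule integral_subset_le) (use assms laplace_integrand_int in \<open>auto intro!: mult_nonneg_nonneg inner2_nonneg orb_pos\<close>)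

lemma laplace_le:
  assumes u: "u \<in> L2 m" and y: "y \<in> L2 m" and c: "c < lam" and t: "0 \<le> t" and C: "0 \<le> C"
    and le: "\<And>s. 0 \<le> s \<Longrightarrow> inner2 m (T s u) y \<le> C * exp (c * s)"
  shows "laplace lam u y t \<le> C / (lam - c)"
proof -
  have "laplace lam u y t \<le> integral {0..t} (\<lambda>s. C * exp (- (lam - c) * s))"
    unfolding laplace_def
  proof (rule integral_le[OF laplace_integrand_int[OF u y]])
    show "(\<lambda>s. C * exp (- (lam - c) * s)) integrable_on {0..t}"
      by (auto intro!: integrable_continuous_interval continuous_intros)
    fix s assume s: "s \<in> {0..t}"
    have "exp (- lam * s) * inner2 m (orb u s) y \<le> exp (- lam * s) * (C * exp (c * s))"
      using le[of s] s by (intro mult_left_mono) (auto simp: orb_eq)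
    also have "\<dots> = C * exp (- (lam - c) * s)"
      by (simp add: exp_add[symmetric] algebra_simps)
    finally show "exp (- lam * s) * inner2 m (orb u s) y \<le> C * exp (- (lam - c) * s)" .
  qed
  also have "\<dots> \<le> C / (lam - c)" by (rule integral_exp_mult_le) (use assms in auto)
  finally show ?thesis .
qed

text \<open>The derivative of \<open>- exp (- lam * s) * inner2 m (orb w s) y\<close> is integrated
  over \<open>[0, t]\<close>, for any real \<open>lam\<close>. The term at \<open>t\<close> is all
  that separates \<open>w\<close> from the Laplace transform of \<open>lam * w - g\<close>; later
  arguments consist in making it vanish.\<close>

lemma laplace_generator:
  assumes wg: "(w, g) \<in> A" and y: "y \<in> L2 m" and t: "0 \<le> t"
  shows "inner2 m w y = exp (- lam * t) * inner2 m (T t w) y + laplace lam (\<lambda>x. lam * w x - g x) y t"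
proof -
  note w = generatorD(1)[OF wg] and g = generatorD(2)[OF wg]
  let ?G = "\<lambda>s. - exp (- lam * s) * inner2 m (orb w s) y"
  have "((\<lambda>s. exp (- lam * s) * inner2 m (orb (\<lambda>x. lam * w x - g x) s) y) has_integral ?G t - ?G 0) {0..t}"
  proof (rule fundamental_theorem_of_calculus[OF t])
    fix s assume s: "s \<in> {0..t}"
    have *: "((\<lambda>s. inner2 m (orb w s) y) has_real_derivative inner2 m (orb g s) y) (at s within {0..t})"
      by (rule has_field_derivative_subset[OF orb_generator_deriv[OF wg y]]) (use s in auto)
    have "(?G has_real_derivative exp (- lam * s) * inner2 m (orb (\<lambda>x. lam * w x - g x) s) y) (at s within {0..t})"
      by (auto intro!: derivative_eq_intros * simp: inner2_orb_diff inner2_orb_scale w g y algebra_simps)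
    then show "(?G has_vector_derivative exp (- lam * s) * inner2 m (orb (\<lambda>x. lam * w x - g x) s) y) (at s within {0..t})"
      by (simp add: has_real_derivative_iff_has_vector_derivative)
  qed
  then have "laplace lam (\<lambda>x. lam * w x - g x) y t = ?G t - ?G 0"
    unfolding laplace_def by (rule integral_unique)
  then show ?thesis using t w y by (simp add: orb_eq inner2_T_zero)
qed

lemma generator_resolvent_bound:
  assumes K: "1 \<le> K" "0 \<le> w" "\<And>t u. 0 \<le> t \<Longrightarrow> u \<in> L2 m \<Longrightarrow> norm2 m (T t u) \<le> K * exp (w * t) * norm2 m u"
    and lam: "w < lam" and zg: "(z, g) \<in> A" and y: "y \<in> L2 m"
  shows "((\<lambda>t. laplace lam (\<lambda>x. lam * z x - g x) y t) \<longlongrightarrow> inner2 m z y) at_top"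
    and "norm2 m z \<le> K / (lam - w) * norm2 m (\<lambda>x. lam * z x - g x)"
proof -
  note z = generatorD(1)[OF zg] and g = generatorD(2)[OF zg]
  let ?f = "\<lambda>x. lam * z x - g x"
  have f: "?f \<in> L2 m" using z g by auto
  have conv: "((\<lambda>t. laplace lam ?f y t) \<longlongrightarrow> inner2 m z y) at_top" if y: "y \<in> L2 m" for y
  proof -
    have "((\<lambda>t. exp (- lam * t) * inner2 m (T t z) y) \<longlongrightarrow> 0) at_top"
    proof (rule Lim_null_comparison)
      show "((\<lambda>t. (K * norm2 m z * norm2 m y) * exp (- (lam - w) * t)) \<longlongrightarrow> 0) at_top"
        by (rule exp_neg_tendsto_0) (use lam in simp)
      show "\<forall>\<^sub>F t in at_top. norm (exp (- lam * t) * inner2 m (T t z) y) \<le> (K * norm2 m z * norm2 m y) * exp (- (lam - w) * t)"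
        using eventually_ge_at_top[of "0::real"]
      proof eventually_elim
        case (elim t)
        have "\<bar>inner2 m (T t z) y\<bar> \<le> K * exp (w * t) * norm2 m z * norm2 m y"
          by (rule cauchy_schwarz_L2_le) (use elim z y K in auto)
        then have "exp (- lam * t) * \<bar>inner2 m (T t z) y\<bar> \<le> exp (- lam * t) * (K * exp (w * t) * norm2 m z * norm2 m y)"
          by (intro mult_left_mono) auto
        also have "\<dots> = (K * norm2 m z * norm2 m y) * exp (- (lam - w) * t)"
          by (simp add: exp_add[symmetric] algebra_simps)
        finally show ?case by (simp add: abs_mult)
      qed
    qed
    then have "((\<lambda>t. inner2 m z y - exp (- lam * t) * inner2 m (T t z) y) \<longlongrightarrow> inner2 m z y - 0) at_top"
      by (intro tendsto_diff tendsto_const)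
    moreover have "\<forall>\<^sub>F t in at_top. inner2 m z y - exp (- lam * t) * inner2 m (T t z) y = laplace lam ?f y t"
      using eventually_ge_at_top[of "0::real"]
    proof eventually_elim
      case (elim t)
      show ?case using laplace_generator[OF zg y elim, of lam] by simp
    qed
    ultimately have "((\<lambda>t. laplace lam ?f y t) \<longlongrightarrow> inner2 m z y - 0) at_top"
      by (rule Lim_transform_eventually)
    then show ?thesis by simp
  qed
  show "((\<lambda>t. laplace lam ?f y t) \<longlongrightarrow> inner2 m z y) at_top" by (rule conv[OF y])
  show "norm2 m z \<le> K / (lam - w) * norm2 m ?f"
  proof (rule norm2_le_by_duality[OF z])
    fix y assume y: "y \<in> L2 m"
    have "laplace lam ?f y t \<le> K * norm2 m ?f * norm2 m y / (lam - w)" if t: "0 \<le> t" for t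
    proof (rule laplace_le[OF f y lam t])
      fix s :: real assume s: "0 \<le> s"
      have "\<bar>inner2 m (T s ?f) y\<bar> \<le> K * exp (w * s) * norm2 m ?f * norm2 m y"
        by (rule cauchy_schwarz_L2_le) (use s f y K in auto)
      then show "inner2 m (T s ?f) y \<le> K * norm2 m ?f * norm2 m y * exp (w * s)" by (simp add: mult_ac)
    qed (use K in auto)
    then have "inner2 m z y \<le> K * norm2 m ?f * norm2 m y / (lam - w)"
      by (intro tendsto_upperbound[OF conv[OF y]])
        (auto intro: eventually_mono[OF eventually_ge_at_top[of "0::real"]])
    then show "inner2 m z y \<le> K / (lam - w) * norm2 m ?f * norm2 m y" by simp
  qed (use K lam in auto)
qed

lemma generator_resolvent_surj:
  assumes K: "1 \<le> K" "0 \<le> w" "\<And>t u. 0 \<le> t \<Longrightarrow> u \<in> L2 m \<Longrightarrow> norm2 m (T t u) \<le> K * exp (w * t) * norm2 m u"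
    and lam: "w < lam" and f: "f \<in> L2 m"
  shows "\<exists>z. (z, (\<lambda>x. lam * z x - f x)) \<in> A"
proof -
  have upper: "\<bar>exp (- lam * s) * inner2 m (orb f s) y\<bar> \<le> (K * norm2 m f * norm2 m y) * exp (- (lam - w) * s)"
    if "0 \<le> s" "y \<in> L2 m" for s y
  proof -
    have "\<bar>inner2 m (orb f s) y\<bar> \<le> K * exp (w * s) * norm2 m f * norm2 m y"
      by (rule cauchy_schwarz_L2_le) (use that f K in \<open>auto simp: orb_eq\<close>)
    then have "exp (- lam * s) * \<bar>inner2 m (orb f s) y\<bar> \<le> exp (- lam * s) * (K * exp (w * s) * norm2 m f * norm2 m y)"
      by (intro mult_left_mono) auto
    also have "\<dots> = (K * norm2 m f * norm2 m y) * exp (- (lam - w) * s)"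
      by (simp add: exp_add[symmetric] algebra_simps)
    finally show ?thesis by (simp add: abs_mult)
  qed
  have "\<exists>L. ((\<lambda>t. laplace lam f y t) \<longlongrightarrow> L) at_top" if y: "y \<in> L2 m" for y
    unfolding laplace_def
    by (rule exp_bounded_integral_tendsto[OF laplace_integrand_cont[OF f y], of "lam - w"])
      (use upper[OF _ y] lam in auto)
  then obtain J where J: "\<And>y. y \<in> L2 m \<Longrightarrow> ((\<lambda>t. laplace lam f y t) \<longlongrightarrow> J y) at_top" by metis
  have "\<exists>z\<in>L2 m. \<forall>y\<in>L2 m. inner2 m z y = J y"
  proof (rule riesz_L2)
    fix u v a b assume uv: "u \<in> L2 m" "v \<in> L2 m"
    have "((\<lambda>t. a * laplace lam f u t + b * laplace lam f v t) \<longlongrightarrow> a * J u + b * J v) at_top"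
      by (intro tendsto_intros J uv)
    then have "((\<lambda>t. laplace lam f (\<lambda>x. a * u x + b * v x) t) \<longlongrightarrow> a * J u + b * J v) at_top"
      by (simp add: laplace_lin_right f uv)
    then show "J (\<lambda>x. a * u x + b * v x) = a * J u + b * J v"
      using J[OF L2_lin[OF uv, of a b]] tendsto_unique[OF trivial_limit_at_top_linorder] by blast
  next
    fix y assume y: "y \<in> L2 m"
    have "\<bar>laplace lam f y t\<bar> \<le> K * norm2 m f / (lam - w) * norm2 m y" if t: "0 \<le> t" for t
    proof -
      have "norm (laplace lam f y t) \<le> integral {0..t} (\<lambda>s. (K * norm2 m f * norm2 m y) * exp (- (lam - w) * s))"
        unfolding laplace_def
        by (rule integral_norm_bound_integral[OF laplace_integrand_int[OF f y]])
          (use upper[OF _ y] in \<open>auto intro!: integrable_continuous_interval continuous_intros\<close>)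
      also have "\<dots> \<le> K * norm2 m f * norm2 m y / (lam - w)"
        by (rule integral_exp_mult_le) (use K lam t in auto)
      finally show ?thesis by (simp add: mult_ac)
    qed
    then show "\<bar>J y\<bar> \<le> K * norm2 m f / (lam - w) * norm2 m y"
      by (intro tendsto_upperbound[OF tendsto_rabs[OF J[OF y]]])
        (auto intro: eventually_mono[OF eventually_ge_at_top[of "0::real"]])
  qed
  then obtain z where z: "z \<in> L2 m" and zJ: "\<And>y. y \<in> L2 m \<Longrightarrow> inner2 m z y = J y" by blast
  have "(z, (\<lambda>x. lam * z x - f x)) \<in> A"
  proof (rule generator_by_integral[OF z])
    fix h y assume h: "(0::real) < h" and y: "y \<in> L2 m"
    define p where "p s = inner2 m (orb f s) y" for s
    obtain H where H: "\<And>s. (H has_real_derivative exp (- lam * s) * p s) (at s)"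
      "\<And>a b. a \<le> b \<Longrightarrow> integral {a..b} (\<lambda>s. exp (- lam * s) * p s) = H b - H a"
      by (rule continuous_antiderivative[OF laplace_integrand_cont[OF f y, of UNIV lam, folded p_def]]) blast
    \<comment> \<open>\<open>J y + H 0 - H s\<close> is the tail of the Laplace integral beyond time
      \<open>s\<close>. Shifting the integration variable shows that \<open>Q s\<close> is
      \<open>T s z\<close> paired with \<open>y\<close>, and \<open>Q\<close> solves
      \<open>Q' = lam * Q - p\<close>, which is the differential form of what
      \<open>generator_by_integral\<close> demands.\<close>
    define Q where "Q s = exp (lam * s) * (J y + H 0 - H s)" for s
    have TQ: "inner2 m (orb z s) y = Q s" if s: "0 \<le> s" for s
    proof -
      have adj: "adj m (T s) y \<in> L2 m" by (rule adj_T_L2[OF s y])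
      have "((\<lambda>t. laplace lam f y t) \<longlongrightarrow> J y) at_top" by (rule J[OF y])
      moreover have "filterlim (\<lambda>t::real. t + s) at_top at_top"
        by (rule filterlim_add_const_at_top)
      ultimately have "((\<lambda>t. laplace lam f y (t + s)) \<longlongrightarrow> J y) at_top"
        by (rule filterlim_compose)
      then have "((\<lambda>t. exp (lam * s) * (laplace lam f y (t + s) + H 0 - H s)) \<longlongrightarrow> Q s) at_top"
        unfolding Q_def by (intro tendsto_intros)
      then have "((\<lambda>t. laplace lam f (adj m (T s) y) t) \<longlongrightarrow> Q s) at_top"
      proof (rule Lim_transform_eventually)
        show "\<forall>\<^sub>F t in at_top. exp (lam * s) * (laplace lam f y (t + s) + H 0 - H s) = laplace lam f (adj m (T s) y) t"
          using eventually_ge_at_top[of "0::real"]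
        proof eventually_elim
          case (elim t)
          have "laplace lam f (adj m (T s) y) t = integral {0..t} (\<lambda>r. exp (lam * s) * (exp (- lam * (r + s)) * p (r + s)))"
            unfolding laplace_def
          proof (rule integral_cong)
            fix r assume r: "r \<in> {0..t}"
            have "inner2 m (orb f r) (adj m (T s) y) = p (r + s)"
              using r s f y by (simp add: inner2_adj_T inner2_orb_add p_def)
            then show "exp (- lam * r) * inner2 m (orb f r) (adj m (T s) y) = exp (lam * s) * (exp (- lam * (r + s)) * p (r + s))"
              by (simp add: algebra_simps flip: exp_add)
          qed
          also have "\<dots> = exp (lam * s) * integral {0..t} (\<lambda>r. exp (- lam * (r + s)) * p (r + s))" by simp
          also have "integral {0..t} (\<lambda>r. exp (- lam * (r + s)) * p (r + s)) = H (t + s) - H (0 + s)"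
            by (rule integral_of_deriv_shift[OF H(1) elim])
          also have "laplace lam f y (t + s) = H (t + s) - H 0"
            unfolding laplace_def p_def[symmetric] using elim s by (intro H(2)) auto
          then have "H (t + s) - H (0 + s) = laplace lam f y (t + s) + H 0 - H s" by simp
          finally show ?case by simp
        qed
      qed
      then have "inner2 m z (adj m (T s) y) = Q s"
        using J[OF adj] zJ[OF adj] tendsto_unique[of at_top] by force
      then show ?thesis using s y z by (simp add: inner2_adj_T orb_eq)
    qed
    have dQ: "(Q has_real_derivative lam * Q s - p s) (at s)" for s
      unfolding Q_def
      by (auto intro!: derivative_eq_intros H(1) simp: algebra_simps simp flip: exp_add)
    have "integral {0..h} (\<lambda>s. inner2 m (orb (\<lambda>x. lam * z x - f x) s) y) = integral {0..h} (\<lambda>s. lam * Q (s + 0) - p (s + 0))"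
      by (rule integral_cong) (use z f y in \<open>auto simp: inner2_orb_diff inner2_orb_scale p_def TQ\<close>)
    also have "\<dots> = Q (h + 0) - Q (0 + 0)"
      by (rule integral_of_deriv_shift[where c = 0 and p = "\<lambda>s. lam * Q s - p s"]) (use dQ h in auto)
    also have "\<dots> = inner2 m (T h z) y - inner2 m z y"
      using TQ[of h] TQ[of 0] h z y by (simp add: orb_eq inner2_T_zero)
    finally show "inner2 m (T h z) y - inner2 m z y = integral {0..h} (\<lambda>s. inner2 m (orb (\<lambda>x. lam * z x - f x) s) y)"
      by simp
  qed (use z f in auto)
  then show ?thesis by blast
qed

section \<open>Algebra of the resolvent\<close>

abbreviation R where "R lam \<equiv> op_apply (resolvent m A lam)"
abbreviation \<rho> where "\<rho> \<equiv> resolvent_set m A"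

lemma large_in_resolvent_set:
  assumes K: "1 \<le> K" "0 \<le> w" "\<And>t u. 0 \<le> t \<Longrightarrow> u \<in> L2 m \<Longrightarrow> norm2 m (T t u) \<le> K * exp (w * t) * norm2 m u"
    and lam: "w < lam"
  shows "lam \<in> \<rho>"
proof -
  have "norm2 m z \<le> K / (lam - w) * norm2 m f" if fz: "(f, z) \<in> resolvent m A lam" for f z
  proof -
    obtain g where g: "(z, g) \<in> A" "AE x in m. lam * z x - g x = f x" and f: "f \<in> L2 m"
      using fz by (auto simp: resolvent_def)
    have "norm2 m (\<lambda>x. lam * z x - g x) = norm2 m f"
      by (rule norm2_cong_AE) (use generatorD[OF g(1)] f g in auto)
    with generator_resolvent_bound(2)[OF K lam g(1) L2_zero] show ?thesis by simp
  qed
  moreover have "f \<in> Domain (resolvent m A lam)" if f: "f \<in> L2 m" for f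
  proof -
    obtain z where "(z, (\<lambda>x. lam * z x - f x)) \<in> A"
      using generator_resolvent_surj[OF K lam f] by blast
    then have "(f, z) \<in> resolvent m A lam" using f by (auto simp: resolvent_def)
    then show ?thesis by blast
  qed
  moreover have "Domain (resolvent m A lam) \<subseteq> L2 m" by (auto simp: resolvent_def)
  ultimately show ?thesis unfolding resolvent_set_def by blast
qed

lemma R_mem:
  assumes "lam \<in> \<rho>" "u \<in> L2 m"
  obtains g where "(R lam u, g) \<in> A" "AE x in m. lam * R lam u x - g x = u x"
proof -
  have "u \<in> Domain (resolvent m A lam)" using assms by (auto simp: resolvent_set_def)
  then have "(u, R lam u) \<in> resolvent m A lam" by (rule op_apply_mem)
  then show ?thesis using that by (auto simp: resolvent_def)
qed

lemma R_L2 [simp, intro]: "lam \<in> \<rho> \<Longrightarrow> u \<in> L2 m \<Longrightarrow> R lam u \<in> L2 m"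
  using R_mem generatorD(1) by blast

lemma R_bound:
  assumes "lam \<in> \<rho>"
  obtains C where "0 \<le> C" "\<And>u z g. (z, g) \<in> A \<Longrightarrow> u \<in> L2 m \<Longrightarrow> AE x in m. lam * z x - g x = u x \<Longrightarrow> norm2 m z \<le> C * norm2 m u"
proof -
  obtain C where C: "\<And>f w. (f, w) \<in> resolvent m A lam \<Longrightarrow> norm2 m w \<le> C * norm2 m f"
    using assms unfolding resolvent_set_def by blast
  show ?thesis
  proof (rule that[of "max 0 C"])
    fix u z g assume "(z, g) \<in> A" "u \<in> L2 m" "AE x in m. lam * z x - g x = u x"
    then have "norm2 m z \<le> C * norm2 m u" by (intro C) (auto simp: resolvent_def)
    also have "\<dots> \<le> max 0 C * norm2 m u" by (intro mult_right_mono) auto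
    finally show "norm2 m z \<le> max 0 C * norm2 m u" .
  qed simp
qed

lemma R_norm_bound:
  assumes "lam \<in> \<rho>"
  obtains C where "0 \<le> C" "\<And>u. u \<in> L2 m \<Longrightarrow> norm2 m (R lam u) \<le> C * norm2 m u"
proof -
  obtain C where C: "0 \<le> C" "\<And>u z g. (z, g) \<in> A \<Longrightarrow> u \<in> L2 m \<Longrightarrow> AE x in m. lam * z x - g x = u x \<Longrightarrow> norm2 m z \<le> C * norm2 m u"
    using R_bound[OF assms] by metis
  show ?thesis by (rule that[OF C(1)]) (metis C(2) R_mem assms)
qed

text \<open>The difference of two solutions is a solution with right-hand side 0, which the bound in
  \<open>resolvent_set\<close> forces to have norm 0. Since \<open>R\<close> is a choice, this is
  the means of identifying its values.\<close>

lemma R_unique: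
  assumes lam: "lam \<in> \<rho>" and u: "u \<in> L2 m" and zg: "(z, g) \<in> A" "AE x in m. lam * z x - g x = u x"
  shows "AE x in m. R lam u x = z x"
proof -
  obtain C where C: "\<And>u z g. (z, g) \<in> A \<Longrightarrow> u \<in> L2 m \<Longrightarrow> AE x in m. lam * z x - g x = u x \<Longrightarrow> norm2 m z \<le> C * norm2 m u"
    using R_bound[OF lam] by metis
  obtain k where k: "(R lam u, k) \<in> A" "AE x in m. lam * R lam u x - k x = u x" using R_mem[OF lam u] by metis
  have "(\<lambda>x. 1 * R lam u x + (-1) * z x, \<lambda>x. 1 * k x + (-1) * g x) \<in> A"
    by (rule generator_lin[OF k(1) zg(1)])
  moreover have "AE x in m. lam * (1 * R lam u x + (-1) * z x) - (1 * k x + (-1) * g x) = 0"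
    using k(2) zg(2) by eventually_elim (simp add: algebra_simps)
  ultimately have "norm2 m (\<lambda>x. 1 * R lam u x + (-1) * z x) \<le> C * norm2 m (\<lambda>x. 0)"
    by (intro C[of _ _ "\<lambda>x. 0"]) auto
  then have "norm2 m (\<lambda>x. R lam u x - z x) = 0" by (simp add: order_antisym)
  then show ?thesis
    using norm2_eq_0_iff[of "\<lambda>x. R lam u x - z x" m] lam u generatorD(1)[OF zg(1)] by auto
qed

lemma R_generator:
  assumes "lam \<in> \<rho>" "(z, g) \<in> A"
  shows "AE x in m. R lam (\<lambda>x. lam * z x - g x) x = z x"
  by (rule R_unique) (use assms generatorD in auto)

lemma R_lin:
  assumes lam: "lam \<in> \<rho>" and u: "u \<in> L2 m" and v: "v \<in> L2 m"
  shows "AE x in m. R lam (\<lambda>x. a * u x + b * v x) x = a * R lam u x + b * R lam v x"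
proof -
  obtain g where g: "(R lam u, g) \<in> A" "AE x in m. lam * R lam u x - g x = u x" using R_mem[OF lam u] by metis
  obtain k where k: "(R lam v, k) \<in> A" "AE x in m. lam * R lam v x - k x = v x" using R_mem[OF lam v] by metis
  show ?thesis
  proof (rule R_unique[OF lam _ generator_lin[OF g(1) k(1)]])
    show "AE x in m. lam * (a * R lam u x + b * R lam v x) - (a * g x + b * k x) = a * u x + b * v x"
      using g(2) k(2)
    proof eventually_elim
      case (elim x)
      then show ?case by (simp flip: elim add: algebra_simps)
    qed
  qed (use u v in auto)
qed

text \<open>With \<open>w = R \<mu> u\<close>, the equation \<open>\<mu> * w - A w = u\<close> is
  the same as \<open>lam * w - A w = u + (lam - \<mu>) * w\<close>.\<close>

lemma resolvent_identity:
  assumes lam: "lam \<in> \<rho>" and mu: "\<mu> \<in> \<rho>" and u: "u \<in> L2 m"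
  shows "AE x in m. R \<mu> u x = R lam (\<lambda>x. 1 * u x + (lam - \<mu>) * R \<mu> u x) x"
proof -
  obtain g where g: "(R \<mu> u, g) \<in> A" "AE x in m. \<mu> * R \<mu> u x - g x = u x" using R_mem[OF mu u] by metis
  have "AE x in m. R lam (\<lambda>x. 1 * u x + (lam - \<mu>) * R \<mu> u x) x = R \<mu> u x"
    by (rule R_unique[OF lam _ g(1)])
      (use u mu g(2) in \<open>auto simp: algebra_simps elim!: eventually_mono intro!: L2_lin[of u m "R \<mu> u" 1, simplified]\<close>)
  then show ?thesis by eventually_elim simp
qed

lemma R_laplace_large:
  assumes K: "1 \<le> K" "0 \<le> w" "\<And>t u. 0 \<le> t \<Longrightarrow> u \<in> L2 m \<Longrightarrow> norm2 m (T t u) \<le> K * exp (w * t) * norm2 m u"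
    and lam: "w < lam" and u: "u \<in> L2 m" and y: "y \<in> L2 m"
  shows "((\<lambda>t. laplace lam u y t) \<longlongrightarrow> inner2 m (R lam u) y) at_top"
    and "norm2 m (R lam u) \<le> K / (lam - w) * norm2 m u"
proof -
  obtain g where g: "(R lam u, g) \<in> A" "AE x in m. lam * R lam u x - g x = u x"
    using R_mem[OF large_in_resolvent_set[OF K lam] u] by metis
  have f: "(\<lambda>x. lam * R lam u x - g x) \<in> L2 m" using generatorD[OF g(1)] by auto
  show "((\<lambda>t. laplace lam u y t) \<longlongrightarrow> inner2 m (R lam u) y) at_top"
    using generator_resolvent_bound(1)[OF K lam g(1) y] laplace_cong[OF f u y g(2)] by simp
  show "norm2 m (R lam u) \<le> K / (lam - w) * norm2 m u"
    using generator_resolvent_bound(2)[OF K lam g(1) y] norm2_cong_AE[OF f u g(2)] by simp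
qed

section \<open>Positivity of the resolvent and its Laplace representation\<close>

definition pos_resolvent :: "real \<Rightarrow> bool" where
  "pos_resolvent lam \<longleftrightarrow> (\<forall>u\<in>L2 m. nonneg_ae m u \<longrightarrow> nonneg_ae m (R lam u))"

lemma pos_resolvent_large:
  assumes K: "1 \<le> K" "0 \<le> w" "\<And>t u. 0 \<le> t \<Longrightarrow> u \<in> L2 m \<Longrightarrow> norm2 m (T t u) \<le> K * exp (w * t) * norm2 m u"
    and lam: "w < lam"
  shows "pos_resolvent lam"
  unfolding pos_resolvent_def
proof (intro ballI impI nonneg_ae_by_duality)
  fix u y assume u: "u \<in> L2 m" "nonneg_ae m u" and y: "y \<in> L2 m" "nonneg_ae m y"
  show "0 \<le> inner2 m (R lam u) y"
    by (rule tendsto_lowerbound[OF R_laplace_large(1)[OF K lam u(1) y(1)]])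
      (use laplace_nonneg u y in auto)
qed (use large_in_resolvent_set[OF K lam] in auto)

(* If w = R \<nu> u and \<nu> \<le> \<mu>, then w = R \<mu> u + (\<mu> - \<nu>) R \<mu> w, so the negative part of w is at most
   (\<mu> - \<nu>) R \<mu> of itself. *)
lemma pos_resolvent_step:
  assumes lam: "lam \<in> \<rho>"
  obtains \<delta> where "0 < \<delta>" "\<And>\<mu> \<nu>. \<mu> \<in> \<rho> \<Longrightarrow> \<nu> \<in> \<rho> \<Longrightarrow> \<bar>\<mu> - lam\<bar> < \<delta> \<Longrightarrow> \<bar>\<nu> - lam\<bar> < \<delta> \<Longrightarrow>
    \<nu> \<le> \<mu> \<Longrightarrow> pos_resolvent \<mu> \<Longrightarrow> pos_resolvent \<nu>"
proof -
  obtain K where K: "0 \<le> K" "\<And>u. u \<in> L2 m \<Longrightarrow> norm2 m (R lam u) \<le> K * norm2 m u"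
    using R_norm_bound[OF lam] by metis
  \<comment> \<open>Within distance \<open>\<delta>\<close> of \<open>lam\<close> the resolvent has
    norm at most \<open>2 * K\<close>, because the resolvent identity lets half of it be absorbed,
    and \<open>\<mu> - \<nu> < 2 * \<delta>\<close>. The negative part is thus estimated by itself
    with the factor \<open>4 * (K * \<delta>)\<close>, which this choice makes less than 1, also for
    \<open>K = 0\<close>.\<close>
  define \<delta> where "\<delta> = 1 / (4 * (K + 1))"
  have \<delta>: "0 < \<delta>" using K by (simp add: \<delta>_def)
  have K\<delta>: "4 * (K * \<delta>) < 1" using K by (simp add: \<delta>_def field_simps)
  have bound: "norm2 m (R \<mu> u) \<le> 2 * K * norm2 m u"
    if mu: "\<mu> \<in> \<rho>" "\<bar>\<mu> - lam\<bar> < \<delta>" and u: "u \<in> L2 m" for \<mu> u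
  proof -
    have "norm2 m (R \<mu> u) = norm2 m (R lam (\<lambda>x. 1 * u x + (lam - \<mu>) * R \<mu> u x))"
      using resolvent_identity[OF lam mu(1) u] mu lam u by (intro norm2_cong_AE R_L2 L2_lin)
    also have "\<dots> \<le> K * norm2 m (\<lambda>x. 1 * u x + (lam - \<mu>) * R \<mu> u x)"
      by (intro K L2_lin R_L2 u mu)
    also have "\<dots> \<le> K * (norm2 m u + \<bar>lam - \<mu>\<bar> * norm2 m (R \<mu> u))"
      using norm2_triangle[OF u L2_scale[OF R_L2[OF mu(1) u], of "lam - \<mu>"]] K(1)
      by (intro mult_left_mono) (auto simp: norm2_scale)
    also have "\<dots> = K * norm2 m u + (K * \<bar>lam - \<mu>\<bar>) * norm2 m (R \<mu> u)" by (simp add: algebra_simps)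
    also have "(K * \<bar>lam - \<mu>\<bar>) * norm2 m (R \<mu> u) \<le> (1/2) * norm2 m (R \<mu> u)"
    proof (rule mult_right_mono)
      have "K * \<bar>lam - \<mu>\<bar> \<le> K * \<delta>" using mu K by (intro mult_left_mono) auto
      then show "K * \<bar>lam - \<mu>\<bar> \<le> 1/2" using K\<delta> by linarith
    qed simp
    finally show ?thesis by simp
  qed
  show ?thesis
  proof (rule that[OF \<delta>])
    fix \<mu> \<nu> assume mu: "\<mu> \<in> \<rho>" "\<bar>\<mu> - lam\<bar> < \<delta>" and nu: "\<nu> \<in> \<rho>" "\<bar>\<nu> - lam\<bar> < \<delta>"
      and le: "\<nu> \<le> \<mu>" and pos: "pos_resolvent \<mu>"
    show "pos_resolvent \<nu>" unfolding pos_resolvent_def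
    proof (intro ballI impI)
      fix u assume u: "u \<in> L2 m" "nonneg_ae m u"
      define c where "c = \<mu> - \<nu>"
      have c: "0 \<le> c" "c < 2 * \<delta>" using le mu nu by (auto simp: c_def abs_if split: if_splits)
      define w where "w = R \<nu> u"
      have w: "w \<in> L2 m" using nu u by (auto simp: w_def)
      define p where "p = (\<lambda>x. max 0 (w x))"
      define n where "n = (\<lambda>x. max 0 (- w x))"
      have p: "p \<in> L2 m" "nonneg_ae m p" and n: "n \<in> L2 m" "nonneg_ae m n"
        using w by (auto simp: p_def n_def nonneg_ae_def)
      have w_eq: "w = (\<lambda>x. 1 * p x + (-1) * n x)" by (auto simp: p_def n_def)
      have "AE x in m. w x = R \<mu> (\<lambda>x. 1 * u x + c * w x) x"
        using resolvent_identity[OF mu(1) nu(1) u(1)] by (simp add: w_def c_def)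
      moreover have "AE x in m. R \<mu> (\<lambda>x. 1 * u x + c * w x) x = 1 * R \<mu> u x + c * R \<mu> w x"
        by (rule R_lin[OF mu(1) u(1) w])
      moreover have "AE x in m. R \<mu> w x = 1 * R \<mu> p x + (-1) * R \<mu> n x"
        using R_lin[OF mu(1) p(1) n(1), of 1 "-1"] w_eq by simp
      moreover have "AE x in m. 0 \<le> R \<mu> u x" "AE x in m. 0 \<le> R \<mu> p x" "AE x in m. 0 \<le> R \<mu> n x"
        using pos u p n unfolding pos_resolvent_def nonneg_ae_def by auto
      ultimately have "AE x in m. \<bar>n x\<bar> \<le> \<bar>c * R \<mu> n x\<bar>"
      proof eventually_elim
        case (elim x)
        have "w x = R \<mu> u x + c * R \<mu> p x - c * R \<mu> n x"
          using elim(1,2,3) by (simp add: algebra_simps)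
        moreover have "0 \<le> c * R \<mu> p x" "0 \<le> c * R \<mu> n x" using elim c by auto
        ultimately have "- w x \<le> c * R \<mu> n x" using elim(4) by linarith
        with \<open>0 \<le> c * R \<mu> n x\<close> show ?case by (simp add: n_def)
      qed
      then have "norm2 m n \<le> norm2 m (\<lambda>x. c * R \<mu> n x)"
        by (intro norm2_mono) (use n mu in auto)
      also have "\<dots> = c * norm2 m (R \<mu> n)" using c by (simp add: norm2_scale)
      also have "\<dots> \<le> c * (2 * K * norm2 m n)" using c bound[OF mu n(1)] by (intro mult_left_mono)
      also have "\<dots> \<le> (2 * \<delta>) * (2 * K * norm2 m n)" using c K by (intro mult_right_mono) auto
      finally have le1: "norm2 m n \<le> (4 * (K * \<delta>)) * norm2 m n" by (simp add: mult_ac)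
      have "norm2 m n = 0"
      proof (rule ccontr)
        assume "norm2 m n \<noteq> 0"
        then have "0 < norm2 m n" by (simp add: less_le)
        then have "(4 * (K * \<delta>)) * norm2 m n < 1 * norm2 m n" using K\<delta> by (intro mult_strict_right_mono)
        with le1 show False by simp
      qed
      then have "AE x in m. n x = 0" using norm2_eq_0_iff[OF n(1)] by simp
      then show "nonneg_ae m (R \<nu> u)"
        unfolding nonneg_ae_def w_def[symmetric]
        by eventually_elim (simp add: n_def max_def split: if_splits)
    qed
  qed
qed

text \<open>Failures of positivity to the right of \<open>lam\<close> are bounded above by the
  growth bound; let \<open>s\<close> be their supremum. Just to the right of \<open>s\<close> the
  resolvent is positive, and \<open>pos_resolvent_step\<close> around \<open>s\<close>, which itself
  lies in the resolvent set, carries positivity down to a failure just below or at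
  \<open>s\<close>.\<close>

lemma pos_resolvent_right:
  assumes lam: "{lam..} \<subseteq> \<rho>"
  shows "pos_resolvent lam"
proof (rule ccontr)
  assume neg: "\<not> pos_resolvent lam"
  obtain K w where K: "1 \<le> K" "0 \<le> w"
    "\<And>t u. 0 \<le> t \<Longrightarrow> u \<in> L2 m \<Longrightarrow> norm2 m (T t u) \<le> K * exp (w * t) * norm2 m u"
    using growth_bound by metis
  define S where "S = {\<mu>. lam \<le> \<mu> \<and> \<not> pos_resolvent \<mu>}"
  have ne: "lam \<in> S" using neg by (simp add: S_def)
  have bdd: "bdd_above S"
    using pos_resolvent_large[OF K] by (intro bdd_aboveI[of _ w]) (auto simp: S_def not_less[symmetric])
  define s where "s = Sup S"
  have s: "lam \<le> s" unfolding s_def by (rule cSup_upper[OF ne bdd])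
  then have s_in: "s \<in> \<rho>" using lam by auto
  obtain \<delta> where \<delta>: "0 < \<delta>" "\<And>\<mu> \<nu>. \<mu> \<in> \<rho> \<Longrightarrow> \<nu> \<in> \<rho> \<Longrightarrow> \<bar>\<mu> - s\<bar> < \<delta> \<Longrightarrow> \<bar>\<nu> - s\<bar> < \<delta> \<Longrightarrow>
    \<nu> \<le> \<mu> \<Longrightarrow> pos_resolvent \<mu> \<Longrightarrow> pos_resolvent \<nu>"
    by (rule pos_resolvent_step[OF s_in]) blast
  obtain \<nu> where \<nu>: "\<nu> \<in> S" "s - \<delta> < \<nu>"
    using less_cSup_iff[OF _ bdd, of "s - \<delta>"] ne \<delta>(1) by (auto simp: s_def)
  have \<nu>s: "\<nu> \<le> s" unfolding s_def by (rule cSup_upper[OF \<nu>(1) bdd])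
  define \<mu> where "\<mu> = s + \<delta> / 2"
  have "\<mu> \<notin> S"
  proof
    assume "\<mu> \<in> S"
    then have "\<mu> \<le> s" unfolding s_def by (rule cSup_upper[OF _ bdd])
    then show False using \<delta> by (simp add: \<mu>_def)
  qed
  then have "pos_resolvent \<mu>" using s \<delta> by (simp add: S_def \<mu>_def)
  then have "pos_resolvent \<nu>"
    using \<nu> \<nu>s \<delta>(1) s lam by (intro \<delta>(2)[of \<mu> \<nu>]) (auto simp: \<mu>_def S_def)
  with \<nu> show False by (simp add: S_def)
qed

lemma exp_generator_eigenvector:
  assumes z: "z \<in> L2 m" and eq: "\<And>s y. 0 \<le> s \<Longrightarrow> y \<in> L2 m \<Longrightarrow> inner2 m (T s z) y = exp (lam * s) * inner2 m z y"
  shows "(z, (\<lambda>x. lam * z x)) \<in> A"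
proof (rule generator_by_integral)
  fix h y assume h: "(0::real) < h" and y: "y \<in> L2 m"
  have "integral {0..h} (\<lambda>s. inner2 m (orb (\<lambda>x. lam * z x) s) y) =
      integral {0..h} (\<lambda>s. lam * exp (lam * (s + 0)) * inner2 m z y)"
    by (rule integral_cong) (use z y eq in \<open>auto simp: orb_eq inner2_T_scale\<close>)
  also have "\<dots> = exp (lam * (h + 0)) * inner2 m z y - exp (lam * (0 + 0)) * inner2 m z y"
    by (rule integral_of_deriv_shift[where c = 0 and p = "\<lambda>s. lam * exp (lam * s) * inner2 m z y"
          and F = "\<lambda>s. exp (lam * s) * inner2 m z y"])
      (use h in \<open>auto intro!: derivative_eq_intros\<close>)
  finally show "inner2 m (T h z) y - inner2 m z y = integral {0..h} (\<lambda>s. inner2 m (orb (\<lambda>x. lam * z x) s) y)"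
    using eq[of h y] h y by simp
qed (use z in auto)

(* For w = R lam u the curve exp (- lam t) T t w decreases. Its weak limit is an eigenvector of A
   to the eigenvalue lam, hence zero. *)
lemma resolvent_laplace:
  assumes lam: "{lam..} \<subseteq> \<rho>" and u: "u \<in> L2 m" "nonneg_ae m u" and y: "y \<in> L2 m"
  shows "((\<lambda>t. laplace lam u y t) \<longlongrightarrow> inner2 m (R lam u) y) at_top"
proof -
  have lam_in: "lam \<in> \<rho>" using lam by auto
  define w where "w = R lam u"
  have w: "w \<in> L2 m" using lam_in u by (auto simp: w_def)
  have wpos: "nonneg_ae m w" using pos_resolvent_right[OF lam] u by (auto simp: pos_resolvent_def w_def)
  obtain g where g: "(w, g) \<in> A" "AE x in m. lam * w x - g x = u x"
    using R_mem[OF lam_in u(1)] unfolding w_def by metis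
  define W where "W t y = exp (- lam * t) * inner2 m (T t w) y" for t y
  have Weq: "inner2 m w y = W t y + laplace lam u y t" if "0 \<le> t" "y \<in> L2 m" for t y
    using laplace_generator[OF g(1) that(2,1), of lam]
      laplace_cong[OF _ u(1) that(2) g(2)] generatorD[OF g(1)] by (simp add: W_def)
  have Wpos: "0 \<le> W t y" if "0 \<le> t" "nonneg_ae m y" for t y
    unfolding W_def using that w wpos by (auto intro!: mult_nonneg_nonneg inner2_nonneg T_pos)
  have Wlim_pos: "\<exists>L. ((\<lambda>t. W t y) \<longlongrightarrow> L) at_top" if y: "y \<in> L2 m" "nonneg_ae m y" for y
  proof -
    have "\<exists>L. ((\<lambda>t. laplace lam u y t) \<longlongrightarrow> L) at_top"
      by (rule bounded_mono_tendsto_at_top[where c = "inner2 m w y"])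
        (use laplace_mono u y Weq Wpos in \<open>auto simp: le_add_same_cancel2\<close>)
    then obtain L where L: "((\<lambda>t. laplace lam u y t) \<longlongrightarrow> L) at_top" by blast
    have "((\<lambda>t. inner2 m w y - laplace lam u y t) \<longlongrightarrow> inner2 m w y - L) at_top"
      by (intro tendsto_intros L)
    then have "((\<lambda>t. W t y) \<longlongrightarrow> inner2 m w y - L) at_top"
      by (rule Lim_transform_eventually)
        (use Weq[OF _ y(1)] in \<open>auto intro: eventually_mono[OF eventually_ge_at_top[of "0::real"]]\<close>)
    then show ?thesis by blast
  qed
  have "\<exists>L. ((\<lambda>t. W t y) \<longlongrightarrow> L) at_top" if y: "y \<in> L2 m" for y
  proof -
    have "(\<lambda>x. max 0 (y x)) \<in> L2 m" "nonneg_ae m (\<lambda>x. max 0 (y x))"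
      "(\<lambda>x. max 0 (- y x)) \<in> L2 m" "nonneg_ae m (\<lambda>x. max 0 (- y x))"
      using y by (auto simp: nonneg_ae_def)
    then obtain L1 L2 where "((\<lambda>t. W t (\<lambda>x. max 0 (y x))) \<longlongrightarrow> L1) at_top"
      "((\<lambda>t. W t (\<lambda>x. max 0 (- y x))) \<longlongrightarrow> L2) at_top" using Wlim_pos by metis
    then have "((\<lambda>t. W t (\<lambda>x. max 0 (y x)) - W t (\<lambda>x. max 0 (- y x))) \<longlongrightarrow> L1 - L2) at_top"
      by (rule tendsto_diff)
    moreover have "\<forall>\<^sub>F t in at_top. W t (\<lambda>x. max 0 (y x)) - W t (\<lambda>x. max 0 (- y x)) = W t y"
      using eventually_ge_at_top[of "0::real"]
    proof eventually_elim
      case (elim t)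
      show ?case using inner2_parts[OF y T_L2[OF elim w]] unfolding W_def by (simp only: right_diff_distrib)
    qed
    ultimately have "((\<lambda>t. W t y) \<longlongrightarrow> L1 - L2) at_top" by (rule Lim_transform_eventually)
    then show ?thesis by blast
  qed
  then obtain J where J: "\<And>y. y \<in> L2 m \<Longrightarrow> ((\<lambda>t. W t y) \<longlongrightarrow> J y) at_top" by metis
  have "\<exists>z\<in>L2 m. \<forall>y\<in>L2 m. inner2 m z y = J y"
  proof (rule riesz_L2)
    fix x y a b assume xy: "x \<in> L2 m" "y \<in> L2 m"
    have "((\<lambda>t. a * W t x + b * W t y) \<longlongrightarrow> a * J x + b * J y) at_top"
      by (intro tendsto_intros J xy)
    moreover have "\<forall>\<^sub>F t in at_top. a * W t x + b * W t y = W t (\<lambda>z. a * x z + b * y z)"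
      using eventually_ge_at_top[of "0::real"]
    proof eventually_elim
      case (elim t)
      show ?case using inner2_lin_right[OF xy T_L2[OF elim w]] by (simp add: W_def algebra_simps)
    qed
    ultimately have "((\<lambda>t. W t (\<lambda>z. a * x z + b * y z)) \<longlongrightarrow> a * J x + b * J y) at_top"
      by (rule Lim_transform_eventually)
    then show "J (\<lambda>z. a * x z + b * y z) = a * J x + b * J y"
      using J[OF L2_lin[OF xy, of a b]] tendsto_unique[OF trivial_limit_at_top_linorder] by blast
  next
    fix y assume y: "y \<in> L2 m"
    \<comment> \<open>Monotonicity in \<open>t\<close> is available only for nonnegative test
      functions. As \<open>T t w\<close> is nonnegative, \<open>W t y\<close> is dominated by
      \<open>W t\<close> at \<open>|y|\<close>, which never exceeds \<open>inner2 m w\<close> at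
      \<open>|y|\<close>.\<close>
    let ?a = "\<lambda>x. \<bar>y x\<bar>"
    have a: "?a \<in> L2 m" "nonneg_ae m ?a" using y by (auto simp: nonneg_ae_def)
    have "\<bar>W t y\<bar> \<le> norm2 m w * norm2 m y" if t: "0 \<le> t" for t
    proof -
      have Tw: "T t w \<in> L2 m" "AE x in m. 0 \<le> T t w x"
        using T_pos[OF t w wpos] t w by (auto simp: nonneg_ae_def)
      have "\<bar>inner2 m (T t w) y\<bar> \<le> (\<integral>x. \<bar>T t w x * y x\<bar> \<partial>m)"
        unfolding inner2_def by (rule integral_abs_bound)
      also have "\<dots> = inner2 m (T t w) ?a"
        unfolding inner2_def
        by (rule integral_cong_AE) (use Tw y in \<open>auto simp: abs_mult intro!: borel_measurable_times\<close>)
      finally have "\<bar>W t y\<bar> \<le> W t ?a" by (simp add: W_def abs_mult)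
      also have "W t ?a \<le> inner2 m w ?a" using Weq[OF t a(1)] laplace_nonneg[OF u(1) a(1) u(2) a(2), of lam t] by simp
      also have "\<dots> \<le> norm2 m w * norm2 m y" using inner2_le_norm2[OF w a(1)] by simp
      finally show ?thesis .
    qed
    then show "\<bar>J y\<bar> \<le> norm2 m w * norm2 m y"
      by (intro tendsto_upperbound[OF tendsto_rabs[OF J[OF y]]])
        (auto intro: eventually_mono[OF eventually_ge_at_top[of "0::real"]])
  qed
  then obtain z where z: "z \<in> L2 m" and zJ: "\<And>y. y \<in> L2 m \<Longrightarrow> inner2 m z y = J y" by blast
  have "(z, (\<lambda>x. lam * z x)) \<in> A"
  proof (rule exp_generator_eigenvector[OF z])
    fix s y assume s: "(0::real) \<le> s" and y: "y \<in> L2 m"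
    have adj: "adj m (T s) y \<in> L2 m" by (rule adj_T_L2[OF s y])
    have "filterlim (\<lambda>t::real. t + s) at_top at_top" by (rule filterlim_add_const_at_top)
    \<comment> \<open>A time shift by \<open>s\<close> leaves the limit unchanged, whereas moving
      \<open>T s\<close> onto the test function rescales \<open>W\<close> by
      \<open>exp (lam * s)\<close>. Comparing the two gives the eigenvector equation for
      \<open>z\<close>.\<close>
    then have "((\<lambda>t. W (t + s) y) \<longlongrightarrow> J y) at_top" by (rule filterlim_compose[OF J[OF y]])
    then have "((\<lambda>t. exp (lam * s) * W (t + s) y) \<longlongrightarrow> exp (lam * s) * J y) at_top" by (intro tendsto_intros)
    then have "((\<lambda>t. W t (adj m (T s) y)) \<longlongrightarrow> exp (lam * s) * J y) at_top"
    proof (rule Lim_transform_eventually)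
      show "\<forall>\<^sub>F t in at_top. exp (lam * s) * W (t + s) y = W t (adj m (T s) y)"
        using eventually_ge_at_top[of "0::real"]
      proof eventually_elim
        case (elim t)
        have "inner2 m (T t w) (adj m (T s) y) = inner2 m (T (t + s) w) y"
          using s elim w y inner2_T_add[of s t w y] by (simp add: inner2_adj_T add.commute)
        moreover have "exp (lam * s) * exp (- lam * (t + s)) = exp (- lam * t)"
          by (simp add: algebra_simps flip: exp_add)
        ultimately show ?case unfolding W_def by (simp only: mult.assoc[symmetric])
      qed
    qed
    then have "J (adj m (T s) y) = exp (lam * s) * J y"
      using J[OF adj] tendsto_unique[OF trivial_limit_at_top_linorder] by blast
    then show "inner2 m (T s z) y = exp (lam * s) * inner2 m z y"
      using zJ[OF adj] zJ[OF y] s z y by (simp add: inner2_adj_T)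
  qed
  then have "norm2 m z = 0"
  proof -
    assume *: "(z, (\<lambda>x. lam * z x)) \<in> A"
    obtain C where "0 \<le> C" "\<And>u z g. (z, g) \<in> A \<Longrightarrow> u \<in> L2 m \<Longrightarrow> AE x in m. lam * z x - g x = u x \<Longrightarrow> norm2 m z \<le> C * norm2 m u"
      using R_bound[OF lam_in] by metis
    from this(2)[OF * L2_zero] show ?thesis by (simp add: order_antisym)
  qed
  then have "J y = 0" using zJ[OF y] cauchy_schwarz_L2[OF z y] by simp
  then have "((\<lambda>t. inner2 m w y - W t y) \<longlongrightarrow> inner2 m w y - 0) at_top"
    using J[OF y] by (intro tendsto_intros) simp
  then have "((\<lambda>t. laplace lam u y t) \<longlongrightarrow> inner2 m w y - 0) at_top"
    by (rule Lim_transform_eventually)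
      (use Weq[OF _ y] in \<open>auto intro: eventually_mono[OF eventually_ge_at_top[of "0::real"]]\<close>)
  then show ?thesis by (simp add: w_def)
qed

section \<open>Bounds on L1 for the resolvent and its adjoint, and behaviour for large
  parameters\<close>

lemma inner2_R_le:
  assumes lam: "{lam..} \<subseteq> \<rho>" "c < lam" and u: "u \<in> L2 m" "nonneg_ae m u" and y: "y \<in> L2 m" and C: "0 \<le> C"
    and le: "\<And>s. 0 \<le> s \<Longrightarrow> inner2 m (T s u) y \<le> C * exp (c * s)"
  shows "inner2 m (R lam u) y \<le> C / (lam - c)"
  by (rule tendsto_upperbound[OF resolvent_laplace[OF lam(1) u y]])
    (auto intro: eventually_mono[OF eventually_ge_at_top[of "0::real"]] laplace_le assms)

lemma R_L1:
  assumes sf: "sigma_finite_measure m" and lam: "{lam..} \<subseteq> \<rho>" "c < lam"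
    and u: "u \<in> L2 m" "nonneg_ae m u" and C: "0 \<le> C"
    and le: "\<And>s. 0 \<le> s \<Longrightarrow> T s u \<in> L1 m \<and> norm1 m (T s u) \<le> C * exp (c * s)"
  shows "R lam u \<in> L1 m" "norm1 m (R lam u) \<le> C / (lam - c)"
proof -
  have lam_in: "lam \<in> \<rho>" using lam by auto
  have "inner2 m (R lam u) y \<le> C / (lam - c)" if y: "y \<in> L2 m" "\<And>x. 0 \<le> y x \<and> y x \<le> 1" for y
  proof (rule inner2_R_le[OF lam u y(1) C])
    fix s :: real assume s: "0 \<le> s"
    have "inner2 m y (T s u) \<le> norm1 m (T s u)"
      by (rule inner2_le_norm1) (use y u s le[OF s] in auto)
    then show "inner2 m (T s u) y \<le> C * exp (c * s)" using le[OF s] by (simp add: inner2_commute)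
  qed
  then show "R lam u \<in> L1 m" "norm1 m (R lam u) \<le> C / (lam - c)"
    using sigma_finite_measure.L1_by_duality[OF sf R_L2[OF lam_in u(1)]] pos_resolvent_right[OF lam(1)] u
    unfolding pos_resolvent_def by blast+
qed

text \<open>Here \<open>z\<close> is the adjoint of \<open>R lam\<close> applied to
  \<open>v\<close>, found by Riesz representation, so the resolvent theory of the adjoint operator
  never has to be developed. Its \<open>L1\<close> bound is \<open>inner2_R_le\<close> with the test
  function as the argument of the resolvent.\<close>

lemma adjoint_resolvent:
  assumes sf: "sigma_finite_measure m" and lam: "{lam..} \<subseteq> \<rho>" "c < lam"
    and v: "v \<in> L2 m" "nonneg_ae m v" and C: "0 \<le> C"
    and le: "\<And>s. 0 \<le> s \<Longrightarrow> adj m (T s) v \<in> L1 m \<and> norm1 m (adj m (T s) v) \<le> C * exp (c * s)"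
  obtains z where "(z, (\<lambda>x. lam * z x - v x)) \<in> adjoint_op m A" "nonneg_ae m z"
    "z \<in> L1 m" "norm1 m z \<le> C / (lam - c)" "\<forall>x\<in>L2 m. inner2 m x z = inner2 m (R lam x) v"
proof -
  have lam_in: "lam \<in> \<rho>" using lam by auto
  obtain K where K: "0 \<le> K" "\<And>u. u \<in> L2 m \<Longrightarrow> norm2 m (R lam u) \<le> K * norm2 m u"
    using R_norm_bound[OF lam_in] by metis
  have "\<exists>z\<in>L2 m. \<forall>x\<in>L2 m. inner2 m z x = inner2 m (R lam x) v"
  proof (rule riesz_L2)
    fix x y a b assume xy: "x \<in> L2 m" "y \<in> L2 m"
    have "inner2 m (R lam (\<lambda>t. a * x t + b * y t)) v = inner2 m (\<lambda>t. a * R lam x t + b * R lam y t) v"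
      by (rule inner2_cong_AE[OF _ _ _ R_lin]) (use lam_in v xy in auto)
    then show "inner2 m (R lam (\<lambda>t. a * x t + b * y t)) v = a * inner2 m (R lam x) v + b * inner2 m (R lam y) v"
      using lam_in v xy by (simp add: inner2_lin_left)
  next
    fix x assume x: "x \<in> L2 m"
    show "\<bar>inner2 m (R lam x) v\<bar> \<le> (K * norm2 m v) * norm2 m x"
      using cauchy_schwarz_L2_le[OF R_L2[OF lam_in x] v(1) K(2)[OF x]] by (simp add: mult_ac)
  qed
  then obtain z where z: "z \<in> L2 m" and zR: "\<And>x. x \<in> L2 m \<Longrightarrow> inner2 m z x = inner2 m (R lam x) v" by blast
  have zpos: "nonneg_ae m z"
    by (rule nonneg_ae_by_duality[OF z])
      (use zR v pos_resolvent_right[OF lam(1)] in \<open>auto simp: pos_resolvent_def intro!: inner2_nonneg\<close>)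
  have "inner2 m z y \<le> C / (lam - c)" if y: "y \<in> L2 m" "\<And>x. 0 \<le> y x \<and> y x \<le> 1" for y
    unfolding zR[OF y(1)]
  proof (rule inner2_R_le[OF lam y(1) _ v(1) C])
    show "nonneg_ae m y" using y by (simp add: nonneg_ae_def)
    fix s :: real assume s: "0 \<le> s"
    have "inner2 m y (adj m (T s) v) \<le> norm1 m (adj m (T s) v)"
      by (rule inner2_le_norm1) (use y v s le[OF s] in auto)
    then show "inner2 m (T s y) v \<le> C * exp (c * s)" using le[OF s] s v y by (simp add: inner2_adj_T)
  qed
  then have z1: "z \<in> L1 m" "norm1 m z \<le> C / (lam - c)"
    using sigma_finite_measure.L1_by_duality[OF sf z zpos] by blast+
  have "(z, (\<lambda>x. lam * z x - v x)) \<in> adjoint_op m A"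
    unfolding adjoint_op_def
  proof (safe)
    fix x g assume xg: "(x, g) \<in> A"
    note x = generatorD(1)[OF xg] and g = generatorD(2)[OF xg]
    have "inner2 m z (\<lambda>t. lam * x t - g t) = inner2 m (R lam (\<lambda>t. lam * x t - g t)) v"
      by (rule zR) (use x g in auto)
    also have "\<dots> = inner2 m x v"
      by (rule inner2_cong_AE[OF _ _ _ R_generator[OF lam_in xg]]) (use x g lam_in v in auto)
    finally show "inner2 m g z = inner2 m x (\<lambda>x. lam * z x - v x)"
      using x g z v by (simp add: inner2_simps inner2_commute)
  qed (use z v in auto)
  then show ?thesis using that zpos z1 zR by (simp add: inner2_commute)
qed

text \<open>For \<open>x\<close> in the domain with image \<open>g\<close>,
  \<open>lam * R lam x - x\<close> equals \<open>R lam g\<close>, whose norm decays like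
  \<open>1 / lam\<close>. Density of the domain and a bound on \<open>lam * R lam\<close> uniform in
  large \<open>lam\<close> extend the convergence to all \<open>u\<close>.\<close>

lemma R_asymptotics:
  assumes u: "u \<in> L2 m" and y: "y \<in> L2 m"
  shows "((\<lambda>lam. lam * inner2 m (R lam u) y) \<longlongrightarrow> inner2 m u y) at_top"
proof -
  obtain K w where K: "1 \<le> K" "0 \<le> w"
    "\<And>t u. 0 \<le> t \<Longrightarrow> u \<in> L2 m \<Longrightarrow> norm2 m (T t u) \<le> K * exp (w * t) * norm2 m u"
    using growth_bound by metis
  have strong: "((\<lambda>lam. norm2 m (\<lambda>x. lam * R lam u x - u x)) \<longlongrightarrow> 0) at_top"
  proof (rule tendstoI)
    fix e :: real assume e: "0 < e"
    obtain x g where xg: "(x, g) \<in> A" and xu: "norm2 m (\<lambda>z. x z - u z) < e / (2 * (2 * K + 1))"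
      \<comment> \<open>For \<open>lam \<ge> 2 * w\<close> the quotient
        \<open>lam / (lam - w)\<close> is at most 2, so \<open>lam * R lam\<close> has norm at most
        \<open>2 * K\<close>. Together with the identity, the approximation error is multiplied by
        at most \<open>2 * K + 1\<close>, which leaves \<open>e / 2\<close> for
        \<open>R lam g\<close>.\<close>
      using generator_dense[OF u, of "e / (2 * (2 * K + 1))"] e K by auto
    note x = generatorD(1)[OF xg] and g = generatorD(2)[OF xg]
    have "filterlim (\<lambda>lam::real. lam + (- w)) at_top at_top" by (rule filterlim_add_const_at_top)
    then have "filterlim (\<lambda>lam::real. lam - w) at_infinity at_top"
      by (simp add: filterlim_at_top_imp_at_infinity)
    then have "((\<lambda>lam. K / (lam - w)) \<longlongrightarrow> 0) at_top" by (rule tendsto_divide_0[OF tendsto_const])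
    then have "((\<lambda>lam. K / (lam - w) * norm2 m g) \<longlongrightarrow> 0) at_top" by (rule tendsto_mult_left_zero)
    then have ev: "\<forall>\<^sub>F lam in at_top. K / (lam - w) * norm2 m g < e / 2"
      by (rule order_tendstoD) (use e in simp)
    show "\<forall>\<^sub>F lam in at_top. dist (norm2 m (\<lambda>x. lam * R lam u x - u x)) 0 < e"
      using ev eventually_ge_at_top[of "2 * w"] eventually_gt_at_top[of w]
    proof eventually_elim
      case (elim lam)
      have lam0: "0 < lam" using elim K by simp
      have lam_in: "lam \<in> \<rho>" by (rule large_in_resolvent_set[OF K elim(3)])
      have bd: "norm2 m (R lam f) \<le> K / (lam - w) * norm2 m f" if "f \<in> L2 m" for f
        by (rule R_laplace_large(2)[OF K elim(3) that L2_zero])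
      define d where "d = (\<lambda>z. u z - x z)"
      have d: "d \<in> L2 m" using u x by (auto simp: d_def)
      have "AE z in m. R lam (\<lambda>z. lam * x z + (-1) * g z) z = lam * R lam x z + (-1) * R lam g z"
        by (rule R_lin[OF lam_in x g])
      moreover have "AE z in m. R lam (\<lambda>z. lam * x z - g z) z = x z" by (rule R_generator[OF lam_in xg])
      moreover have "AE z in m. R lam (\<lambda>z. 1 * u z + (-1) * x z) z = 1 * R lam u z + (-1) * R lam x z"
        by (rule R_lin[OF lam_in u x])
      ultimately have "AE z in m. lam * R lam u z - u z = (lam * R lam d z + R lam g z) + (-1) * d z"
      proof eventually_elim
        case (elim z)
        have "R lam u z = R lam x z + R lam d z" "lam * R lam x z = x z + R lam g z"
          using elim by (simp_all add: d_def)
        then have "lam * R lam u z = x z + R lam g z + lam * R lam d z" by (simp only: distrib_left)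
        then show ?case by (simp add: d_def)
      qed
      then have "norm2 m (\<lambda>z. lam * R lam u z - u z) = norm2 m (\<lambda>z. (lam * R lam d z + R lam g z) + (-1) * d z)"
        by (intro norm2_cong_AE L2_add L2_diff L2_scale R_L2 lam_in u d g)
      also have "\<dots> \<le> norm2 m (\<lambda>z. lam * R lam d z + R lam g z) + norm2 m (\<lambda>z. (-1) * d z)"
        by (intro norm2_triangle L2_add L2_scale R_L2 lam_in d g)
      also have "norm2 m (\<lambda>z. lam * R lam d z + R lam g z) \<le> norm2 m (\<lambda>z. lam * R lam d z) + norm2 m (R lam g)"
        by (intro norm2_triangle L2_scale R_L2 lam_in d g)
      also have "norm2 m (\<lambda>z. lam * R lam d z) = lam * norm2 m (R lam d)" using lam0 by (simp add: norm2_scale)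
      also have "lam * norm2 m (R lam d) \<le> lam * (K / (lam - w) * norm2 m d)"
        using lam0 by (intro mult_left_mono bd d) auto
      also have "lam * (K / (lam - w) * norm2 m d) \<le> 2 * K * norm2 m d"
      proof -
        have "lam / (lam - w) \<le> 2" using elim by (simp add: field_simps)
        then have "lam / (lam - w) * (K * norm2 m d) \<le> 2 * (K * norm2 m d)"
          using K by (intro mult_right_mono) auto
        then show ?thesis by (simp add: mult_ac)
      qed
      also have "norm2 m (\<lambda>z. (-1) * d z) = norm2 m d" unfolding norm2_scale by simp
      finally have "norm2 m (\<lambda>z. lam * R lam u z - u z) \<le> (2 * K + 1) * norm2 m d + norm2 m (R lam g)"
        by (simp add: algebra_simps)
      also have "norm2 m (R lam g) \<le> K / (lam - w) * norm2 m g" by (rule bd[OF g])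
      also have "(2 * K + 1) * norm2 m d < e / 2"
        using xu K unfolding d_def norm2_minus_commute[of m u x] by (simp add: field_simps)
      finally have "norm2 m (\<lambda>z. lam * R lam u z - u z) < e" using elim(1) by linarith
      then show ?case by simp
    qed
  qed
  have "((\<lambda>lam. lam * inner2 m (R lam u) y - inner2 m u y) \<longlongrightarrow> 0) at_top"
  proof (rule Lim_null_comparison)
    show "((\<lambda>lam. norm2 m (\<lambda>x. lam * R lam u x - u x) * norm2 m y) \<longlongrightarrow> 0) at_top"
      by (rule tendsto_mult_left_zero[OF strong])
    show "\<forall>\<^sub>F lam in at_top. norm (lam * inner2 m (R lam u) y - inner2 m u y)
        \<le> norm2 m (\<lambda>x. lam * R lam u x - u x) * norm2 m y"
      using eventually_gt_at_top[of w]
    proof eventually_elim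
      case (elim lam)
      have lam_in: "lam \<in> \<rho>" by (rule large_in_resolvent_set[OF K elim])
      show ?case
        using cauchy_schwarz_L2[of "\<lambda>x. lam * R lam u x - u x" m y] u y lam_in by (simp add: inner2_simps)
    qed
  qed
  then show ?thesis by (rule LIM_zero_cancel)
qed

end

section \<open>Comparison of two semigroups\<close>

lemma norm1_nonneg [simp]: "0 \<le> norm1 m u"
  by (simp add: norm1_def)

lemma inner2_strong_weak_tendsto:
  assumes L2: "\<And>h. 0 < h \<Longrightarrow> U h \<in> L2 m" "\<And>h. 0 < h \<Longrightarrow> V h \<in> L2 m" "x \<in> L2 m"
    and strong: "((\<lambda>h. norm2 m (\<lambda>z. U h z - x z)) \<longlongrightarrow> 0) (at_right (0::real))"
    and weak: "((\<lambda>h. inner2 m (V h) x) \<longlongrightarrow> inner2 m y x) (at_right 0)"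
    and bdd: "\<forall>\<^sub>F h in at_right 0. norm2 m (V h) \<le> B"
  shows "((\<lambda>h. inner2 m (U h) (V h)) \<longlongrightarrow> inner2 m x y) (at_right 0)"
proof -
  have "((\<lambda>h. inner2 m (\<lambda>z. U h z - x z) (V h)) \<longlongrightarrow> 0) (at_right 0)"
  proof (rule Lim_null_comparison)
    show "((\<lambda>h. norm2 m (\<lambda>z. U h z - x z) * B) \<longlongrightarrow> 0) (at_right 0)"
      by (rule tendsto_mult_left_zero[OF strong])
    show "\<forall>\<^sub>F h in at_right 0. norm (inner2 m (\<lambda>z. U h z - x z) (V h)) \<le> norm2 m (\<lambda>z. U h z - x z) * B"
      using bdd eventually_at_right_less[of "0::real"]
    proof eventually_elim
      case (elim h)
      have "\<bar>inner2 m (\<lambda>z. U h z - x z) (V h)\<bar> \<le> norm2 m (\<lambda>z. U h z - x z) * norm2 m (V h)"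
        by (rule cauchy_schwarz_L2) (use L2 elim in auto)
      also have "\<dots> \<le> norm2 m (\<lambda>z. U h z - x z) * B" using elim by (intro mult_left_mono) auto
      finally show ?case by simp
    qed
  qed
  from tendsto_add[OF this weak]
  have "((\<lambda>h. inner2 m (\<lambda>z. U h z - x z) (V h) + inner2 m (V h) x) \<longlongrightarrow> inner2 m x y) (at_right 0)"
    by (simp add: inner2_commute)
  then show ?thesis
  proof (rule Lim_transform_eventually)
    show "\<forall>\<^sub>F h in at_right 0. inner2 m (\<lambda>z. U h z - x z) (V h) + inner2 m (V h) x = inner2 m (U h) (V h)"
      using eventually_at_right_less[of "0::real"]
      by eventually_elim (simp add: L2 inner2_diff_left inner2_commute[of m "V _" x])
  qed
qed

locale semigroup_pair = T: pos_semigroup m T + T0: pos_semigroup m T0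
  for m :: "'a measure" and T T0 +
  fixes M \<omega> :: real
  assumes sf: "sigma_finite_measure m" and M: "1 \<le> M"
    and T_L1: "\<And>t u. 0 \<le> t \<Longrightarrow> u \<in> L2 m \<Longrightarrow> u \<in> L1 m \<Longrightarrow>
      T t u \<in> L1 m \<and> norm1 m (T t u) \<le> M * exp (\<omega> * t) * norm1 m u"
    and T0_L1: "\<And>t v. 0 \<le> t \<Longrightarrow> v \<in> L2 m \<Longrightarrow> v \<in> L1 m \<Longrightarrow>
      adj m (T0 t) v \<in> L1 m \<and> norm1 m (adj m (T0 t) v) \<le> M * exp (\<omega> * t) * norm1 m v"
begin

text \<open>Quantifying over pairs in the graphs removes the chosen values \<open>op_apply\<close>,
  so that the explicit images of averages and resolvents can be inserted directly.\<close>

definition form_bound :: "real \<Rightarrow> bool" where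
  "form_bound C \<longleftrightarrow> (\<forall>u g v k. (u, g) \<in> T.A \<longrightarrow> (v, k) \<in> adjoint_op m T0.A \<longrightarrow> u \<in> L1 m \<longrightarrow> v \<in> L1 m \<longrightarrow>
     nonneg_ae m u \<longrightarrow> nonneg_ae m v \<longrightarrow> inner2 m g v \<le> inner2 m u k + C * norm1 m u * norm1 m v)"

lemma form_bound_mono:
  assumes "form_bound C" "C \<le> D"
  shows "form_bound D"
  unfolding form_bound_def
proof (intro allI impI)
  fix u g v k
  assume "(u, g) \<in> T.A" "(v, k) \<in> adjoint_op m T0.A" "u \<in> L1 m" "v \<in> L1 m" "nonneg_ae m u" "nonneg_ae m v"
  then have "inner2 m g v \<le> inner2 m u k + C * norm1 m u * norm1 m v"
    using assms(1) unfolding form_bound_def by blast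
  also have "C * norm1 m u * norm1 m v \<le> D * norm1 m u * norm1 m v"
    using assms(2) by (intro mult_right_mono) auto
  finally show "inner2 m g v \<le> inner2 m u k + D * norm1 m u * norm1 m v" by simp
qed

text \<open>As \<open>u\<close> need not lie in the domain of \<open>T0.A\<close>, its
  \<open>T0\<close> difference quotient is read as the image under \<open>T0.A\<close> of an average
  of its orbit. The adjoint relation moves the operator onto \<open>v\<close>, and the average tends
  weakly to \<open>u\<close>.\<close>

lemma form_bound_of_semigroup_bound:
  assumes le: "\<And>t u. 0 \<le> t \<Longrightarrow> u \<in> L2 m \<Longrightarrow> u \<in> L1 m \<Longrightarrow> nonneg_ae m u \<Longrightarrow>
    AE x in m. T t u x \<le> T0 t u x + C * t * exp (\<omega> * t) * norm1 m u"
  shows "form_bound C"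
  unfolding form_bound_def
proof (intro allI impI)
  fix u g v k
  assume ug: "(u, g) \<in> T.A" and vk: "(v, k) \<in> adjoint_op m T0.A" and L1: "u \<in> L1 m" "v \<in> L1 m"
    and pos: "nonneg_ae m u" "nonneg_ae m v"
  note u = T.generatorD(1)[OF ug] and v = adjoint_opD(1)[OF vk] and k = adjoint_opD(2)[OF vk]
  interpret U: strong_curve m "T0.orb u" by (rule T0.strong_curve_orb[OF u])
  have lim: "((\<lambda>h. inner2 m (wavg m (T0.orb u) h 0) k + C * exp (\<omega> * h) * norm1 m u * norm1 m v) \<longlongrightarrow>
      inner2 m (T0.orb u 0) k + C * exp (\<omega> * 0) * norm1 m u * norm1 m v) (at_right 0)"
    by (intro tendsto_intros U.inner2_wavg_tendsto k)
  have "inner2 m g v \<le> inner2 m (T0.orb u 0) k + C * exp (\<omega> * 0) * norm1 m u * norm1 m v"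
  proof (rule tendsto_le[OF _ lim T.inner2_generator_tendsto[OF ug v]])
    show "\<forall>\<^sub>F h in at_right 0. (inner2 m (T h u) v - inner2 m u v) / h
        \<le> inner2 m (wavg m (T0.orb u) h 0) k + C * exp (\<omega> * h) * norm1 m u * norm1 m v"
      using eventually_at_right_less[of "0::real"]
    proof eventually_elim
      case (elim h)
      have "inner2 m (T h u) v \<le> inner2 m (T0 h u) v + (C * h * exp (\<omega> * h) * norm1 m u) * norm1 m v"
        by (rule inner2_le_of_AE_le) (use elim u v L1 pos le in auto)
      then have "(inner2 m (T h u) v - inner2 m u v) / h
          \<le> ((inner2 m (T0 h u) v - inner2 m u v) + (C * h * exp (\<omega> * h) * norm1 m u) * norm1 m v) / h"
        using elim by (intro divide_right_mono) auto
      also have "\<dots> = (inner2 m (T0 h u) v - inner2 m u v) / h + C * exp (\<omega> * h) * norm1 m u * norm1 m v"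
        using elim by (simp add: add_divide_distrib)
      also have "(inner2 m (T0 h u) v - inner2 m u v) / h = inner2 m (\<lambda>x. (T0.orb u (0 + h) x - T0.orb u 0 x) / h) v"
        using elim u v by (simp add: inner2_simps T0.orb_eq T0.inner2_T_zero)
      also have "\<dots> = inner2 m (wavg m (T0.orb u) h 0) k"
        by (rule adjoint_opD(3)[OF vk T0.wavg_orb_generator]) (use u elim in auto)
      finally show ?case .
    qed
  qed simp
  then show "inner2 m g v \<le> inner2 m u k + C * norm1 m u * norm1 m v"
    by (simp add: T0.inner2_orb_zero u k)
qed

lemma resolvent_bound_of_form_bound:
  assumes fb: "form_bound C" and C: "0 \<le> C" and lam: "{lam..} \<subseteq> T.\<rho>" "{lam..} \<subseteq> T0.\<rho>" "\<omega> < lam"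
    and u: "u \<in> L2 m" "u \<in> L1 m" "nonneg_ae m u"
  shows "AE x in m. T.R lam u x \<le> T0.R lam u x + C * M\<^sup>2 / (lam - \<omega>)\<^sup>2 * norm1 m u"
proof (rule sigma_finite_measure.AE_le_by_duality[OF sf])
  have lam_in: "lam \<in> T.\<rho>" "lam \<in> T0.\<rho>" using lam by auto
  then show "T.R lam u \<in> L2 m" "T0.R lam u \<in> L2 m" using u by auto
  fix v assume v: "v \<in> L2 m" "v \<in> L1 m" "nonneg_ae m v"
  define w where "w = T.R lam u"
  obtain g where g: "(w, g) \<in> T.A" "AE x in m. lam * w x - g x = u x"
    using T.R_mem[OF lam_in(1) u(1)] unfolding w_def by metis
  note wL = T.generatorD(1)[OF g(1)] and gL = T.generatorD(2)[OF g(1)]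
  have w1: "w \<in> L1 m" "norm1 m w \<le> M * norm1 m u / (lam - \<omega>)"
    unfolding w_def
    using T.R_L1[OF sf lam(1,3) u(1,3), of "M * norm1 m u"] T_L1[OF _ u(1,2)] M by (auto simp: mult_ac)
  have wpos: "nonneg_ae m w"
    using T.pos_resolvent_right[OF lam(1)] u by (auto simp: T.pos_resolvent_def w_def)
  have Mv: "0 \<le> M * norm1 m v" using M by simp
  have adj_L1: "\<And>s. 0 \<le> s \<Longrightarrow> adj m (T0 s) v \<in> L1 m \<and> norm1 m (adj m (T0 s) v) \<le> (M * norm1 m v) * exp (\<omega> * s)"
    using T0_L1[OF _ v(1,2)] by (auto simp: mult_ac)
  obtain z where z: "(z, (\<lambda>x. lam * z x - v x)) \<in> adjoint_op m T0.A" "nonneg_ae m z"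
    "z \<in> L1 m" "norm1 m z \<le> M * norm1 m v / (lam - \<omega>)" "\<forall>x\<in>L2 m. inner2 m x z = inner2 m (T0.R lam x) v"
    by (rule T0.adjoint_resolvent[OF sf lam(2,3) v(1,3) Mv adj_L1]) blast
  note zL = adjoint_opD(1)[OF z(1)]
  \<comment> \<open>Pairing the resolvent equation for \<open>w\<close> with \<open>z\<close> lets
    \<open>lam * inner2 m w z\<close> cancel in the form bound for \<open>w\<close> and
    \<open>z\<close>. What remains compares exactly the two resolvents of \<open>u\<close>, paired
    with \<open>v\<close>.\<close>
  have "lam * inner2 m w z - inner2 m g z = inner2 m (\<lambda>x. lam * w x - g x) z"
    using wL gL zL by (simp add: inner2_simps)
  also have "\<dots> = inner2 m u z" by (rule inner2_cong_AE) (use wL gL zL u g in auto)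
  finally have 1: "inner2 m g z = lam * inner2 m w z - inner2 m (T0.R lam u) v" using z(5) u(1) by simp
  have "inner2 m g z \<le> inner2 m w (\<lambda>x. lam * z x - v x) + C * norm1 m w * norm1 m z"
    using fb g(1) z w1 wpos unfolding form_bound_def by blast
  then have "inner2 m w v \<le> inner2 m (T0.R lam u) v + C * (norm1 m w * norm1 m z)"
    using wL zL v unfolding 1 by (simp add: inner2_simps)
  also have "norm1 m w * norm1 m z \<le> (M * norm1 m u / (lam - \<omega>)) * (M * norm1 m v / (lam - \<omega>))"
    using w1 z M lam by (intro mult_mono) auto
  then have "C * (norm1 m w * norm1 m z) \<le> C * ((M * norm1 m u / (lam - \<omega>)) * (M * norm1 m v / (lam - \<omega>)))"
    using C by (rule mult_left_mono)
  also have "\<dots> = C * M\<^sup>2 / (lam - \<omega>)\<^sup>2 * norm1 m u * norm1 m v" by (simp add: power2_eq_square)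
  finally show "inner2 m (T.R lam u) v \<le> inner2 m (T0.R lam u) v + C * M\<^sup>2 / (lam - \<omega>)\<^sup>2 * norm1 m u * norm1 m v"
    by (simp add: w_def)
qed

text \<open>The limit runs through \<open>lam\<close> beyond both growth bounds, where the whole
  half-line lies in both resolvent sets and the hypothesis applies. The constant is preserved
  because \<open>lam\<^sup>2 / (lam - \<omega>)\<^sup>2\<close> tends to 1.\<close>

lemma form_bound_of_resolvent_bound:
  assumes le: "\<And>lam u. {lam..} \<subseteq> T.\<rho> \<Longrightarrow> {lam..} \<subseteq> T0.\<rho> \<Longrightarrow> \<omega> < lam \<Longrightarrow>
    u \<in> L2 m \<Longrightarrow> u \<in> L1 m \<Longrightarrow> nonneg_ae m u \<Longrightarrow>
    AE x in m. T.R lam u x \<le> T0.R lam u x + C / (lam - \<omega>)\<^sup>2 * norm1 m u"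
  shows "form_bound C"
  unfolding form_bound_def
proof (intro allI impI)
  fix u g v k
  assume ug: "(u, g) \<in> T.A" and vk: "(v, k) \<in> adjoint_op m T0.A" and L1: "u \<in> L1 m" "v \<in> L1 m"
    and pos: "nonneg_ae m u" "nonneg_ae m v"
  note u = T.generatorD(1)[OF ug] and g = T.generatorD(2)[OF ug]
    and v = adjoint_opD(1)[OF vk] and k = adjoint_opD(2)[OF vk]
  obtain K w where K: "1 \<le> K" "0 \<le> w"
    "\<And>t u. 0 \<le> t \<Longrightarrow> u \<in> L2 m \<Longrightarrow> norm2 m (T t u) \<le> K * exp (w * t) * norm2 m u"
    using T.growth_bound by metis
  obtain K0 w0 where K0: "1 \<le> K0" "0 \<le> w0"
    "\<And>t u. 0 \<le> t \<Longrightarrow> u \<in> L2 m \<Longrightarrow> norm2 m (T0 t u) \<le> K0 * exp (w0 * t) * norm2 m u"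
    using T0.growth_bound by metis
  have "((\<lambda>lam::real. \<omega> / (lam - \<omega>)) \<longlongrightarrow> 0) at_top"
    using filterlim_add_const_at_top[of "- \<omega>"]
    by (intro tendsto_divide_0[OF tendsto_const]) (simp add: filterlim_at_top_imp_at_infinity)
  then have "((\<lambda>lam. C * (1 + \<omega> / (lam - \<omega>))\<^sup>2 * norm1 m u * norm1 m v) \<longlongrightarrow> C * (1 + 0)\<^sup>2 * norm1 m u * norm1 m v) at_top"
    by (intro tendsto_intros)
  then have lim: "((\<lambda>lam. lam * inner2 m (T0.R lam u) k + C * (1 + \<omega> / (lam - \<omega>))\<^sup>2 * norm1 m u * norm1 m v) \<longlongrightarrow>
      inner2 m u k + C * (1 + 0)\<^sup>2 * norm1 m u * norm1 m v) at_top"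
    by (rule tendsto_add[OF T0.R_asymptotics[OF u k]])
  have "inner2 m g v \<le> inner2 m u k + C * (1 + 0)\<^sup>2 * norm1 m u * norm1 m v"
  proof (rule tendsto_le[OF _ lim T.R_asymptotics[OF g v]])
    show "\<forall>\<^sub>F lam in at_top. lam * inner2 m (T.R lam g) v
        \<le> lam * inner2 m (T0.R lam u) k + C * (1 + \<omega> / (lam - \<omega>))\<^sup>2 * norm1 m u * norm1 m v"
      using eventually_gt_at_top[of "max (max w w0) \<omega>"]
    proof eventually_elim
      case (elim lam)
      have sub: "{lam..} \<subseteq> T.\<rho>" "{lam..} \<subseteq> T0.\<rho>"
        using T.large_in_resolvent_set[OF K] T0.large_in_resolvent_set[OF K0] elim by auto
      then have lam_in: "lam \<in> T.\<rho>" "lam \<in> T0.\<rho>" by auto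
      have "inner2 m (T.R lam u) v \<le> inner2 m (T0.R lam u) v + C / (lam - \<omega>)\<^sup>2 * norm1 m u * norm1 m v"
        by (rule inner2_le_of_AE_le) (use lam_in sub elim u v L1 pos le in auto)
      \<comment> \<open>After multiplication by \<open>lam\<^sup>2\<close>, the two sides differ
        from \<open>lam * inner2 m (T.R lam g) v\<close> and
        \<open>lam * inner2 m (T0.R lam u) k\<close> plus the error term by the same quantity
        \<open>lam * inner2 m u v\<close>. It grows with \<open>lam\<close> but cancels, and both
        remaining pairings converge by \<open>R_asymptotics\<close>.\<close>
      then have "lam\<^sup>2 * inner2 m (T.R lam u) v \<le> lam\<^sup>2 * (inner2 m (T0.R lam u) v + C / (lam - \<omega>)\<^sup>2 * norm1 m u * norm1 m v)"
        by (intro mult_left_mono) auto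
      moreover have "lam * inner2 m (T.R lam g) v = lam\<^sup>2 * inner2 m (T.R lam u) v - lam * inner2 m u v"
      proof -
        have "AE x in m. T.R lam (\<lambda>x. lam * u x + (-1) * g x) x = lam * T.R lam u x + (-1) * T.R lam g x"
          by (rule T.R_lin[OF lam_in(1) u g])
        moreover have "AE x in m. T.R lam (\<lambda>x. lam * u x - g x) x = u x" by (rule T.R_generator[OF lam_in(1) ug])
        ultimately have "AE x in m. T.R lam g x = lam * T.R lam u x - u x" by eventually_elim simp
        then have "inner2 m (T.R lam g) v = inner2 m (\<lambda>x. lam * T.R lam u x - u x) v"
          by (intro inner2_cong_AE) (use lam_in u g v in auto)
        also have "\<dots> = lam * inner2 m (T.R lam u) v - inner2 m u v"
          using lam_in u v by (simp add: inner2_simps)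
        finally show ?thesis by (simp add: power2_eq_square right_diff_distrib)
      qed
      moreover have "lam * inner2 m (T0.R lam u) k = lam\<^sup>2 * inner2 m (T0.R lam u) v - lam * inner2 m u v"
      proof -
        obtain g0 where g0: "(T0.R lam u, g0) \<in> T0.A" "AE x in m. lam * T0.R lam u x - g0 x = u x"
          using T0.R_mem[OF lam_in(2) u] by metis
        have "AE x in m. g0 x = lam * T0.R lam u x - u x" using g0(2) by eventually_elim simp
        then have "inner2 m g0 v = inner2 m (\<lambda>x. lam * T0.R lam u x - u x) v"
          by (intro inner2_cong_AE) (use T0.generatorD[OF g0(1)] u v in auto)
        then have "inner2 m (T0.R lam u) k = lam * inner2 m (T0.R lam u) v - inner2 m u v"
          using adjoint_opD(3)[OF vk g0(1)] lam_in u v by (simp add: inner2_simps)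
        then show ?thesis by (simp add: power2_eq_square right_diff_distrib)
      qed
      moreover have "lam\<^sup>2 * (C / (lam - \<omega>)\<^sup>2 * norm1 m u * norm1 m v) = C * (1 + \<omega> / (lam - \<omega>))\<^sup>2 * norm1 m u * norm1 m v"
      proof -
        have "1 + \<omega> / (lam - \<omega>) = lam / (lam - \<omega>)" using elim by (simp add: field_simps)
        then show ?thesis by (simp add: power_divide)
      qed
      ultimately show ?case by (simp only: distrib_left)
    qed
  qed simp
  then show "inner2 m g v \<le> inner2 m u k + C * norm1 m u * norm1 m v" by simp
qed

(* The derivative in s of (T s u | adj (T0 (t - s)) v) is controlled by the form bound. Averaging
   over time intervals of length h puts u and v into the domains. *)
lemma semigroup_bound_of_form_bound:
  assumes fb: "form_bound C" and C: "0 \<le> C" and t: "0 < t"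
    and u: "u \<in> L2 m" "u \<in> L1 m" "nonneg_ae m u"
  shows "AE x in m. T t u x \<le> T0 t u x + C * M\<^sup>2 * t * exp (\<omega> * t) * norm1 m u"
proof (rule sigma_finite_measure.AE_le_by_duality[OF sf])
  show "T t u \<in> L2 m" "T0 t u \<in> L2 m" using u t by auto
  fix v assume v: "v \<in> L2 m" "v \<in> L1 m" "nonneg_ae m v"
  let ?f = "T.orb u" and ?e = "T0.adj_orb v"
  interpret U: strong_curve m ?f by (rule T.strong_curve_orb[OF u(1)])
  interpret V: weak_curve m ?e by (rule T0.weak_curve_adj_orb[OF v(1)])
  \<comment> \<open>An average over \<open>[s, s + h]\<close> sees times after \<open>s\<close>; the
    factor \<open>exp (\<bar>\<omega>\<bar> * h)\<close> absorbs them for either sign of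
    \<open>\<omega>\<close>. It enters \<open>c\<close> squared, once for each averaged orbit, and
    tends to 1 with \<open>h\<close>.\<close>
  have exp_le: "exp (\<omega> * r) \<le> exp (\<omega> * s) * exp (\<bar>\<omega>\<bar> * h)" if "r \<in> {s..s + h}" for r s h
  proof -
    have "\<omega> * r = \<omega> * s + \<omega> * (r - s)" by (simp add: algebra_simps)
    also have "\<omega> * (r - s) \<le> \<bar>\<omega>\<bar> * h" using that by (intro mult_mono) auto
    finally show ?thesis by (simp flip: exp_add)
  qed
  define c where "c h = C * M\<^sup>2 * exp (\<omega> * t) * (exp (\<bar>\<omega>\<bar> * h))\<^sup>2 * norm1 m u * norm1 m v" for h
  have key: "inner2 m (wavg m ?f h t) (wavg m ?e h 0) \<le> inner2 m (wavg m ?f h 0) (wavg m ?e h t) + t * c h"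
    if h: "0 < h" for h
  proof -
    define f' where "f' s = (\<lambda>x. (?f (s + h) x - ?f s x) / h)" for s
    define e' where "e' s = (\<lambda>x. (?e (s + h) x - ?e s x) / h)" for s
    define \<phi> where "\<phi> s = inner2 m (wavg m ?f h s) (wavg m ?e h (t - s))" for s
    have f'L: "f' s \<in> L2 m" and e'L: "e' s \<in> L2 m" for s unfolding f'_def e'_def by auto
    have d\<phi>: "(\<phi> has_real_derivative inner2 m (f' s) (wavg m ?e h (t - s)) + inner2 m (wavg m ?f h s) (\<lambda>x. (-1) * e' (t - s) x)) (at s)" for s
      unfolding \<phi>_def
    proof -
      obtain B where B: "\<And>r. r \<in> {t - s - 1..t - s + 1 + h} \<Longrightarrow> norm2 m (?e r) \<le> B" using V.f_bdd by meson
      show "((\<lambda>s. inner2 m (wavg m ?f h s) (wavg m ?e h (t - s))) has_real_derivative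
          inner2 m (f' s) (wavg m ?e h (t - s)) + inner2 m (wavg m ?f h s) (\<lambda>x. (-1) * e' (t - s) x)) (at s)"
      proof (rule inner2_curves_deriv[where B = B])
        show "((\<lambda>r. norm2 m (\<lambda>x. wavg m ?f h r x - wavg m ?f h s x - (r - s) * f' s x) / \<bar>r - s\<bar>) \<longlongrightarrow> 0) (at s)"
          unfolding f'_def by (rule U.wavg_strong_deriv[OF h])
        fix x assume x: "x \<in> L2 m"
        have "((\<lambda>r. t - r) has_real_derivative -1) (at s)" by (auto intro!: derivative_eq_intros)
        from DERIV_chain2[OF V.inner2_wavg_deriv[OF h x] this]
        show "((\<lambda>r. inner2 m (wavg m ?e h (t - r)) x) has_real_derivative inner2 m (\<lambda>x. (-1) * e' (t - s) x) x) (at s)"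
          unfolding inner2_scale_left e'_def by (simp add: mult.commute)
      next
        have "norm2 m (wavg m ?e h (t - r)) \<le> B" if "dist r s < 1" for r
          by (rule V.norm2_wavg_le[OF h]) (use that B in \<open>auto simp: dist_real_def abs_less_iff\<close>)
        then show "\<forall>\<^sub>F r in at s. norm2 m (wavg m ?e h (t - r)) \<le> B"
          by (auto simp: eventually_at intro!: exI[of _ "1::real"])
      qed (use h f'L in auto)
    qed
    \<comment> \<open>The mean value theorem takes the place of integration over
      \<open>[0, t]\<close>: the bound on the derivative does not depend on \<open>s\<close>, so a
      single intermediate point suffices and integrability of the derivative is no issue.\<close>
    obtain s where s: "0 < s" "s < t" and mvt: "\<phi> t - \<phi> 0 = (t - 0) *
        (inner2 m (f' s) (wavg m ?e h (t - s)) + inner2 m (wavg m ?f h s) (\<lambda>x. (-1) * e' (t - s) x))"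
      using MVT2[of 0 t \<phi>, OF t d\<phi>] by auto
    define Us where "Us = wavg m ?f h s"
    define Vs where "Vs = wavg m ?e h (t - s)"
    have U1: "Us \<in> L1 m" "norm1 m Us \<le> M * (exp (\<omega> * s) * exp (\<bar>\<omega>\<bar> * h)) * norm1 m u"
    proof -
      have *: "?f r \<in> L1 m \<and> norm1 m (?f r) \<le> M * (exp (\<omega> * s) * exp (\<bar>\<omega>\<bar> * h)) * norm1 m u"
        if r: "r \<in> {s..s + h}" for r
      proof -
        have "0 \<le> r" using r s by simp
        then have "?f r \<in> L1 m \<and> norm1 m (?f r) \<le> M * exp (\<omega> * r) * norm1 m u"
          using T_L1[OF _ u(1,2)] by (simp add: T.orb_eq)
        moreover have "M * exp (\<omega> * r) * norm1 m u \<le> M * (exp (\<omega> * s) * exp (\<bar>\<omega>\<bar> * h)) * norm1 m u"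
          using exp_le[OF r] M by (intro mult_right_mono mult_left_mono) auto
        ultimately show ?thesis by linarith
      qed
      show "Us \<in> L1 m" "norm1 m Us \<le> M * (exp (\<omega> * s) * exp (\<bar>\<omega>\<bar> * h)) * norm1 m u"
        unfolding Us_def using U.wavg_L1[OF sf h T.orb_pos[OF u(1,3)] *] by blast+
    qed
    have V1: "Vs \<in> L1 m" "norm1 m Vs \<le> M * (exp (\<omega> * (t - s)) * exp (\<bar>\<omega>\<bar> * h)) * norm1 m v"
    proof -
      have *: "?e r \<in> L1 m \<and> norm1 m (?e r) \<le> M * (exp (\<omega> * (t - s)) * exp (\<bar>\<omega>\<bar> * h)) * norm1 m v"
        if r: "r \<in> {t - s..t - s + h}" for r
      proof -
        have "0 \<le> r" using r s by simp
        then have "?e r \<in> L1 m \<and> norm1 m (?e r) \<le> M * exp (\<omega> * r) * norm1 m v"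
          using T0_L1[OF _ v(1,2)] by (simp add: T0.adj_orb_eq)
        moreover have "M * exp (\<omega> * r) * norm1 m v \<le> M * (exp (\<omega> * (t - s)) * exp (\<bar>\<omega>\<bar> * h)) * norm1 m v"
          using exp_le[OF r] M by (intro mult_right_mono mult_left_mono) auto
        ultimately show ?thesis by linarith
      qed
      show "Vs \<in> L1 m" "norm1 m Vs \<le> M * (exp (\<omega> * (t - s)) * exp (\<bar>\<omega>\<bar> * h)) * norm1 m v"
        unfolding Vs_def using V.wavg_L1[OF sf h T0.adj_orb_pos[OF v(1,3)] *] by blast+
    qed
    have "(Us, f' s) \<in> T.A" unfolding Us_def f'_def
      by (rule T.wavg_orb_generator[OF u(1) h]) (use s in simp)
    moreover have "(Vs, e' (t - s)) \<in> adjoint_op m T0.A" unfolding Vs_def e'_def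
      by (rule T0.wavg_adj_orb_generator[OF v(1) h]) (use s in simp)
    moreover have "nonneg_ae m Us" "nonneg_ae m Vs"
      unfolding Us_def Vs_def
      using U.wavg_nonneg[OF h T.orb_pos[OF u(1,3)]] V.wavg_nonneg[OF h T0.adj_orb_pos[OF v(1,3)]] by auto
    ultimately have "inner2 m (f' s) Vs \<le> inner2 m Us (e' (t - s)) + C * norm1 m Us * norm1 m Vs"
      using fb U1 V1 unfolding form_bound_def by blast
    also have "C * norm1 m Us * norm1 m Vs = C * (norm1 m Us * norm1 m Vs)" by simp
    also have "\<dots> \<le> C * ((M * (exp (\<omega> * s) * exp (\<bar>\<omega>\<bar> * h)) * norm1 m u) * (M * (exp (\<omega> * (t - s)) * exp (\<bar>\<omega>\<bar> * h)) * norm1 m v))"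
      using U1 V1 C M by (intro mult_left_mono mult_mono) auto
    also have "\<dots> = C * M\<^sup>2 * (exp (\<omega> * s) * exp (\<omega> * (t - s))) * (exp (\<bar>\<omega>\<bar> * h))\<^sup>2 * norm1 m u * norm1 m v"
      by (simp add: power2_eq_square mult_ac)
    also have "exp (\<omega> * s) * exp (\<omega> * (t - s)) = exp (\<omega> * t)"
      by (simp add: algebra_simps flip: exp_add)
    finally have "inner2 m (f' s) Vs + inner2 m Us (\<lambda>x. (-1) * e' (t - s) x) \<le> c h"
      unfolding inner2_scale_right c_def by simp
    then have "\<phi> t - \<phi> 0 \<le> t * c h" using mvt t unfolding Us_def Vs_def by simp
    then show ?thesis by (simp add: \<phi>_def)
  qed
  \<comment> \<open>Both factors move with \<open>h\<close>. The average of the \<open>T\<close>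
    orbit converges in norm, that of the adjoint orbit weakly and with bounded norms, which is
    enough for their pairing.\<close>
  have lim: "((\<lambda>h. inner2 m (wavg m ?f h s) (wavg m ?e h r)) \<longlongrightarrow> inner2 m (?f s) (?e r)) (at_right 0)" for s r
  proof -
    obtain B where B: "\<And>\<sigma>. \<sigma> \<in> {r..r + 1} \<Longrightarrow> norm2 m (?e \<sigma>) \<le> B" using V.f_bdd by meson
    have "norm2 m (wavg m ?e h r) \<le> B" if "0 < h" "h < 1" for h
      by (rule V.norm2_wavg_le[OF that(1)]) (use that B in auto)
    then have "\<forall>\<^sub>F h in at_right 0. norm2 m (wavg m ?e h r) \<le> B"
      by (auto simp: eventually_at_right_field intro!: exI[of _ "1::real"])
    then show ?thesis
      by (intro inner2_strong_weak_tendsto[OF _ _ _ U.wavg_strong_tendsto V.inner2_wavg_tendsto]) auto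
  qed
  have "((\<lambda>h. c h) \<longlongrightarrow> c 0) (at_right 0)" unfolding c_def by (intro tendsto_intros)
  then have lim0: "((\<lambda>h. inner2 m (wavg m ?f h 0) (wavg m ?e h t) + t * c h) \<longlongrightarrow> inner2 m (?f 0) (?e t) + t * c 0) (at_right 0)"
    by (intro tendsto_intros lim)
  have "inner2 m (?f t) (?e 0) \<le> inner2 m (?f 0) (?e t) + t * c 0"
  proof (rule tendsto_le[OF _ lim0 lim])
    show "\<forall>\<^sub>F h in at_right 0. inner2 m (wavg m ?f h t) (wavg m ?e h 0)
        \<le> inner2 m (wavg m ?f h 0) (wavg m ?e h t) + t * c h"
      using eventually_at_right_less[of "0::real"] by (rule eventually_mono) (rule key)
  qed simp
  moreover have "inner2 m (?f t) (?e 0) = inner2 m (T t u) v"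
  proof -
    have "inner2 m (?e 0) (?f t) = inner2 m (T0.orb (?f t) 0) v"
      by (rule T0.inner2_adj_orb) (use u v in auto)
    also have "\<dots> = inner2 m (?f t) v" by (rule T0.inner2_orb_zero) (use u v in auto)
    finally show ?thesis using t by (simp add: inner2_commute T.orb_eq)
  qed
  moreover have "inner2 m (?f 0) (?e t) = inner2 m (T0 t u) v"
    using t u v T0.inner2_adj_orb[OF v(1) u(1), of t]
    by (simp add: T.inner2_orb_zero T0.orb_eq inner2_commute[of m u])
  moreover have "t * c 0 = C * M\<^sup>2 * t * exp (\<omega> * t) * norm1 m u * norm1 m v" by (simp add: c_def)
  ultimately show "inner2 m (T t u) v \<le> inner2 m (T0 t u) v + C * M\<^sup>2 * t * exp (\<omega> * t) * norm1 m u * norm1 m v"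
    by simp
qed

end

theorem theorem2p1:
  fixes m :: "'a measure"
    and T T0 :: "real \<Rightarrow> ('a \<Rightarrow> real) \<Rightarrow> ('a \<Rightarrow> real)"
    and M \<omega> :: real
  assumes "sigma_finite_measure m"
    and "C0_semigroup m T0" and "positive_semigroup m T0"
    and "C0_semigroup m T" and "positive_semigroup m T"
    and "1 \<le> M"
    and "\<forall>t\<ge>0. \<forall>u\<in>L2 m \<inter> L1 m.
           T t u \<in> L1 m \<and> norm1 m (T t u) \<le> M * exp (\<omega> * t) * norm1 m u"
    and "\<forall>t\<ge>0. \<forall>v\<in>L2 m \<inter> L1 m.
           op_apply (adjoint_op m (graph_of m (T0 t))) v \<in> L1 m \<and>
           norm1 m (op_apply (adjoint_op m (graph_of m (T0 t))) v) \<le> M * exp (\<omega> * t) * norm1 m v"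
  defines "A \<equiv> generator m T" and "A0 \<equiv> generator m T0"
  defines "cond_a \<equiv> \<exists>C1::real. \<forall>t\<ge>0. \<forall>u\<in>L2 m \<inter> L1 m. nonneg_ae m u \<longrightarrow>
             (AE x in m. T t u x \<le> T0 t u x + C1 * t * exp (\<omega> * t) * norm1 m u)"
    and "cond_b \<equiv> \<exists>C2::real. \<forall>u\<in>Domain A \<inter> L1 m. \<forall>v\<in>Domain (adjoint_op m A0) \<inter> L1 m.
             nonneg_ae m u \<longrightarrow> nonneg_ae m v \<longrightarrow>
             inner2 m (op_apply A u) v
               \<le> inner2 m u (op_apply (adjoint_op m A0) v) + C2 * norm1 m u * norm1 m v"
    and "cond_c \<equiv> \<exists>C3::real. \<forall>lam>\<omega>. lam \<in> right_of_spectra m A A0 \<longrightarrow>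
             (\<forall>u\<in>L2 m \<inter> L1 m. nonneg_ae m u \<longrightarrow>
               (AE x in m. op_apply (resolvent m A lam) u x
                  \<le> op_apply (resolvent m A0 lam) u x + C3 / (lam - \<omega>)\<^sup>2 * norm1 m u))"
  shows "(cond_a \<longleftrightarrow> cond_b) \<and> (cond_b \<longleftrightarrow> cond_c)"
proof -
  interpret semigroup_pair m T T0 M \<omega>
  proof (intro semigroup_pair.intro semigroup_pair_axioms.intro pos_semigroup.intro)
    show "T t u \<in> L1 m \<and> norm1 m (T t u) \<le> M * exp (\<omega> * t) * norm1 m u"
      if "0 \<le> t" "u \<in> L2 m" "u \<in> L1 m" for t u
      using assms(7) that by blast
    show "adj m (T0 t) v \<in> L1 m \<and> norm1 m (adj m (T0 t) v) \<le> M * exp (\<omega> * t) * norm1 m v"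
      if "0 \<le> t" "v \<in> L2 m" "v \<in> L1 m" for t v
      using assms(8) that by blast
  qed (fact assms)+
  have b_iff: "cond_b \<longleftrightarrow> (\<exists>C. form_bound C)"
  proof
    assume cond_b
    then obtain C where C: "\<And>u v. u \<in> Domain A \<Longrightarrow> u \<in> L1 m \<Longrightarrow> v \<in> Domain (adjoint_op m A0) \<Longrightarrow> v \<in> L1 m \<Longrightarrow>
      nonneg_ae m u \<Longrightarrow> nonneg_ae m v \<Longrightarrow>
      inner2 m (op_apply A u) v \<le> inner2 m u (op_apply (adjoint_op m A0) v) + C * norm1 m u * norm1 m v"
      unfolding cond_b_def by blast
    have "form_bound C" unfolding form_bound_def
    proof (intro allI impI)
      fix u g v k
      assume ug: "(u, g) \<in> T.A" and vk: "(v, k) \<in> adjoint_op m T0.A" and L1: "u \<in> L1 m" "v \<in> L1 m"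
        and pos: "nonneg_ae m u" "nonneg_ae m v"
      have "u \<in> Domain A" "v \<in> Domain (adjoint_op m A0)" using ug vk by (auto simp: A_def A0_def)
      from C[OF this(1) L1(1) this(2) L1(2) pos]
      show "inner2 m g v \<le> inner2 m u k + C * norm1 m u * norm1 m v"
        using T.inner2_op_apply_generator[OF ug adjoint_opD(1)[OF vk]]
          T0.inner2_op_apply_adjoint[OF vk T.generatorD(1)[OF ug]] by (simp add: A_def A0_def)
    qed
    then show "\<exists>C. form_bound C" by blast
  next
    assume "\<exists>C. form_bound C"
    then obtain C where C: "form_bound C" by blast
    show cond_b unfolding cond_b_def
    proof (intro exI[of _ C] ballI impI)
      fix u v assume uv: "u \<in> Domain A \<inter> L1 m" "v \<in> Domain (adjoint_op m A0) \<inter> L1 m"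
        and pos: "nonneg_ae m u" "nonneg_ae m v"
      have "(u, op_apply A u) \<in> A" "(v, op_apply (adjoint_op m A0) v) \<in> adjoint_op m A0"
        using uv by (auto intro: op_apply_mem)
      with C uv pos show "inner2 m (op_apply A u) v
          \<le> inner2 m u (op_apply (adjoint_op m A0) v) + C * norm1 m u * norm1 m v"
        unfolding form_bound_def A_def A0_def by blast
    qed
  qed
  have right: "lam \<in> right_of_spectra m A A0 \<longleftrightarrow> {lam..} \<subseteq> T.\<rho> \<and> {lam..} \<subseteq> T0.\<rho>" for lam
    by (simp add: right_of_spectra_def A_def A0_def)
  have "cond_a \<Longrightarrow> \<exists>C. form_bound C"
  proof -
    assume cond_a
    then obtain C where "\<And>t u. 0 \<le> t \<Longrightarrow> u \<in> L2 m \<Longrightarrow> u \<in> L1 m \<Longrightarrow> nonneg_ae m u \<Longrightarrow>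
        AE x in m. T t u x \<le> T0 t u x + C * t * exp (\<omega> * t) * norm1 m u"
      unfolding cond_a_def by blast
    then have "form_bound C" by (rule form_bound_of_semigroup_bound)
    then show ?thesis by blast
  qed
  moreover have "cond_a" "cond_c" if "\<exists>C. form_bound C"
  proof -
    \<comment> \<open>A nonnegative constant is needed because upper bounds on the product of the
      two \<open>L1\<close> norms are going to be multiplied by it.\<close>
    from that obtain C where C: "0 \<le> C" "form_bound C" using form_bound_mono by (meson max.cobounded1 max.cobounded2)
    have "AE x in m. T t u x \<le> T0 t u x + C * M\<^sup>2 * t * exp (\<omega> * t) * norm1 m u"
      if t: "0 \<le> t" and u: "u \<in> L2 m" "u \<in> L1 m" "nonneg_ae m u" for t u
    \<comment> \<open>At time 0 both semigroups act as the identity; the mean value argument covers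
      only \<open>0 < t\<close>.\<close>
    proof (cases "t = 0")
      case True
      from T.T_zero[OF u(1)] T0.T_zero[OF u(1)] show ?thesis
        unfolding True by eventually_elim simp
    next
      case False
      then show ?thesis using t u by (intro semigroup_bound_of_form_bound C) auto
    qed
    then show cond_a unfolding cond_a_def by blast
    show cond_c unfolding cond_c_def right
    proof (intro exI[of _ "C * M\<^sup>2"] allI impI ballI)
      fix lam u
      assume "\<omega> < lam" "{lam..} \<subseteq> T.\<rho> \<and> {lam..} \<subseteq> T0.\<rho>" "u \<in> L2 m \<inter> L1 m" "nonneg_ae m u"
      then show "AE x in m. op_apply (resolvent m A lam) u x
          \<le> op_apply (resolvent m A0 lam) u x + C * M\<^sup>2 / (lam - \<omega>)\<^sup>2 * norm1 m u"
        unfolding A_def A0_def by (intro resolvent_bound_of_form_bound C) auto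
    qed
  qed
  moreover have "\<exists>C. form_bound C" if cond_c
  proof -
    from that obtain C where C: "\<And>lam u. {lam..} \<subseteq> T.\<rho> \<Longrightarrow> {lam..} \<subseteq> T0.\<rho> \<Longrightarrow> \<omega> < lam \<Longrightarrow>
      u \<in> L2 m \<Longrightarrow> u \<in> L1 m \<Longrightarrow> nonneg_ae m u \<Longrightarrow>
      AE x in m. T.R lam u x \<le> T0.R lam u x + C / (lam - \<omega>)\<^sup>2 * norm1 m u"
      unfolding cond_c_def right unfolding A_def A0_def by blast
    show ?thesis by (rule exI[of _ C], rule form_bound_of_resolvent_bound) (fact C)
  qed
  ultimately show ?thesis using b_iff by blast
qed

end
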